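(* (i) Every completely $0$-simple semigroup $S=\mathscr{M}^\circ(G;I,L;P)$ (in Rees matrix form) determines a cross-connection $(\mathbb{L}(S),\mathbb{R}(S);\Gamma_P,\Delta_P)$ between the completely unambiguous categories $\mathbb{L}(S)$ and $\mathbb{R}(S)$ of principal left, respectively right, ideals of $S$, where the functors $\Gamma_P\colon\mathbb{R}(S)\to\mathbb{L}(S)^*$ and $\Delta_P\colon\mathbb{L}(S)\to\mathbb{R}(S)^*$ are given by the matrix $P$ as described in the context. (ii) Conversely, given two arbitrary sets $L,I$ and a $0$-group $G^\circ=G\cup\{0\}$, one can define two completely unambiguous categories $\mathcal{C}=\mathcal{C}(G,L)$ and $\mathcal{D}=\mathcal{D}(G,I)$ (described in the context) such that an arbitrary regular $L\times I$ matrix $P$ with entries from $G^\circ$ determines a unique cross-connection $(\mathcal{C},\mathcal{D};\Gamma_P,\Delta_P)$; the cross-connection semigroup so obtained is the completely $0$-simple semigroup $\mathscr{M}^\circ(G;I,L;P)$.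
   Context: Rees matrix semigroups. For a group $G$, sets $I,L$ and an $L\times I$ matrix $P=(p_{\ell i})$ over $G^\circ=G\cup\{0\}$ that is regular (no row or column consists entirely of zeros), $\mathscr{M}^\circ(G;I,L;P)=(I\times G\times L)\cup\{0\}$ with $(i,a,\ell)(j,b,k)=(i,ap_{\ell j}b,k)$ if $p_{\ell j}\ne0$, and all other products equal to $0$. Categories with subobjects. Morphisms are composed left to right; $v\mathcal{C}$ is the object set. A category with subobjects is a pair $(\mathcal{C},\mathcal{P})$, $\mathcal{C}$ a small category and $\mathcal{P}$ a subcategory with $v\mathcal{P}=v\mathcal{C}$, such that (1) $\mathcal{P}$ is a strict preorder (at most one morphism from any object to another, only identities are isomorphisms in $\mathcal P$); (2) morphisms of $\mathcal{P}$ are monomorphisms in $\mathcal{C}$; (3) if $\varphi,\psi\in\mathcal{P}$ and $\varphi=\alpha\psi$ with $\alpha\in\mathcal{C}$, then $\alpha\in\mathcal{P}$. Morphisms of $\mathcal{P}$ are inclusions, written $\iota(c',c)$ when $c'\subseteq c$. A retraction is a morphism $\theta\colon c\to c'$ with $\iota(c',c)\theta=1_{c'}$. A normal factorisation is $\varphi=\theta\sigma\iota$ (retraction, isomorphism, inclusion), and $\varphi^\circ=\theta\sigma$. A normal cone with apex $d$ is a map $\gamma\colon v\mathcal{C}\to\mathcal{C}$, $\gamma(a)\in\mathcal{C}(a,d)$, with $\iota(a,b)\gamma(b)=\gamma(a)$ for $a\subseteq b$ and some component an isomorphism; $c_\gamma$ is its apex. $\mathcal{C}$ is unambiguous if it is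 a category with subobjects, every inclusion splits uniquely (has a unique retraction), every morphism has a unique normal factorisation, and for each $c$ there is a normal cone $\mu$ with $\mu(c)=1_c$. $\gamma\ast\varphi$ denotes the cone $c\mapsto\gamma(c)\varphi$ ($\varphi$ an epimorphism with domain $c_\gamma$). The set $\widehat{\mathcal{C}}$ of normal cones is a semigroup under $\gamma\cdot\delta=\gamma\ast(\delta(c_\gamma))^\circ$, with idempotents the cones $\mu$ with $\mu(c_\mu)=1_{c_\mu}$. Duals and cross-connections. For an idempotent cone $\mu$: $H(\mu;c)=\{\mu\ast f^\circ:f\in\mathcal{C}(c_\mu,c)\}$, $H(\mu;g)\colon\mu\ast f^\circ\mapsto\mu\ast(fg)^\circ$; $\eta_\mu\colon H(\mu;-)\to\mathcal{C}(c_\mu,-)$, $\mu\ast f^\circ\mapsto f$, is a natural isomorphism. The dual $\mathcal{C}^*$ is the full subcategory of $[\mathcal{C},\mathbf{Set}]$ on these $H$-functors, with componentwise set inclusions as inclusions. $MH(\mu;-)=\{c:\mu(c)\text{ is an isomorphism}\}$. A local isomorphism is an inclusion preserving, fully faithful functor $F$ between unambiguous categories that restricts, for each object $c$, to an isomorphism from the full subcategory on $\{d: d\subseteq c\}$ onto the full subcategory on $\{d: d\subseteq F(c)\}$. A cross-connection is $\Omega=(\mathcal{C},\mathcal{D};\Gamma,\Delta)$ with $\mathcal{C},\mathcal{D}$ unambiguous and $\Gamma\colon\mathcal{D}\to\mathcal{C}^*$, $\Delta\colon\mathcal{C}\to\mathcal{D}^*$ local isomorphisms such that $c\in M\Gamma(d)\iff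 d\in M\Delta(c)$ for all $c\in v\mathcal{C}$, $d\in v\mathcal{D}$. The cross-connection semigroup. Put $E_\Omega=\{(c,d):c\in M\Gamma(d)\}$; for $(c,d)\in E_\Omega$, $\gamma(c,d)$ is the unique idempotent cone in $\mathcal{C}$ with apex $c$ and $H(\gamma(c,d);-)=\Gamma(d)$, and $\delta(c,d)$ the unique idempotent cone in $\mathcal{D}$ with apex $d$ and $H(\delta(c,d);-)=\Delta(c)$. For $(c',d),(c,d')\in E_\Omega$ and $f\in\mathcal{C}(c',c)$ the transpose $f^\dagger\in\mathcal{D}(d',d)$ is the unique morphism with $\Delta(f)\eta_{\delta(c,d')}=\eta_{\delta(c',d)}\mathcal{D}(f^\dagger,-)$, where $\mathcal{D}(f^\dagger,-)\colon h\mapsto f^\dagger h$. Write $\Gamma(c,d)=\Gamma(d)(c)$ and $\Delta(c,d)=\Delta(c)(d)$ for the associated bifunctors $\mathcal{C}\times\mathcal{D}\to\mathbf{Set}$, and let $\chi(c,d)\colon\Gamma(c,d)\to\Delta(c,d)$ be the map $\gamma(c',d)\ast f^\circ\mapsto\delta(c,d')\ast(f^\dagger)^\circ$ (where $c'\in M\Gamma(d)$, $d'\in M\Delta(c)$, $f\in\mathcal{C}(c',c)$); it is quoted as a theorem of Nambooripad that $\chi(c,d)$ is a bijection and that $\chi$ is a natural isomorphism of the bifunctors. The cross-connection semigroup $\mathbb{S}\Omega$ is the set of all linked pairs $(\gamma,\delta)\in\widehat{\mathcal{C}}\times\widehat{\mathcal{D}}$, i.e. pairs with $\gamma\in\Gamma(c,d)$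 and $\delta=\chi(c,d)(\gamma)$ for some $(c,d)\in v\mathcal{C}\times v\mathcal{D}$, with product $(\gamma,\delta)\circ(\gamma',\delta')=(\gamma\cdot\gamma',\delta'\cdot\delta)$. The categories. For a regular semigroup $S$, $\mathbb{L}(S)$ has objects $Se$ ($e=e^2\in S$) and morphisms $\rho(e,u,f)\colon Se\to Sf$, $x\mapsto xu$, $u\in eSf$; $\mathbb{R}(S)$ has objects $eS$ and morphisms $\lambda(e,u,f)\colon eS\to fS$, $x\mapsto ux$, $u\in fSe$; inclusions are the inclusion maps of ideals. The unambiguous categories arising in this way from completely $0$-simple semigroups are called completely unambiguous. $\mathcal{C}(G,L)$ has objects $L\cup\{0\}$; for $\ell,k\in L$ the morphisms $\ell\to k$ are $\rho_g$, $g\in G^\circ$; there is exactly one morphism, denoted $\rho_0$, between $0$ and any object in either direction; composition is $\rho_g\rho_h=\rho_{gh}$; the inclusions are the identities and the morphisms $0\to\ell$. $\mathcal{D}(G,I)$ has objects $I\cup\{0\}$, morphisms $\lambda_g$ ($g\in G^\circ$) between nonzero objects, a unique morphism $\lambda_0$ from and to $0$, composition (left to right) $\lambda_g\lambda_h=\lambda_{hg}$, and inclusions the identities and $0\to i$. For $S=\mathscr{M}^\circ(G;I,L;P)$, $\mathbb{L}(S)$ is identified with $\mathcal{C}(G,L)$ by $S(i,a,\ell)\leftrightarrow\ell$, with $\rho_g\colon\ell\to k$ being the map $(i,a,\ell)\mapsto(i,ag,k)$ (read as $0$ if $g=0$); $\mathbb{R}(S)$ is identified with $\mathcal{D}(G,I)$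 by $(i,a,\ell)S\leftrightarrow i$, with $\lambda_g\colon i\to j$ being $(i,a,\ell)\mapsto(j,ga,\ell)$ (read as $0$ if $g=0$). Normal cones of $\mathcal{C}(G,L)$ with apex $\ell\in L$ correspond to pairs $((g_\alpha)_{\alpha\in L};\ell)$, $g_\alpha\in G^\circ$ not all $0$, with component $\rho_{g_\alpha}$ at $\alpha$; there is one normal cone $\gamma_0$ with apex $0$. The $H$-functor of an idempotent cone with tuple $g=(g_\alpha)$ is determined by the class $gG^\circ$ and takes the value $\{(gx;k):x\in G\}\cup\{\gamma_0\}$ at $k\in L$ and $\{\gamma_0\}$ at $0$; it is denoted $gG^\circ$. The $H$-functor of $\gamma_0$, constantly $\{\gamma_0\}$, is denoted $\gamma_0G^\circ$. Dually, the $H$-functors of $\mathcal{D}(G,I)$ are denoted $G^\circ g$, $g\in(G^\circ)^I$ nonzero, and $G^\circ\delta_0$. The functors. $\Gamma_P$ sends $i\in I$ to $p_iG^\circ$, where $p_i$ is the $i$-th column of $P$, sends $0$ to $\gamma_0G^\circ$, and sends $\lambda_g\colon i\to j$ to the natural transformation $\sigma_g\colon(p_ix;k)\mapsto(p_jgx;k)$ (read as $\gamma_0$ if $g=0$), and $\lambda_0$ to the corresponding zero transformation $\sigma_0$. $\Delta_P$ sends $\ell\in L$ to $G^\circ p_\ell$, where $p_\ell$ is the $\ell$-th row of $P$, sends $0$ to $G^\circ\delta_0$, and sends $\rho_g\colon\ell\to k$ to $\tau_g\colon(xp_\ell;i)\mapsto(xgp_k;i)$ (read as $\delta_0$ if $g=0$),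 and $\rho_0$ to $\tau_0$. *)

theory Defs
  imports "HOL-Algebra.Group"
begin

section \<open>Semigroups\<close>

record 'a sgrp = "'a partial_object" +
  smul :: "'a \<Rightarrow> 'a \<Rightarrow> 'a"  (infixl \<open>\<cdot>\<index>\<close> 70)

definition is_semigroup :: "('a, 'x) sgrp_scheme \<Rightarrow> bool" where
  "is_semigroup S \<longleftrightarrow>
     (\<forall>x\<in>carrier S. \<forall>y\<in>carrier S. x \<cdot>\<^bsub>S\<^esub> y \<in> carrier S) \<and>
     (\<forall>x\<in>carrier S. \<forall>y\<in>carrier S. \<forall>z\<in>carrier S.
        (x \<cdot>\<^bsub>S\<^esub> y) \<cdot>\<^bsub>S\<^esub> z = x \<cdot>\<^bsub>S\<^esub> (y \<cdot>\<^bsub>S\<^esub> z))"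

definition idems :: "('a, 'x) sgrp_scheme \<Rightarrow> 'a set" where
  "idems S = {e \<in> carrier S. e \<cdot>\<^bsub>S\<^esub> e = e}"

definition is_zero :: "('a, 'x) sgrp_scheme \<Rightarrow> 'a \<Rightarrow> bool" where
  "is_zero S z \<longleftrightarrow> z \<in> carrier S \<and> (\<forall>x\<in>carrier S. x \<cdot>\<^bsub>S\<^esub> z = z \<and> z \<cdot>\<^bsub>S\<^esub> x = z)"

definition is_ideal :: "('a, 'x) sgrp_scheme \<Rightarrow> 'a set \<Rightarrow> bool" where
  "is_ideal S A \<longleftrightarrow> A \<noteq> {} \<and> A \<subseteq> carrier S \<and>
     (\<forall>a\<in>A. \<forall>x\<in>carrier S. a \<cdot>\<^bsub>S\<^esub> x \<in> A \<and> x \<cdot>\<^bsub>S\<^esub> a \<in> A)"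

definition zero_simple :: "('a, 'x) sgrp_scheme \<Rightarrow> 'a \<Rightarrow> bool" where
  "zero_simple S z \<longleftrightarrow> is_semigroup S \<and> is_zero S z \<and>
     (\<exists>x\<in>carrier S. \<exists>y\<in>carrier S. x \<cdot>\<^bsub>S\<^esub> y \<noteq> z) \<and>
     (\<forall>A. is_ideal S A \<longrightarrow> A = {z} \<or> A = carrier S)"

definition primitive_idem :: "('a, 'x) sgrp_scheme \<Rightarrow> 'a \<Rightarrow> 'a \<Rightarrow> bool" where
  "primitive_idem S z e \<longleftrightarrow> e \<in> idems S \<and> e \<noteq> z \<and>
     (\<forall>f\<in>idems S. f \<noteq> z \<and> e \<cdot>\<^bsub>S\<^esub> f = f \<and> f \<cdot>\<^bsub>S\<^esub> e = f \<longrightarrow> f = e)"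

definition completely_0_simple :: "('a, 'x) sgrp_scheme \<Rightarrow> bool" where
  "completely_0_simple S \<longleftrightarrow> (\<exists>z. zero_simple S z \<and> (\<exists>e. primitive_idem S z e))"

definition sgrp_isomorphic :: "('a, 'x) sgrp_scheme \<Rightarrow> ('b, 'y) sgrp_scheme \<Rightarrow> bool" where
  "sgrp_isomorphic S T \<longleftrightarrow> (\<exists>\<phi>. bij_betw \<phi> (carrier S) (carrier T) \<and>
     (\<forall>x\<in>carrier S. \<forall>y\<in>carrier S. \<phi> (x \<cdot>\<^bsub>S\<^esub> y) = \<phi> x \<cdot>\<^bsub>T\<^esub> \<phi> y))"


section \<open>Categories with subobjects\<close>

text \<open>Composition \<^term>\<open>Cmp\<close> is written left to right; \<^term>\<open>Inc\<close> is the set of inclusions,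
  i.e. the morphisms of the subcategory of subobjects.\<close>

record ('o, 'm) cat =
  Obj :: "'o set"
  Arr :: "'m set"
  Dom :: "'m \<Rightarrow> 'o"
  Cod :: "'m \<Rightarrow> 'o"
  Id  :: "'o \<Rightarrow> 'm"
  Cmp :: "'m \<Rightarrow> 'm \<Rightarrow> 'm"  (infixl \<open>\<Zsemi>\<index>\<close> 70)
  Inc :: "'m set"

definition mor :: "('o, 'm) cat \<Rightarrow> 'o \<Rightarrow> 'o \<Rightarrow> 'm set" where
  "mor C a b = {f \<in> Arr C. Dom C f = a \<and> Cod C f = b}"

definition is_category :: "('o, 'm) cat \<Rightarrow> bool" where
  "is_category C \<longleftrightarrow>
     (\<forall>f\<in>Arr C. Dom C f \<in> Obj C \<and> Cod C f \<in> Obj C) \<and>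
     (\<forall>a\<in>Obj C. Id C a \<in> mor C a a) \<and>
     (\<forall>f\<in>Arr C. \<forall>g\<in>Arr C. Cod C f = Dom C g \<longrightarrow> f \<Zsemi>\<^bsub>C\<^esub> g \<in> mor C (Dom C f) (Cod C g)) \<and>
     (\<forall>f\<in>Arr C. Id C (Dom C f) \<Zsemi>\<^bsub>C\<^esub> f = f \<and> f \<Zsemi>\<^bsub>C\<^esub> Id C (Cod C f) = f) \<and>
     (\<forall>f\<in>Arr C. \<forall>g\<in>Arr C. \<forall>h\<in>Arr C. Cod C f = Dom C g \<and> Cod C g = Dom C h \<longrightarrow>
        (f \<Zsemi>\<^bsub>C\<^esub> g) \<Zsemi>\<^bsub>C\<^esub> h = f \<Zsemi>\<^bsub>C\<^esub> (g \<Zsemi>\<^bsub>C\<^esub> h))"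

definition inverse_pair :: "('o, 'm) cat \<Rightarrow> 'm \<Rightarrow> 'm \<Rightarrow> bool" where
  "inverse_pair C f g \<longleftrightarrow> f \<in> Arr C \<and> g \<in> mor C (Cod C f) (Dom C f) \<and>
     f \<Zsemi>\<^bsub>C\<^esub> g = Id C (Dom C f) \<and> g \<Zsemi>\<^bsub>C\<^esub> f = Id C (Cod C f)"

definition is_iso :: "('o, 'm) cat \<Rightarrow> 'm \<Rightarrow> bool" where
  "is_iso C f \<longleftrightarrow> (\<exists>g. inverse_pair C f g)"

definition is_mono :: "('o, 'm) cat \<Rightarrow> 'm \<Rightarrow> bool" where
  "is_mono C f \<longleftrightarrow> f \<in> Arr C \<and>
     (\<forall>a\<in>Obj C. \<forall>g\<in>mor C a (Dom C f). \<forall>h\<in>mor C a (Dom C f). g \<Zsemi>\<^bsub>C\<^esub> f = h \<Zsemi>\<^bsub>C\<^esub> f \<longrightarrow> g = h)"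

definition cat_with_subobjects :: "('o, 'm) cat \<Rightarrow> bool" where
  "cat_with_subobjects C \<longleftrightarrow> is_category C \<and>
     Inc C \<subseteq> Arr C \<and>
     (\<forall>a\<in>Obj C. Id C a \<in> Inc C) \<and>
     (\<forall>f\<in>Inc C. \<forall>g\<in>Inc C. Cod C f = Dom C g \<longrightarrow> f \<Zsemi>\<^bsub>C\<^esub> g \<in> Inc C) \<and>
     (\<forall>f\<in>Inc C. \<forall>g\<in>Inc C. Dom C f = Dom C g \<and> Cod C f = Cod C g \<longrightarrow> f = g) \<and>
     (\<forall>f\<in>Inc C. \<forall>g\<in>Inc C. inverse_pair C f g \<longrightarrow> f = Id C (Dom C f)) \<and>
     (\<forall>f\<in>Inc C. is_mono C f) \<and>
     (\<forall>f\<in>Inc C. \<forall>g\<in>Inc C. \<forall>h\<in>mor C (Dom C f) (Dom C g). f = h \<Zsemi>\<^bsub>C\<^esub> g \<longrightarrow> h \<in> Inc C)"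

definition subobj :: "('o, 'm) cat \<Rightarrow> 'o \<Rightarrow> 'o \<Rightarrow> bool" where
  "subobj C a b \<longleftrightarrow> (\<exists>f\<in>Inc C. f \<in> mor C a b)"

definition incl :: "('o, 'm) cat \<Rightarrow> 'o \<Rightarrow> 'o \<Rightarrow> 'm" where
  "incl C a b = (THE f. f \<in> Inc C \<and> f \<in> mor C a b)"

definition is_retraction :: "('o, 'm) cat \<Rightarrow> 'm \<Rightarrow> bool" where
  "is_retraction C r \<longleftrightarrow> r \<in> Arr C \<and> subobj C (Cod C r) (Dom C r) \<and>
     incl C (Cod C r) (Dom C r) \<Zsemi>\<^bsub>C\<^esub> r = Id C (Cod C r)"

definition normal_factn :: "('o, 'm) cat \<Rightarrow> 'm \<Rightarrow> 'm \<times> 'm \<times> 'm \<Rightarrow> bool" where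
  "normal_factn C f = (\<lambda>(r, s, j).
     is_retraction C r \<and> is_iso C s \<and> j \<in> Inc C \<and>
     Cod C r = Dom C s \<and> Cod C s = Dom C j \<and> f = (r \<Zsemi>\<^bsub>C\<^esub> s) \<Zsemi>\<^bsub>C\<^esub> j)"

definition epi_part :: "('o, 'm) cat \<Rightarrow> 'm \<Rightarrow> 'm" where
  "epi_part C f = (THE q. \<exists>r s j. normal_factn C f (r, s, j) \<and> q = r \<Zsemi>\<^bsub>C\<^esub> s)"

definition normal_cone :: "('o, 'm) cat \<Rightarrow> 'o \<Rightarrow> ('o \<Rightarrow> 'm) \<Rightarrow> bool" where
  "normal_cone C d \<gamma> \<longleftrightarrow> d \<in> Obj C \<and> \<gamma> \<in> extensional (Obj C) \<and>
     (\<forall>a\<in>Obj C. \<gamma> a \<in> mor C a d) \<and>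
     (\<forall>a\<in>Obj C. \<forall>b\<in>Obj C. subobj C a b \<longrightarrow> incl C a b \<Zsemi>\<^bsub>C\<^esub> \<gamma> b = \<gamma> a) \<and>
     (\<exists>a\<in>Obj C. is_iso C (\<gamma> a))"

definition cones :: "('o, 'm) cat \<Rightarrow> ('o \<Rightarrow> 'm) set" where
  "cones C = {\<gamma>. \<exists>d. normal_cone C d \<gamma>}"

definition apex :: "('o, 'm) cat \<Rightarrow> ('o \<Rightarrow> 'm) \<Rightarrow> 'o" where
  "apex C \<gamma> = (THE d. normal_cone C d \<gamma>)"

definition unambiguous :: "('o, 'm) cat \<Rightarrow> bool" where
  "unambiguous C \<longleftrightarrow> cat_with_subobjects C \<and>
     (\<forall>j\<in>Inc C. \<exists>!r. r \<in> mor C (Cod C j) (Dom C j) \<and> j \<Zsemi>\<^bsub>C\<^esub> r = Id C (Dom C j)) \<and>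
     (\<forall>f\<in>Arr C. \<exists>!t. normal_factn C f t) \<and>
     (\<forall>c\<in>Obj C. \<exists>\<mu>\<in>cones C. \<mu> c = Id C c)"

definition cone_star :: "('o, 'm) cat \<Rightarrow> ('o \<Rightarrow> 'm) \<Rightarrow> 'm \<Rightarrow> ('o \<Rightarrow> 'm)" where
  "cone_star C \<gamma> f = (\<lambda>a\<in>Obj C. \<gamma> a \<Zsemi>\<^bsub>C\<^esub> f)"

definition cone_mult :: "('o, 'm) cat \<Rightarrow> ('o \<Rightarrow> 'm) \<Rightarrow> ('o \<Rightarrow> 'm) \<Rightarrow> ('o \<Rightarrow> 'm)" where
  "cone_mult C \<gamma> \<delta> = cone_star C \<gamma> (epi_part C (\<delta> (apex C \<gamma>)))"

definition idem_cones :: "('o, 'm) cat \<Rightarrow> ('o \<Rightarrow> 'm) set" where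
  "idem_cones C = {\<mu> \<in> cones C. \<mu> (apex C \<mu>) = Id C (apex C \<mu>)}"


section \<open>Functors, local isomorphisms\<close>

record ('o, 'm, 'p, 'n) fctr =
  FObj :: "'o \<Rightarrow> 'p"
  FArr :: "'m \<Rightarrow> 'n"

definition is_functor ::
    "('o, 'm) cat \<Rightarrow> ('p, 'n) cat \<Rightarrow> ('o, 'm, 'p, 'n) fctr \<Rightarrow> bool" where
  "is_functor C D F \<longleftrightarrow> is_category C \<and> is_category D \<and>
     FObj F \<in> Obj C \<rightarrow>\<^sub>E Obj D \<and> FArr F \<in> Arr C \<rightarrow>\<^sub>E Arr D \<and>
     (\<forall>f\<in>Arr C. Dom D (FArr F f) = FObj F (Dom C f) \<and> Cod D (FArr F f) = FObj F (Cod C f)) \<and>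
     (\<forall>a\<in>Obj C. FArr F (Id C a) = Id D (FObj F a)) \<and>
     (\<forall>f\<in>Arr C. \<forall>g\<in>Arr C. Cod C f = Dom C g \<longrightarrow>
        FArr F (f \<Zsemi>\<^bsub>C\<^esub> g) = FArr F f \<Zsemi>\<^bsub>D\<^esub> FArr F g)"

definition is_cat_iso ::
    "('o, 'm) cat \<Rightarrow> ('p, 'n) cat \<Rightarrow> ('o, 'm, 'p, 'n) fctr \<Rightarrow> bool" where
  "is_cat_iso C D F \<longleftrightarrow> is_functor C D F \<and>
     bij_betw (FObj F) (Obj C) (Obj D) \<and> bij_betw (FArr F) (Arr C) (Arr D)"

definition isomorphic_with_subobjects :: "('o, 'm) cat \<Rightarrow> ('p, 'n) cat \<Rightarrow> bool" where
  "isomorphic_with_subobjects C D \<longleftrightarrow>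
     (\<exists>F. is_cat_iso C D F \<and> FArr F ` Inc C = Inc D)"

definition full_sub :: "('o, 'm) cat \<Rightarrow> 'o set \<Rightarrow> ('o, 'm) cat" where
  "full_sub C A = C\<lparr>Obj := Obj C \<inter> A,
     Arr := {f \<in> Arr C. Dom C f \<in> A \<and> Cod C f \<in> A},
     Inc := {f \<in> Inc C. Dom C f \<in> A \<and> Cod C f \<in> A}\<rparr>"

definition down :: "('o, 'm) cat \<Rightarrow> 'o \<Rightarrow> ('o, 'm) cat" where
  "down C c = full_sub C {d \<in> Obj C. subobj C d c}"

definition local_iso ::
    "('o, 'm) cat \<Rightarrow> ('p, 'n) cat \<Rightarrow> ('o, 'm, 'p, 'n) fctr \<Rightarrow> bool" where
  "local_iso C D F \<longleftrightarrow> unambiguous C \<and> unambiguous D \<and> is_functor C D F \<and>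
     (\<forall>f\<in>Inc C. FArr F f \<in> Inc D) \<and>
     (\<forall>a\<in>Obj C. \<forall>b\<in>Obj C. bij_betw (FArr F) (mor C a b) (mor D (FObj F a) (FObj F b))) \<and>
     (\<forall>c\<in>Obj C. is_cat_iso (down C c) (down D (FObj F c))
        \<lparr>FObj = restrict (FObj F) (Obj (down C c)), FArr = restrict (FArr F) (Arr (down C c))\<rparr>)"


section \<open>The dual category\<close>

record ('o, 'm, 'x) set_functor =
  SObj :: "'o \<Rightarrow> 'x set"
  SMap :: "'m \<Rightarrow> 'x \<Rightarrow> 'x"

type_synonym ('o, 'm) hfun = "('o, 'm, 'o \<Rightarrow> 'm) set_functor"

text \<open>A natural transformation is a triple of source functor, family of components, target functor.\<close>

type_synonym ('o, 'm) htrans =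
  "('o, 'm) hfun \<times> ('o \<Rightarrow> ('o \<Rightarrow> 'm) \<Rightarrow> ('o \<Rightarrow> 'm)) \<times> ('o, 'm) hfun"

definition H_obj :: "('o, 'm) cat \<Rightarrow> ('o \<Rightarrow> 'm) \<Rightarrow> 'o \<Rightarrow> ('o \<Rightarrow> 'm) set" where
  "H_obj C \<mu> c = {cone_star C \<mu> (epi_part C f) | f. f \<in> mor C (apex C \<mu>) c}"

definition eta :: "('o, 'm) cat \<Rightarrow> ('o \<Rightarrow> 'm) \<Rightarrow> 'o \<Rightarrow> ('o \<Rightarrow> 'm) \<Rightarrow> 'm" where
  "eta C \<mu> c x = (THE f. f \<in> mor C (apex C \<mu>) c \<and> x = cone_star C \<mu> (epi_part C f))"

definition H_fun :: "('o, 'm) cat \<Rightarrow> ('o \<Rightarrow> 'm) \<Rightarrow> ('o, 'm) hfun" where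
  "H_fun C \<mu> =
     \<lparr>SObj = (\<lambda>c\<in>Obj C. H_obj C \<mu> c),
      SMap = (\<lambda>g\<in>Arr C. \<lambda>x\<in>H_obj C \<mu> (Dom C g).
                cone_star C \<mu> (epi_part C (eta C \<mu> (Dom C g) x \<Zsemi>\<^bsub>C\<^esub> g)))\<rparr>"

definition nat_trans ::
    "('o, 'm) cat \<Rightarrow> ('o, 'm, 'x) set_functor \<Rightarrow> ('o \<Rightarrow> 'x \<Rightarrow> 'x) \<Rightarrow> ('o, 'm, 'x) set_functor \<Rightarrow> bool"
  where
  "nat_trans C F \<tau> F' \<longleftrightarrow> \<tau> \<in> extensional (Obj C) \<and>
     (\<forall>c\<in>Obj C. \<tau> c \<in> SObj F c \<rightarrow>\<^sub>E SObj F' c) \<and>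
     (\<forall>f\<in>Arr C. \<forall>x\<in>SObj F (Dom C f).
        \<tau> (Cod C f) (SMap F f x) = SMap F' f (\<tau> (Dom C f) x))"

abbreviation (input) component :: "('o, 'm) htrans \<Rightarrow> 'o \<Rightarrow> ('o \<Rightarrow> 'm) \<Rightarrow> ('o \<Rightarrow> 'm)" where
  "component t \<equiv> fst (snd t)"

definition dual :: "('o, 'm) cat \<Rightarrow> (('o, 'm) hfun, ('o, 'm) htrans) cat" where
  "dual C =
     \<lparr>Obj = H_fun C ` idem_cones C,
      Arr = {(F, \<tau>, F'). F \<in> H_fun C ` idem_cones C \<and> F' \<in> H_fun C ` idem_cones C \<and>
                         nat_trans C F \<tau> F'},
      Dom = (\<lambda>(F, \<tau>, F'). F),
      Cod = (\<lambda>(F, \<tau>, F'). F'),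
      Id = (\<lambda>F. (F, \<lambda>c\<in>Obj C. \<lambda>x\<in>SObj F c. x, F)),
      Cmp = (\<lambda>(F, \<tau>, _) (_, \<tau>', F'). (F, \<lambda>c\<in>Obj C. compose (SObj F c) (\<tau>' c) (\<tau> c), F')),
      Inc = {(F, \<tau>, F'). F \<in> H_fun C ` idem_cones C \<and> F' \<in> H_fun C ` idem_cones C \<and>
                         nat_trans C F \<tau> F' \<and>
                         (\<forall>c\<in>Obj C. SObj F c \<subseteq> SObj F' c \<and> (\<forall>x\<in>SObj F c. \<tau> c x = x))}\<rparr>"

definition MH :: "('o, 'm) cat \<Rightarrow> ('o, 'm) hfun \<Rightarrow> 'o set" where
  "MH C F = {c \<in> Obj C. \<exists>\<mu>\<in>idem_cones C. F = H_fun C \<mu> \<and> is_iso C (\<mu> c)}"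


section \<open>Cross-connections and their semigroups\<close>

type_synonym ('o, 'm, 'p, 'n) conn = "('o, 'm, ('p, 'n) hfun, ('p, 'n) htrans) fctr"

definition cross_connection ::
    "('o, 'm) cat \<Rightarrow> ('p, 'n) cat \<Rightarrow> ('p, 'n, 'o, 'm) conn \<Rightarrow> ('o, 'm, 'p, 'n) conn \<Rightarrow> bool" where
  "cross_connection C D \<Gamma> \<Delta> \<longleftrightarrow> unambiguous C \<and> unambiguous D \<and>
     local_iso D (dual C) \<Gamma> \<and> local_iso C (dual D) \<Delta> \<and>
     (\<forall>c\<in>Obj C. \<forall>d\<in>Obj D. c \<in> MH C (FObj \<Gamma> d) \<longleftrightarrow> d \<in> MH D (FObj \<Delta> c))"

text \<open>For \<open>\<Gamma> : D \<rightarrow> C\<^sup>*\<close> this is \<open>\<gamma>(c,d)\<close>; the cone \<open>\<delta>(c,d)\<close> is \<open>conn_cone D \<Delta> d c\<close>.\<close>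

definition conn_cone ::
    "('o, 'm) cat \<Rightarrow> ('p, 'n, 'o, 'm) conn \<Rightarrow> 'o \<Rightarrow> 'p \<Rightarrow> ('o \<Rightarrow> 'm)" where
  "conn_cone C \<Gamma> c d = (THE \<mu>. \<mu> \<in> idem_cones C \<and> apex C \<mu> = c \<and> H_fun C \<mu> = FObj \<Gamma> d)"

text \<open>\<open>transpose D \<Delta> c' d c d' f\<close> is \<open>f\<^sup>\<dagger> : d' \<rightarrow> d\<close> for \<open>f : c' \<rightarrow> c\<close>, with
  \<open>(c',d)\<close> and \<open>(c,d')\<close> in \<open>E\<^sub>\<Omega>\<close>.\<close>

definition transpose ::
    "('p, 'n) cat \<Rightarrow> ('o, 'm, 'p, 'n) conn \<Rightarrow> 'o \<Rightarrow> 'p \<Rightarrow> 'o \<Rightarrow> 'p \<Rightarrow> 'm \<Rightarrow> 'n" where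
  "transpose D \<Delta> c' d c d' f = (THE h. h \<in> mor D d' d \<and>
     (\<forall>e\<in>Obj D. \<forall>x\<in>SObj (FObj \<Delta> c') e.
        eta D (conn_cone D \<Delta> d' c) e (component (FArr \<Delta> f) e x) =
        h \<Zsemi>\<^bsub>D\<^esub> eta D (conn_cone D \<Delta> d c') e x))"

definition chi ::
    "('o, 'm) cat \<Rightarrow> ('p, 'n) cat \<Rightarrow> ('p, 'n, 'o, 'm) conn \<Rightarrow> ('o, 'm, 'p, 'n) conn \<Rightarrow>
     'o \<Rightarrow> 'p \<Rightarrow> ('o \<Rightarrow> 'm) \<Rightarrow> ('p \<Rightarrow> 'n)" where
  "chi C D \<Gamma> \<Delta> c d x = (THE y. \<exists>c' d' f.
     c' \<in> MH C (FObj \<Gamma> d) \<and> d' \<in> MH D (FObj \<Delta> c) \<and> f \<in> mor C c' c \<and>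
     x = cone_star C (conn_cone C \<Gamma> c' d) (epi_part C f) \<and>
     y = cone_star D (conn_cone D \<Delta> d' c) (epi_part D (transpose D \<Delta> c' d c d' f)))"

definition cc_semigroup ::
    "('o, 'm) cat \<Rightarrow> ('p, 'n) cat \<Rightarrow> ('p, 'n, 'o, 'm) conn \<Rightarrow> ('o, 'm, 'p, 'n) conn \<Rightarrow>
     (('o \<Rightarrow> 'm) \<times> ('p \<Rightarrow> 'n)) sgrp" where
  "cc_semigroup C D \<Gamma> \<Delta> =
     \<lparr>carrier = {(\<gamma>, \<delta>). \<gamma> \<in> cones C \<and> \<delta> \<in> cones D \<and>
                 (\<exists>c\<in>Obj C. \<exists>d\<in>Obj D. \<gamma> \<in> SObj (FObj \<Gamma> d) c \<and> \<delta> = chi C D \<Gamma> \<Delta> c d \<gamma>)},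
      smul = (\<lambda>(\<gamma>, \<delta>) (\<gamma>', \<delta>'). (cone_mult C \<gamma> \<gamma>', cone_mult D \<delta>' \<delta>))\<rparr>"


section \<open>The categories of principal one-sided ideals\<close>

definition left_ideal :: "'a sgrp \<Rightarrow> 'a \<Rightarrow> 'a set" where
  "left_ideal S e = {x \<cdot>\<^bsub>S\<^esub> e | x. x \<in> carrier S}"

definition right_ideal :: "'a sgrp \<Rightarrow> 'a \<Rightarrow> 'a set" where
  "right_ideal S e = {e \<cdot>\<^bsub>S\<^esub> x | x. x \<in> carrier S}"

definition local_part :: "'a sgrp \<Rightarrow> 'a \<Rightarrow> 'a \<Rightarrow> 'a set" where
  "local_part S e f = {(e \<cdot>\<^bsub>S\<^esub> x) \<cdot>\<^bsub>S\<^esub> f | x. x \<in> carrier S}"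

text \<open>Morphisms are maps between ideals, recorded as (domain, map, codomain).\<close>

definition ideal_cat ::
    "'a set set \<Rightarrow> ('a set \<times> ('a \<Rightarrow> 'a) \<times> 'a set) set \<Rightarrow>
     ('a set, 'a set \<times> ('a \<Rightarrow> 'a) \<times> 'a set) cat" where
  "ideal_cat Os As =
     \<lparr>Obj = Os,
      Arr = As,
      Dom = (\<lambda>(X, \<phi>, Y). X),
      Cod = (\<lambda>(X, \<phi>, Y). Y),
      Id = (\<lambda>X. (X, \<lambda>x\<in>X. x, X)),
      Cmp = (\<lambda>(X, \<phi>, _) (_, \<psi>, Z). (X, compose X \<psi> \<phi>, Z)),
      Inc = {(X, \<phi>, Y). X \<in> Os \<and> Y \<in> Os \<and> X \<subseteq> Y \<and> \<phi> = (\<lambda>x\<in>X. x)}\<rparr>"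

definition LL :: "'a sgrp \<Rightarrow> ('a set, 'a set \<times> ('a \<Rightarrow> 'a) \<times> 'a set) cat" where
  "LL S = ideal_cat (left_ideal S ` idems S)
     {(left_ideal S e, \<lambda>x\<in>left_ideal S e. x \<cdot>\<^bsub>S\<^esub> u, left_ideal S f) | e u f.
        e \<in> idems S \<and> f \<in> idems S \<and> u \<in> local_part S e f}"

definition RR :: "'a sgrp \<Rightarrow> ('a set, 'a set \<times> ('a \<Rightarrow> 'a) \<times> 'a set) cat" where
  "RR S = ideal_cat (right_ideal S ` idems S)
     {(right_ideal S e, \<lambda>x\<in>right_ideal S e. u \<cdot>\<^bsub>S\<^esub> x, right_ideal S f) | e u f.
        e \<in> idems S \<and> f \<in> idems S \<and> u \<in> local_part S f e}"

text \<open>The type argument only says where the elements of the witnessing semigroup live.\<close>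

definition completely_unambiguous :: "'a itself \<Rightarrow> ('o, 'm) cat \<Rightarrow> bool" where
  "completely_unambiguous _ C \<longleftrightarrow> unambiguous C \<and>
     (\<exists>S :: 'a sgrp. completely_0_simple S \<and>
        (isomorphic_with_subobjects C (LL S) \<or> isomorphic_with_subobjects C (RR S)))"


section \<open>Rees matrix semigroups and the categories of a 0-group\<close>

text \<open>An adjoined zero is \<^term>\<open>None\<close>, both for \<open>G \<union> {0}\<close> and for the object sets
  \<open>L \<union> {0}\<close>, \<open>I \<union> {0}\<close>.\<close>

definition with_zero :: "'a set \<Rightarrow> 'a option set" where
  "with_zero A = insert None (Some ` A)"

definition zmult :: "('g, 'x) monoid_scheme \<Rightarrow> 'g option \<Rightarrow> 'g option \<Rightarrow> 'g option" where
  "zmult G a b = (case (a, b) of (Some x, Some y) \<Rightarrow> Some (x \<otimes>\<^bsub>G\<^esub> y) | _ \<Rightarrow> None)"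

definition regular_matrix ::
    "('g, 'x) monoid_scheme \<Rightarrow> 'i set \<Rightarrow> 'l set \<Rightarrow> ('l \<Rightarrow> 'i \<Rightarrow> 'g option) \<Rightarrow> bool" where
  "regular_matrix G I L P \<longleftrightarrow>
     (\<forall>l\<in>L. \<forall>i\<in>I. P l i \<in> with_zero (carrier G)) \<and>
     (\<forall>l\<in>L. \<exists>i\<in>I. P l i \<noteq> None) \<and>
     (\<forall>i\<in>I. \<exists>l\<in>L. P l i \<noteq> None)"

definition rees ::
    "('g, 'x) monoid_scheme \<Rightarrow> 'i set \<Rightarrow> 'l set \<Rightarrow> ('l \<Rightarrow> 'i \<Rightarrow> 'g option) \<Rightarrow>
     ('i \<times> 'g \<times> 'l) option sgrp" where
  "rees G I L P =
     \<lparr>carrier = with_zero (I \<times> carrier G \<times> L),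
      smul = (\<lambda>x y. case (x, y) of
         (Some (i, a, l), Some (j, b, k)) \<Rightarrow>
           (case P l j of None \<Rightarrow> None | Some p \<Rightarrow> Some (i, a \<otimes>\<^bsub>G\<^esub> p \<otimes>\<^bsub>G\<^esub> b, k))
       | _ \<Rightarrow> None)\<rparr>"

text \<open>The triple \<open>(a, g, b)\<close> stands for the morphism \<open>\<rho>\<^sub>g : a \<rightarrow> b\<close>, respectively
  \<open>\<lambda>\<^sub>g : a \<rightarrow> b\<close>; the label is forced to be \<open>0\<close> if \<open>a\<close> or \<open>b\<close> is the object \<open>0\<close>.\<close>

type_synonym ('l, 'g) larr = "'l option \<times> 'g option \<times> 'l option"

definition zarr :: "('g, 'x) monoid_scheme \<Rightarrow> 'l set \<Rightarrow> ('l, 'g) larr set" where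
  "zarr G L = {(a, g, b). a \<in> with_zero L \<and> b \<in> with_zero L \<and> g \<in> with_zero (carrier G) \<and>
     (a = None \<or> b = None \<longrightarrow> g = None)}"

definition zid :: "('g, 'x) monoid_scheme \<Rightarrow> 'l option \<Rightarrow> ('l, 'g) larr" where
  "zid G a = (a, if a = None then None else Some \<one>\<^bsub>G\<^esub>, a)"

definition catC :: "('g, 'x) monoid_scheme \<Rightarrow> 'l set \<Rightarrow> ('l option, ('l, 'g) larr) cat" where
  "catC G L =
     \<lparr>Obj = with_zero L,
      Arr = zarr G L,
      Dom = (\<lambda>(a, g, b). a),
      Cod = (\<lambda>(a, g, b). b),
      Id = zid G,
      Cmp = (\<lambda>(a, g, _) (_, h, b). (a, zmult G g h, b)),
      Inc = zid G ` with_zero L \<union> {(None, None, Some l) | l. l \<in> L}\<rparr>"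

definition catD :: "('g, 'x) monoid_scheme \<Rightarrow> 'i set \<Rightarrow> ('i option, ('i, 'g) larr) cat" where
  "catD G I =
     \<lparr>Obj = with_zero I,
      Arr = zarr G I,
      Dom = (\<lambda>(a, g, b). a),
      Cod = (\<lambda>(a, g, b). b),
      Id = zid G,
      Cmp = (\<lambda>(a, g, _) (_, h, b). (a, zmult G h g, b)),
      Inc = zid G ` with_zero I \<union> {(None, None, Some i) | i. i \<in> I}\<rparr>"

text \<open>The identifications of \<open>catC G L\<close> with \<open>LL (rees G I L P)\<close> and of \<open>catD G I\<close> with
  \<open>RR (rees G I L P)\<close>; \<open>id_coord\<close> is the corresponding trivial identification of \<open>catC G L\<close>
  and \<open>catD G I\<close> with themselves.\<close>

definition obL :: "('g, 'x) monoid_scheme \<Rightarrow> 'i set \<Rightarrow> 'l option \<Rightarrow> ('i \<times> 'g \<times> 'l) option set" where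
  "obL G I c = insert None {Some (i, a, l) | i a l. i \<in> I \<and> a \<in> carrier G \<and> c = Some l}"

definition obR :: "('g, 'x) monoid_scheme \<Rightarrow> 'l set \<Rightarrow> 'i option \<Rightarrow> ('i \<times> 'g \<times> 'l) option set" where
  "obR G L c = insert None {Some (i, a, l) | i a l. l \<in> L \<and> a \<in> carrier G \<and> c = Some i}"

definition coordL ::
    "('g, 'x) monoid_scheme \<Rightarrow> 'i set \<Rightarrow>
     ('l option, ('l, 'g) larr, ('i \<times> 'g \<times> 'l) option set,
      ('i \<times> 'g \<times> 'l) option set \<times> (('i \<times> 'g \<times> 'l) option \<Rightarrow> ('i \<times> 'g \<times> 'l) option)
        \<times> ('i \<times> 'g \<times> 'l) option set) fctr" where
  "coordL G I =
     \<lparr>FObj = obL G I,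
      FArr = (\<lambda>(c, h, d). (obL G I c,
        \<lambda>x\<in>obL G I c. case (x, h, d) of
            (Some (i, a, l), Some g, Some k) \<Rightarrow> Some (i, a \<otimes>\<^bsub>G\<^esub> g, k)
          | _ \<Rightarrow> None,
        obL G I d))\<rparr>"

definition coordR ::
    "('g, 'x) monoid_scheme \<Rightarrow> 'l set \<Rightarrow>
     ('i option, ('i, 'g) larr, ('i \<times> 'g \<times> 'l) option set,
      ('i \<times> 'g \<times> 'l) option set \<times> (('i \<times> 'g \<times> 'l) option \<Rightarrow> ('i \<times> 'g \<times> 'l) option)
        \<times> ('i \<times> 'g \<times> 'l) option set) fctr" where
  "coordR G L =
     \<lparr>FObj = obR G L,
      FArr = (\<lambda>(c, h, d). (obR G L c,
        \<lambda>x\<in>obR G L c. case (x, h, d) of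
            (Some (i, a, l), Some g, Some j) \<Rightarrow> Some (j, g \<otimes>\<^bsub>G\<^esub> a, l)
          | _ \<Rightarrow> None,
        obR G L d))\<rparr>"

definition id_coord :: "('l option, ('l, 'g) larr, 'l option, ('l, 'g) larr) fctr" where
  "id_coord = \<lparr>FObj = (\<lambda>x. x), FArr = (\<lambda>x. x)\<rparr>"


section \<open>The functors given by a sandwich matrix\<close>

text \<open>\<open>tcone \<Phi> L t c\<close> is the normal cone \<open>(t; c)\<close> in the category identified by \<open>\<Phi>\<close> with
  \<open>catC G L\<close> (or \<open>catD G L\<close>): its component at \<open>\<alpha> \<in> L\<close> is labelled \<open>t \<alpha>\<close>. The zero
  tuple, and likewise the apex \<open>c = 0\<close>, give the unique normal cone with apex \<open>0\<close>.\<close>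

definition tcone ::
    "('l option, ('l, 'g) larr, 'o, 'm) fctr \<Rightarrow> 'l set \<Rightarrow> ('l \<Rightarrow> 'g option) \<Rightarrow> 'l option \<Rightarrow>
     ('o \<Rightarrow> 'm)" where
  "tcone \<Phi> L t c = (\<lambda>a\<in>FObj \<Phi> ` with_zero L.
     let \<alpha> = inv_into (with_zero L) (FObj \<Phi>) a in
     if c = None \<or> (\<forall>l\<in>L. t l = None) then FArr \<Phi> (\<alpha>, None, None)
     else FArr \<Phi> (\<alpha>, case \<alpha> of None \<Rightarrow> None | Some l \<Rightarrow> t l, c))"

text \<open>Columns and rows of \<open>P\<close>, extended by the zero tuple for the index \<open>0\<close>.\<close>

definition col :: "('l \<Rightarrow> 'i \<Rightarrow> 'g option) \<Rightarrow> 'i option \<Rightarrow> 'l \<Rightarrow> 'g option" where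
  "col P j = (\<lambda>l. case j of None \<Rightarrow> None | Some i \<Rightarrow> P l i)"

definition row :: "('l \<Rightarrow> 'i \<Rightarrow> 'g option) \<Rightarrow> 'l option \<Rightarrow> 'i \<Rightarrow> 'g option" where
  "row P c = (\<lambda>i. case c of None \<Rightarrow> None | Some l \<Rightarrow> P l i)"

text \<open>\<open>is_Gamma_P \<dots> \<Gamma>\<close> says that \<open>\<Gamma>\<close> is the functor \<open>\<Gamma>\<^sub>P : D \<rightarrow> C\<^sup>*\<close>: it sends \<open>j\<close> to the
  \<open>H\<close>-functor \<open>p\<^sub>jG\<^sup>0\<close>, with value \<open>{(p\<^sub>jx; c) : x \<in> G\<^sup>0}\<close> at \<open>c\<close>, and \<open>\<lambda>\<^sub>g : i \<rightarrow> j\<close> to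
  \<open>(p\<^sub>ix; c) \<mapsto> (p\<^sub>jgx; c)\<close>. With the conventions above this includes the object \<open>0\<close> of either
  category and the zero morphisms.\<close>

definition is_Gamma_P ::
    "('g, 'x) monoid_scheme \<Rightarrow> 'i set \<Rightarrow> 'l set \<Rightarrow> ('l \<Rightarrow> 'i \<Rightarrow> 'g option) \<Rightarrow>
     ('o, 'm) cat \<Rightarrow> ('l option, ('l, 'g) larr, 'o, 'm) fctr \<Rightarrow>
     ('p, 'n) cat \<Rightarrow> ('i option, ('i, 'g) larr, 'p, 'n) fctr \<Rightarrow>
     ('p, 'n, 'o, 'm) conn \<Rightarrow> bool" where
  "is_Gamma_P G I L P C \<Phi> D \<Psi> \<Gamma> \<longleftrightarrow> is_functor D (dual C) \<Gamma> \<and>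
     (\<forall>j\<in>with_zero I. \<forall>c\<in>with_zero L.
        SObj (FObj \<Gamma> (FObj \<Psi> j)) (FObj \<Phi> c) =
        {tcone \<Phi> L (\<lambda>l. zmult G (col P j l) x) c | x. x \<in> with_zero (carrier G)}) \<and>
     (\<forall>(i, g, j)\<in>zarr G I. \<forall>c\<in>with_zero L. \<forall>x\<in>with_zero (carrier G).
        component (FArr \<Gamma> (FArr \<Psi> (i, g, j))) (FObj \<Phi> c)
            (tcone \<Phi> L (\<lambda>l. zmult G (col P i l) x) c) =
        tcone \<Phi> L (\<lambda>l. zmult G (zmult G (col P j l) g) x) c)"

text \<open>Dually, \<open>\<Delta>\<^sub>P : C \<rightarrow> D\<^sup>*\<close>.\<close>

definition is_Delta_P ::
    "('g, 'x) monoid_scheme \<Rightarrow> 'i set \<Rightarrow> 'l set \<Rightarrow> ('l \<Rightarrow> 'i \<Rightarrow> 'g option) \<Rightarrow>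
     ('o, 'm) cat \<Rightarrow> ('l option, ('l, 'g) larr, 'o, 'm) fctr \<Rightarrow>
     ('p, 'n) cat \<Rightarrow> ('i option, ('i, 'g) larr, 'p, 'n) fctr \<Rightarrow>
     ('o, 'm, 'p, 'n) conn \<Rightarrow> bool" where
  "is_Delta_P G I L P C \<Phi> D \<Psi> \<Delta> \<longleftrightarrow> is_functor C (dual D) \<Delta> \<and>
     (\<forall>c\<in>with_zero L. \<forall>j\<in>with_zero I.
        SObj (FObj \<Delta> (FObj \<Phi> c)) (FObj \<Psi> j) =
        {tcone \<Psi> I (\<lambda>i. zmult G x (row P c i)) j | x. x \<in> with_zero (carrier G)}) \<and>
     (\<forall>(c, g, d)\<in>zarr G L. \<forall>j\<in>with_zero I. \<forall>x\<in>with_zero (carrier G).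
        component (FArr \<Delta> (FArr \<Phi> (c, g, d))) (FObj \<Psi> j)
            (tcone \<Psi> I (\<lambda>i. zmult G x (row P c i)) j) =
        tcone \<Psi> I (\<lambda>i. zmult G (zmult G x g) (row P d i)) j)"

end

theory Submission
  imports Defs
begin

text \<open>
  A category isomorphic to \<open>catC G L\<close>, with coordinates given by the isomorphism, is called
  coordinatised. Since \<open>catD G I\<close> is \<open>catC\<close> of the opposite group, all four categories of the
      theorem
  are of this kind, and it suffices to treat \<open>\<Gamma>\<^sub>P\<close>: the functor \<open>\<Delta>\<^sub>P\<close> is \<open>\<Gamma>\<close> for the opposite group
  and the transposed matrix. The normal cones are the pairs \<open>(t; c)\<close> of a tuple and an apex, and an
  \<open>H\<close>-functor is a class \<open>tG\<^sup>0\<close> of proportional tuples. By Yoneda the natural transformations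
  \<open>tG\<^sup>0 \<rightarrow> sG\<^sup>0\<close> are the maps \<open>tx \<mapsto> sgx\<close> with \<open>g \<in> G\<^sup>0\<close>, so the dual of a coordinatised category is
      again
  coordinatised, over the opposite group and the set of nonzero classes; in particular it is
  unambiguous. A fully faithful functor between such categories that respects \<open>0\<close> is a local
  isomorphism, which applies to \<open>\<Gamma>\<^sub>P\<close>. Both \<open>c \<in> M\<Gamma>\<^sub>P(d)\<close>
      and \<open>d \<in> M\<Delta>\<^sub>P(c)\<close> say that the entry of \<open>P\<close> at
  \<open>(c, d)\<close> is nonzero. Finally \<open>\<chi>\<close> maps \<open>(p\<^sub>ia; l)\<close> to \<open>(ap\<^sub>l; i)\<close>, so the linked pairs are
  parametrised by the triples \<open>(i, a, l)\<close> and \<open>0\<close>, and multiply like them.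
\<close>

section \<open>Groups with zero\<close>

text \<open>The object 0 is the obstacle throughout. A pair (t; c) with t zero or c = 0 always
  denotes the one zero cone, from which neither tuple nor scalar can be recovered. Hence cones are
  kept in a reduced form, where t is nonzero exactly when c is not 0, and labels must be 0 as soon
  as one end is 0 (\<open>zarr\<close>, \<open>admissible\<close>), which makes them unique. The
  opposite group comes from the order of composition: the maps tx -> sgx and sx -> rhx compose to tx
  -> r(hg)x. Uniqueness of \<open>\<Gamma>\<^sub>P\<close> needs an argument, because its defining
  conditions prescribe sets and components but not the action of the H-functors on morphisms. A
  single set {(tx; l)} with l in L already fixes t up to a nonzero right factor, and this fixes the
  H-functor. The formula for chi rests on transposes: that of \<open>\<rho>\<^sub>g\<close> : c' ->
  c has label p(c',d)^-1 g p(c,d'). The last factor cancels against the normalisation of the cone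
  delta(c,d'), so both cones carry the same parameter p(c',d)^-1 g, and the choices of c', d' and g
  leave no other trace.\<close>

lemma None_with_zero [simp]: "None \<in> with_zero A"
  by (simp add: with_zero_def)

lemma Some_with_zero [simp]: "Some x \<in> with_zero A \<longleftrightarrow> x \<in> A"
  by (auto simp: with_zero_def)

lemma with_zero_cases:
  assumes "a \<in> with_zero A"
  obtains "a = None" | x where "a = Some x" "x \<in> A"
  using assms by (auto simp: with_zero_def)

lemma zmult_None [simp]: "zmult G None b = None" "zmult G a None = None"
  by (auto simp: zmult_def split: option.splits)

lemma zmult_Some [simp]: "zmult G (Some x) (Some y) = Some (x \<otimes>\<^bsub>G\<^esub> y)"
  by (simp add: zmult_def)

lemma zmult_eq_None [simp]: "zmult G a b = None \<longleftrightarrow> a = None \<or> b = None"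
  by (auto simp: zmult_def split: option.splits)

text \<open>The result is a plain \<open>monoid\<close>: a record extension of \<open>G\<close> is
  dropped, so \<open>opp (opp G)\<close> is not literally \<open>G\<close>.
  \<open>coordinatised_opp_opp\<close> bridges this gap.\<close>

definition opp :: "('g, 'x) monoid_scheme \<Rightarrow> 'g monoid" where
  "opp G = \<lparr>carrier = carrier G, mult = (\<lambda>x y. y \<otimes>\<^bsub>G\<^esub> x), one = \<one>\<^bsub>G\<^esub>\<rparr>"

lemma opp_simps [simp]:
  "carrier (opp G) = carrier G" "x \<otimes>\<^bsub>opp G\<^esub> y = y \<otimes>\<^bsub>G\<^esub> x" "\<one>\<^bsub>opp G\<^esub> = \<one>\<^bsub>G\<^esub>"
  by (simp_all add: opp_def)

lemma zmult_opp: "zmult (opp G) a b = zmult G b a"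
  by (simp add: zmult_def split: option.splits)

lemma zarr_opp [simp]: "zarr (opp G) L = zarr G L"
  by (simp add: zarr_def)

lemma zid_opp [simp]: "zid (opp G) = zid G"
  by (simp add: zid_def fun_eq_iff)

lemma catD_eq_catC_opp: "catD G I = catC (opp G) I"
  by (simp add: catD_def catC_def zmult_opp)

definition zinv :: "('g, 'x) monoid_scheme \<Rightarrow> 'g option \<Rightarrow> 'g option" where
  "zinv G = map_option (m_inv G)"

lemma zinv_simps [simp]: "zinv G None = None" "zinv G (Some x) = Some (inv\<^bsub>G\<^esub> x)"
  by (simp_all add: zinv_def)

lemma zinv_eq_None [simp]: "zinv G a = None \<longleftrightarrow> a = None"
  by (simp add: zinv_def)

context group
begin

lemma group_opp: "group (opp G)"
proof (rule groupI)
  fix x assume "x \<in> carrier (opp G)"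
  then show "\<exists>y\<in>carrier (opp G). y \<otimes>\<^bsub>opp G\<^esub> x = \<one>\<^bsub>opp G\<^esub>"
    by (auto intro!: bexI[of _ "inv x"])
qed (auto simp: m_assoc)

lemma zmult_closed [simp]:
  "a \<in> with_zero (carrier G) \<Longrightarrow> b \<in> with_zero (carrier G) \<Longrightarrow> zmult G a b \<in> with_zero (carrier G)"
  by (auto elim!: with_zero_cases)

lemma zmult_assoc:
  "a \<in> with_zero (carrier G) \<Longrightarrow> b \<in> with_zero (carrier G) \<Longrightarrow> c \<in> with_zero (carrier G) \<Longrightarrow>
   zmult G (zmult G a b) c = zmult G a (zmult G b c)"
  by (auto elim!: with_zero_cases simp: m_assoc)

lemma zmult_one [simp]:
  "a \<in> with_zero (carrier G) \<Longrightarrow> zmult G (Some \<one>) a = a"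
  "a \<in> with_zero (carrier G) \<Longrightarrow> zmult G a (Some \<one>) = a"
  by (auto elim!: with_zero_cases)

lemma zinv_closed [simp]: "a \<in> with_zero (carrier G) \<Longrightarrow> zinv G a \<in> with_zero (carrier G)"
  by (auto elim!: with_zero_cases)

lemma zinv_zmult:
  "a \<in> with_zero (carrier G) \<Longrightarrow> zmult G (zinv G a) a = (if a = None then None else Some \<one>)"
  "a \<in> with_zero (carrier G) \<Longrightarrow> zmult G a (zinv G a) = (if a = None then None else Some \<one>)"
  by (auto elim!: with_zero_cases)

lemma zmult_left_cancel:
  assumes "a \<in> with_zero (carrier G)" "b \<in> with_zero (carrier G)" "c \<in> with_zero (carrier G)"
    and "c \<noteq> None"
  shows "zmult G c a = zmult G c b \<longleftrightarrow> a = b"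
  using assms by (auto elim!: with_zero_cases)

end

section \<open>Coordinatised categories\<close>

text \<open>\<open>\<Phi>\<close> transports the structure of \<open>catC G L\<close> and may take
  any values outside it. It is not phrased through \<open>is_functor\<close>, whose maps are
  \<open>undefined\<close> outside their domain; \<open>coordL\<close>, \<open>coordR\<close> and
  \<open>id_coord\<close> do not have that form.\<close>

locale coordinatised = group G for G (structure) +
  fixes L :: "'l set" and C :: "('o, 'm) cat"
    and \<Phi> :: "('l option, 'l option \<times> 'a option \<times> 'l option, 'o, 'm) fctr"
  assumes inj_ob: "inj_on (FObj \<Phi>) (with_zero L)"
    and Obj_eq: "Obj C = FObj \<Phi> ` with_zero L"
    and inj_ar: "inj_on (FArr \<Phi>) (zarr G L)"
    and Arr_eq: "Arr C = FArr \<Phi> ` zarr G L"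
    and Dom_ar: "(a, g, b) \<in> zarr G L \<Longrightarrow> Dom C (FArr \<Phi> (a, g, b)) = FObj \<Phi> a"
    and Cod_ar: "(a, g, b) \<in> zarr G L \<Longrightarrow> Cod C (FArr \<Phi> (a, g, b)) = FObj \<Phi> b"
    and Id_ob: "a \<in> with_zero L \<Longrightarrow> Id C (FObj \<Phi> a) = FArr \<Phi> (zid G a)"
    and Cmp_ar: "(a, g, b) \<in> zarr G L \<Longrightarrow> (b, h, c) \<in> zarr G L \<Longrightarrow>
      FArr \<Phi> (a, g, b) \<Zsemi>\<^bsub>C\<^esub> FArr \<Phi> (b, h, c) = FArr \<Phi> (a, zmult G g h, c)"
    and Inc_eq: "Inc C = FArr \<Phi> ` (zid G ` with_zero L \<union> {(None, None, Some l) | l. l \<in> L})"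
begin

abbreviation K :: "'a option set" where "K \<equiv> with_zero (carrier G)"
abbreviation ob :: "'l option \<Rightarrow> 'o" where "ob \<equiv> FObj \<Phi>"
abbreviation ar :: "'l option \<Rightarrow> 'a option \<Rightarrow> 'l option \<Rightarrow> 'm" where "ar a g b \<equiv> FArr \<Phi> (a, g, b)"
text \<open>The label of the identity at \<open>a\<close>, and also of every inclusion out of
  \<open>a\<close>, since a proper inclusion starts at 0.\<close>

definition unit_label :: "'l option \<Rightarrow> 'a option"
  where "unit_label a = (if a = None then None else Some \<one>)"

lemma unit_label_simps [simp]:
  "unit_label None = None" "unit_label (Some l) = Some \<one>" "unit_label a \<in> K"
  "unit_label a = None \<longleftrightarrow> a = None" "None = unit_label a \<longleftrightarrow> a = None"
      "a \<noteq> None \<Longrightarrow> unit_label a = Some \<one>"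
  by (auto simp: unit_label_def)

lemma zarr_iff:
  "(a, g, b) \<in> zarr G L \<longleftrightarrow>
   a \<in> with_zero L \<and> b \<in> with_zero L \<and> g \<in> K \<and> (a = None \<or> b = None \<longrightarrow> g = None)"
  by (simp add: zarr_def)

lemma zid_eq: "zid G a = (a, unit_label a, a)"
  by (simp add: zid_def unit_label_def)

lemma unit_label_zmult:
  "(a, g, b) \<in> zarr G L \<Longrightarrow> zmult G (unit_label a) g = g"
  "(a, g, b) \<in> zarr G L \<Longrightarrow> zmult G g (unit_label b) = g"
  by (cases a; cases b; auto simp: zarr_iff)+

lemma ob_eq_iff [simp]:
  "a \<in> with_zero L \<Longrightarrow> b \<in> with_zero L \<Longrightarrow> ob a = ob b \<longleftrightarrow> a = b"
  using inj_ob by (auto simp: inj_on_def)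

lemma ar_eq_iff [simp]:
  "(a, g, b) \<in> zarr G L \<Longrightarrow> (a', g', b') \<in> zarr G L \<Longrightarrow>
   ar a g b = ar a' g' b' \<longleftrightarrow> a = a' \<and> g = g' \<and> b = b'"
  using inj_onD[OF inj_ar] by fastforce

lemma ob_in_Obj [simp]: "a \<in> with_zero L \<Longrightarrow> ob a \<in> Obj C"
  by (simp add: Obj_eq)

lemma ObjE:
  assumes "x \<in> Obj C" obtains a where "a \<in> with_zero L" "x = ob a"
  using assms by (auto simp: Obj_eq)

lemma ArrE:
  assumes "f \<in> Arr C" obtains a g b where "(a, g, b) \<in> zarr G L" "f = ar a g b"
  using assms by (auto simp: Arr_eq)

lemma ar_in_Arr: "(a, g, b) \<in> zarr G L \<Longrightarrow> ar a g b \<in> Arr C"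
  by (auto simp: Arr_eq)

lemma zid_in_zarr: "a \<in> with_zero L \<Longrightarrow> (a, unit_label a, a) \<in> zarr G L"
  by (auto simp: zarr_iff)

lemma ar_in_mor:
  "(a, g, b) \<in> zarr G L \<Longrightarrow> x \<in> with_zero L \<Longrightarrow> y \<in> with_zero L \<Longrightarrow>
   ar a g b \<in> mor C (ob x) (ob y) \<longleftrightarrow> x = a \<and> y = b"
  by (auto simp: mor_def ar_in_Arr Dom_ar Cod_ar zarr_iff)

lemma mor_eq:
  assumes "a \<in> with_zero L" "b \<in> with_zero L"
  shows "mor C (ob a) (ob b) = {ar a g b | g. (a, g, b) \<in> zarr G L}"
proof
  show "mor C (ob a) (ob b) \<subseteq> {ar a g b | g. (a, g, b) \<in> zarr G L}"
  proof
    fix f assume f: "f \<in> mor C (ob a) (ob b)"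
    then obtain a' g b' where *: "(a', g, b') \<in> zarr G L" "f = ar a' g b'"
      by (auto simp: mor_def elim: ArrE)
    with f assms have "a' = a" "b' = b" by (auto simp: ar_in_mor)
    with * show "f \<in> {ar a g b | g. (a, g, b) \<in> zarr G L}" by auto
  qed
qed (use assms in \<open>auto simp: ar_in_mor\<close>)

lemma Cmp_closed:
  "(a, g, b) \<in> zarr G L \<Longrightarrow> (b, h, c) \<in> zarr G L \<Longrightarrow> (a, zmult G g h, c) \<in> zarr G L"
  by (auto simp: zarr_iff)

lemma is_category: "is_category C"
  unfolding is_category_def
proof (intro conjI ballI impI)
  fix f assume "f \<in> Arr C"
  then obtain a g b where f: "(a, g, b) \<in> zarr G L" "f = ar a g b" by (rule ArrE)
  then have ab: "a \<in> with_zero L" "b \<in> with_zero L" "g \<in> K" "a = None \<or> b = None \<longrightarrow> g = None"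
    by (auto simp: zarr_iff)
  show "Dom C f \<in> Obj C" "Cod C f \<in> Obj C"
    using f ab by (auto simp: Dom_ar Cod_ar)
  show "Id C (Dom C f) \<Zsemi>\<^bsub>C\<^esub> f = f"
    using f ab zid_in_zarr[OF ab(1)] by (simp add: Dom_ar Id_ob zid_eq Cmp_ar unit_label_zmult)
  show "f \<Zsemi>\<^bsub>C\<^esub> Id C (Cod C f) = f"
    using f ab zid_in_zarr[OF ab(2)] by (simp add: Cod_ar Id_ob zid_eq Cmp_ar unit_label_zmult)
  fix f' assume "f' \<in> Arr C"
  then obtain a' g' b' where f': "(a', g', b') \<in> zarr G L" "f' = ar a' g' b'" by (rule ArrE)
  then have ab': "a' \<in> with_zero L" "b' \<in> with_zero L" "g' \<in> K" by (auto simp: zarr_iff)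
  {
    assume "Cod C f = Dom C f'"
    then have "b = a'" using f f' ab ab' by (simp add: Dom_ar Cod_ar)
    then show "f \<Zsemi>\<^bsub>C\<^esub> f' \<in> mor C (Dom C f) (Cod C f')"
      using f f' ab ab' Cmp_closed[of a g b g' b'] by (simp add: Dom_ar Cod_ar Cmp_ar ar_in_mor)
  }
  fix f'' assume "f'' \<in> Arr C"
  then obtain a'' g'' b'' where f'': "(a'', g'', b'') \<in> zarr G L" "f'' = ar a'' g'' b'' "
      by (rule ArrE)
  then have ab'': "a'' \<in> with_zero L" "b'' \<in> with_zero L" "g'' \<in> K" by (auto simp: zarr_iff)
  assume "Cod C f = Dom C f' \<and> Cod C f' = Dom C f''"
  then have eq: "a' = b" "a'' = b'" using f f' f'' ab ab' ab'' by (auto simp: Dom_ar Cod_ar)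
  show "f \<Zsemi>\<^bsub>C\<^esub> f' \<Zsemi>\<^bsub>C\<^esub> f'' = f \<Zsemi>\<^bsub>C\<^esub> (f' \<Zsemi>\<^bsub>C\<^esub> f'')"
    using f f' f'' ab ab' ab'' Cmp_closed[of a g b g' b'] Cmp_closed[of b g' b' g'' b'']
    unfolding eq by (simp add: Cmp_ar zmult_assoc)
next
  fix x assume "x \<in> Obj C"
  then obtain a where "a \<in> with_zero L" "x = ob a" by (rule ObjE)
  then show "Id C x \<in> mor C x x"
    by (simp add: Id_ob zid_eq ar_in_mor zarr_iff)
qed

text \<open>An arrow out of 0 has label 0, so it is the identity of 0 or an inclusion 0 -> l; the
  second disjunct covers both.\<close>

lemma ar_in_Inc:
  assumes "(a, g, b) \<in> zarr G L"
  shows "ar a g b \<in> Inc C \<longleftrightarrow> (a = b \<and> g = unit_label a) \<or> a = None"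
proof
  assume "ar a g b \<in> Inc C"
  then obtain t where t: "ar a g b = FArr \<Phi> t"
      "t \<in> zid G ` with_zero L \<union> {(None, None, Some l) | l. l \<in> L}"
    unfolding Inc_eq by auto
  moreover have "t \<in> zarr G L" using t(2) by (auto simp: zid_eq zarr_iff)
  ultimately have "t = (a, g, b)" using assms inj_onD[OF inj_ar, of t "(a, g, b)"] by simp
  with t(2) show "(a = b \<and> g = unit_label a) \<or> a = None" by (auto simp: zid_eq)
next
  assume "(a = b \<and> g = unit_label a) \<or> a = None"
  then have "(a, g, b) \<in> zid G ` with_zero L \<union> {(None, None, Some l) | l. l \<in> L}"
    using assms by (cases b) (auto simp: zid_eq zarr_iff image_iff)
  then show "ar a g b \<in> Inc C"
    unfolding Inc_eq by (rule imageI)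
qed

lemma Inc_subset_Arr: "Inc C \<subseteq> Arr C"
  unfolding Inc_eq Arr_eq by (rule image_mono) (auto simp: zid_eq zarr_iff)

lemma IncE:
  assumes "f \<in> Inc C"
  obtains a g b where "(a, g, b) \<in> zarr G L" "f = ar a g b" "(a = b \<and> g = unit_label a) \<or> a = None"
proof -
  from assms obtain a g b where "(a, g, b) \<in> zarr G L" "f = ar a g b"
    using Inc_subset_Arr ArrE by blast
  with assms ar_in_Inc that show thesis by blast
qed

lemma subobj_iff:
  assumes "a \<in> with_zero L" "b \<in> with_zero L"
  shows "subobj C (ob a) (ob b) \<longleftrightarrow> a = b \<or> a = None"
proof
  assume "subobj C (ob a) (ob b)"
  then show "a = b \<or> a = None" using assms
    by (auto simp: subobj_def ar_in_mor elim!: IncE)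
next
  assume *: "a = b \<or> a = None"
  show "subobj C (ob a) (ob b)" unfolding subobj_def
    by (rule bexI[of _ "ar a (unit_label a) b"]) (use * assms in \<open>auto simp: ar_in_mor ar_in_Inc
        zarr_iff\<close>)
qed

lemma incl_eq:
  assumes "a \<in> with_zero L" "b \<in> with_zero L" "a = b \<or> a = None"
  shows "incl C (ob a) (ob b) = ar a (unit_label a) b"
  unfolding incl_def
proof (rule the_equality)
  have "(a, unit_label a, b) \<in> zarr G L" using assms by (auto simp: zarr_iff)
  then show "ar a (unit_label a) b \<in> Inc C \<and> ar a (unit_label a) b \<in> mor C (ob a) (ob b)"
    using assms by (auto simp: ar_in_Inc ar_in_mor)
  fix f assume "f \<in> Inc C \<and> f \<in> mor C (ob a) (ob b)"
  then show "f = ar a (unit_label a) b"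
    using assms by (auto simp: ar_in_mor zarr_iff elim!: IncE)
qed

section \<open>Isomorphisms, retractions and normal factorisations\<close>

lemma inverse_pair_iff:
  assumes "(a, g, b) \<in> zarr G L" "(c, h, d) \<in> zarr G L"
  shows "inverse_pair C (ar a g b) (ar c h d) \<longleftrightarrow>
    c = b \<and> d = a \<and> zmult G g h = unit_label a \<and> zmult G h g = unit_label b"
proof -
  have *: "a \<in> with_zero L" "b \<in> with_zero L" using assms by (auto simp: zarr_iff)
  show ?thesis
    using * assms Cmp_closed[of a g b h a] Cmp_closed[of b h a g b] zid_in_zarr[of a] zid_in_zarr[of
        b]
    by (auto simp: inverse_pair_def ar_in_Arr Dom_ar Cod_ar ar_in_mor Cmp_ar Id_ob zid_eq)
qed

text \<open>Nonzero labels are invertible in the group. A zero label only produces zero labels, and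
  the identity at an object has label 0 only at the object 0.\<close>

lemma is_iso_iff:
  assumes "(a, g, b) \<in> zarr G L"
  shows "is_iso C (ar a g b) \<longleftrightarrow> (a = None \<and> b = None) \<or> g \<noteq> None"
proof
  assume "is_iso C (ar a g b)"
  then obtain f where f: "inverse_pair C (ar a g b) f" by (auto simp: is_iso_def)
  moreover from f obtain c h d where "(c, h, d) \<in> zarr G L" "f = ar c h d"
    by (auto simp: inverse_pair_def mor_def elim: ArrE)
  ultimately show "(a = None \<and> b = None) \<or> g \<noteq> None"
    using assms by (auto simp: inverse_pair_iff)
next
  assume *: "(a = None \<and> b = None) \<or> g \<noteq> None"
  have "(b, zinv G g, a) \<in> zarr G L" using assms by (auto simp: zarr_iff)
  moreover have "inverse_pair C (ar a g b) (ar b (zinv G g) a)"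
    using * assms calculation by (auto simp: inverse_pair_iff zinv_zmult zarr_iff)
  ultimately show "is_iso C (ar a g b)" by (auto simp: is_iso_def)
qed

text \<open>If the codomain is 0, the composite with the inclusion is the only endomorphism of 0.
  Otherwise the inclusion has to be an identity, and so does its retraction.\<close>

lemma is_retraction_iff:
  assumes "(a, g, b) \<in> zarr G L"
  shows "is_retraction C (ar a g b) \<longleftrightarrow> b = None \<or> (a = b \<and> g = unit_label a)"
proof -
  have *: "a \<in> with_zero L" "b \<in> with_zero L" using assms by (auto simp: zarr_iff)
  have **: "incl C (ob b) (ob a) \<Zsemi>\<^bsub>C\<^esub> ar a g b = ar b (zmult G (unit_label b) g) b"
    if "b = a \<or> b = None"
    using that assms by (simp only: incl_eq[OF *(2,1)], subst Cmp_ar) (auto simp: zarr_iff)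
  have "(b, zmult G (unit_label b) g, b) \<in> zarr G L" using assms by (auto simp: zarr_iff)
  then show ?thesis
    using assms * zid_in_zarr[of b] **
    by (auto simp: is_retraction_def ar_in_Arr Dom_ar Cod_ar subobj_iff Id_ob zid_eq zarr_iff)
qed

lemma cat_with_subobjects: "cat_with_subobjects C"
  unfolding cat_with_subobjects_def
proof (intro conjI ballI impI)
  show "is_category C" by (rule is_category)
  show "Inc C \<subseteq> Arr C" by (rule Inc_subset_Arr)
  fix x assume "x \<in> Obj C"
  then show "Id C x \<in> Inc C" by (auto simp: Id_ob zid_eq ar_in_Inc zid_in_zarr elim!: ObjE)
next
  fix f assume "f \<in> Inc C"
  then obtain a g b where f: "(a, g, b) \<in> zarr G L" "f = ar a g b"
    "(a = b \<and> g = unit_label a) \<or> a = None" by (rule IncE)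
  then have ab: "a \<in> with_zero L" "b \<in> with_zero L" "g \<in> K" by (auto simp: zarr_iff)
  show "is_mono C f"
    unfolding is_mono_def
  proof (intro conjI ballI impI)
    show "f \<in> Arr C" using f ar_in_Arr by simp
    fix x h h' assume "x \<in> Obj C" "h \<in> mor C x (Dom C f)" "h' \<in> mor C x (Dom C f)"
        and eq: "h \<Zsemi>\<^bsub>C\<^esub> f = h' \<Zsemi>\<^bsub>C\<^esub> f"
    then obtain c k k' where *: "(c, k, a) \<in> zarr G L" "h = ar c k a" "(c, k', a) \<in> zarr G L"
        "h' = ar c k' a"
      using f ab by (auto simp: Dom_ar mor_eq elim!: ObjE)
    with eq f have "zmult G k g = zmult G k' g"
      using Cmp_closed[OF *(1) f(1)] Cmp_closed[OF *(3) f(1)] by (simp add: Cmp_ar)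
    with * f(3) show "h = h'" by (auto simp: zarr_iff)
  qed
  fix f' assume "f' \<in> Inc C"
  then obtain a' g' b' where f': "(a', g', b') \<in> zarr G L" "f' = ar a' g' b'"
    "(a' = b' \<and> g' = unit_label a') \<or> a' = None" by (rule IncE)
  then have ab': "a' \<in> with_zero L" "b' \<in> with_zero L" "g' \<in> K" by (auto simp: zarr_iff)
  {
    assume "Cod C f = Dom C f'"
    then have eq: "a' = b" using f f' ab ab' by (simp add: Dom_ar Cod_ar)
    show "f \<Zsemi>\<^bsub>C\<^esub> f' \<in> Inc C"
      using f f' Cmp_closed[of a g b g' b'] unfolding eq by (auto simp: Cmp_ar ar_in_Inc)
  next
    assume "Dom C f = Dom C f' \<and> Cod C f = Cod C f'"
    then show "f = f'" using f f' ab ab' by (auto simp: Dom_ar Cod_ar zarr_iff)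
  next
    assume "inverse_pair C f f'"
    then show "f = Id C (Dom C f)"
      using f f' ab by (auto simp: inverse_pair_iff Dom_ar Id_ob zid_eq zarr_iff)
  next
    fix h assume h: "h \<in> mor C (Dom C f) (Dom C f')" and eq: "f = h \<Zsemi>\<^bsub>C\<^esub> f'"
    have "Dom C f = ob a" "Dom C f' = ob a'" using f f' by (simp_all add: Dom_ar)
    with h obtain k where h: "(a, k, a') \<in> zarr G L" "h = ar a k a'"
      using ab ab' by (auto simp: mor_eq)
    with eq f f' have "g = zmult G k g'" "b = b'"
      using Cmp_closed[OF h(1) f'(1)] by (auto simp: Cmp_ar)
    with f f' h show "h \<in> Inc C" by (auto simp: ar_in_Inc zarr_iff)
  }
qed

text \<open>Reduces uniqueness of normal factorisations to a calculation with the three labels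
  \<open>g1\<close>, \<open>g2\<close>, \<open>g3\<close> and the two intermediate objects.\<close>

lemma normal_factnE:
  assumes z: "(a, g, b) \<in> zarr G L" and n: "normal_factn C (ar a g b) t"
  obtains c g1 g2 d g3 where "t = (ar a g1 c, ar c g2 d, ar d g3 b)"
    "(a, g1, c) \<in> zarr G L" "(c, g2, d) \<in> zarr G L" "(d, g3, b) \<in> zarr G L"
    "zmult G (zmult G g1 g2) g3 = g" "c = None \<or> (a = c \<and> g1 = unit_label a)"
    "(c = None \<and> d = None) \<or> g2 \<noteq> None" "(d = b \<and> g3 = unit_label d) \<or> d = None"
proof -
  obtain r s j where t: "t = (r, s, j)" by (cases t)
  have "r \<in> Arr C" "s \<in> Arr C" "j \<in> Arr C"
    using n Inc_subset_Arr
        by (auto simp: t normal_factn_def is_retraction_def is_iso_def inverse_pair_def)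
  then obtain a1 g1 b1 a2 g2 b2 a3 g3 b3 where
    r: "(a1, g1, b1) \<in> zarr G L" "r = ar a1 g1 b1" and
    s: "(a2, g2, b2) \<in> zarr G L" "s = ar a2 g2 b2" and
    j: "(a3, g3, b3) \<in> zarr G L" "j = ar a3 g3 b3"
    by (elim ArrE)
  have "ob b1 = ob a2" "ob b2 = ob a3"
    using n r s j by (auto simp: t normal_factn_def Dom_ar Cod_ar)
  then have e: "a2 = b1" "a3 = b2" using r s j by (auto simp: zarr_iff)
  have rs: "(a1, zmult G g1 g2, b2) \<in> zarr G L" using r s Cmp_closed unfolding e by blast
  have rsj: "(a1, zmult G (zmult G g1 g2) g3, b3) \<in> zarr G L" using rs j Cmp_closed unfolding e
      by blast
  have "ar a g b = ar a1 (zmult G (zmult G g1 g2) g3) b3"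
    using n r s j rs by (simp add: t normal_factn_def e Cmp_ar)
  then have e2: "a1 = a" "b3 = b" "zmult G (zmult G g1 g2) g3 = g" using z rsj by auto
  show thesis
    by (rule that[of g1 b1 g2 b2 g3])
      (use n r s j e e2 in \<open>auto simp: t normal_factn_def is_retraction_iff is_iso_iff ar_in_Inc\<close>)
qed

text \<open>A product with value in G has no zero factor, so neither the retraction nor the
  inclusion can touch the object 0, and both are identities.\<close>

lemma normal_factn_nonzero:
  assumes "(a, Some g, b) \<in> zarr G L"
  shows "normal_factn C (ar a (Some g) b) t \<longleftrightarrow>
     t = (ar a (unit_label a) a, ar a (Some g) b, ar b (unit_label b) b)"
proof -
  have ab: "a \<in> with_zero L" "b \<in> with_zero L" "a \<noteq> None" "b \<noteq> None" "g \<in> carrier G"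
    using assms by (auto simp: zarr_iff)
  note z = zid_in_zarr[OF ab(1)] zid_in_zarr[OF ab(2)]
  show ?thesis
  proof
    assume t: "t = (ar a (unit_label a) a, ar a (Some g) b, ar b (unit_label b) b)"
    show "normal_factn C (ar a (Some g) b) t"
      using assms z ab unfolding t normal_factn_def
      by (simp add: is_retraction_iff is_iso_iff ar_in_Inc Dom_ar Cod_ar Cmp_ar)
  next
    assume "normal_factn C (ar a (Some g) b) t"
    with assms show "t = (ar a (unit_label a) a, ar a (Some g) b, ar b (unit_label b) b)"
    proof (cases rule: normal_factnE)
      case (1 c g1 g2 d g3)
      have "g1 \<noteq> None" "g3 \<noteq> None" using 1(5) by (metis zmult_None option.distinct(1))+
      then have "c = a" "g1 = Some \<one>" "d = b" "g3 = Some \<one>" using 1 by (auto simp: zarr_iff)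
      moreover have "g2 \<in> K" using 1 by (auto simp: zarr_iff)
      ultimately show ?thesis using 1 ab by auto
    qed
  qed
qed

text \<open>If one intermediate object were nonzero, the isomorphism would have a nonzero label;
  then both intermediate objects are nonzero, the outer factors are identities, and the product is
  nonzero. So the factorisation passes through 0.\<close>

lemma normal_factn_zero:
  assumes "(a, None, b) \<in> zarr G L"
  shows "normal_factn C (ar a None b) t \<longleftrightarrow>
     t = (ar a None None, ar None None None, ar None None b)"
proof
  have "a \<in> with_zero L" "b \<in> with_zero L" using assms by (auto simp: zarr_iff)
  then have z: "(a, None, None) \<in> zarr G L" "(None, None, None) \<in> zarr G L"
      "(None, None, b) \<in> zarr G L"
    by (auto simp: zarr_iff)
  assume t: "t = (ar a None None, ar None None None, ar None None b)"
  show "normal_factn C (ar a None b) t"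
    using assms z unfolding t normal_factn_def
    by (simp add: is_retraction_iff is_iso_iff ar_in_Inc Dom_ar Cod_ar Cmp_ar)
next
  assume "normal_factn C (ar a None b) t"
  with assms show "t = (ar a None None, ar None None None, ar None None b)"
  proof (cases rule: normal_factnE)
    case (1 c g1 g2 d g3)
    then have g0: "c = None \<or> d = None \<longrightarrow> g2 = None" "c = None \<longrightarrow> g1 = None" "d = None \<longrightarrow> g3 = None"
      by (auto simp: zarr_iff)
    have "c = None \<and> d = None"
    proof (rule ccontr)
      assume "\<not> (c = None \<and> d = None)"
      with 1(7) have "g2 \<noteq> None" "c \<noteq> None" "d \<noteq> None" using g0 by auto
      with 1(5,6,8) show False by auto
    qed
    with g0 1 show ?thesis by auto
  qed
qed

text \<open>The epimorphic part of a zero morphism ends at 0, whatever its codomain was. This is why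
  multiplying a cone by a zero label moves its apex to 0.\<close>

lemma epi_part_ar:
  assumes "(a, g, b) \<in> zarr G L"
  shows "epi_part C (ar a g b) = (if g = None then ar a None None else ar a g b)"
proof (cases g)
  case None
  then have z: "(a, None, b) \<in> zarr G L" "(a, None, None) \<in> zarr G L"
      "(None, None, None) \<in> zarr G L"
    using assms by (auto simp: zarr_iff)
  show ?thesis
    unfolding epi_part_def using z None by (auto simp: normal_factn_zero Cmp_ar)
next
  case (Some x)
  have z: "(a, Some x, b) \<in> zarr G L" "(a, Some \<one>, a) \<in> zarr G L" "a \<noteq> None" "Some x \<in> K"
    using assms Some by (auto simp: zarr_iff)
  then show ?thesis
    unfolding epi_part_def using Some by (auto simp: normal_factn_nonzero Cmp_ar[OF z(2,1)])
qed

text \<open>For an inclusion out of 0, the retraction ends at 0 and its label is forced; otherwise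
  the inclusion is an identity.\<close>

lemma unique_retraction:
  assumes "j \<in> Inc C"
  shows "\<exists>!r. r \<in> mor C (Cod C j) (Dom C j) \<and> j \<Zsemi>\<^bsub>C\<^esub> r = Id C (Dom C j)"
proof -
  obtain a g b where j: "(a, g, b) \<in> zarr G L" "j = ar a g b" "(a = b \<and> g = unit_label a) \<or> a =
      None"
    using assms by (rule IncE)
  have ab: "a \<in> with_zero L" "b \<in> with_zero L" using j by (auto simp: zarr_iff)
  have z: "(b, unit_label a, a) \<in> zarr G L" using j ab by (auto simp: zarr_iff)
  show ?thesis
  proof (rule ex1I[of _ "ar b (unit_label a) a"])
    have "zmult G g (unit_label a) = unit_label a" using j by (auto simp: zarr_iff)
    then show "ar b (unit_label a) a \<in> mor C (Cod C j) (Dom C j) \<and> j \<Zsemi>\<^bsub>C\<^esub> ar b (unit_label a) a =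
        Id C (Dom C j)"
      using j z ab by (simp only: Dom_ar Cod_ar ar_in_mor Cmp_ar Id_ob zid_eq simp_thms)
  next
    fix r assume r: "r \<in> mor C (Cod C j) (Dom C j) \<and> j \<Zsemi>\<^bsub>C\<^esub> r = Id C (Dom C j)"
    then obtain h where h: "(b, h, a) \<in> zarr G L" "r = ar b h a"
      using j ab by (auto simp: Dom_ar Cod_ar mor_eq)
    with r j have "ar a (zmult G g h) a = ar a (unit_label a) a"
      using ab by (simp add: Dom_ar Cmp_ar Id_ob zid_eq)
    then have "zmult G g h = unit_label a"
      using Cmp_closed[OF j(1) h(1)] zid_in_zarr[OF ab(1)] by simp
    with j h show "r = ar b (unit_label a) a" by (auto simp: zarr_iff)
  qed
qed

end

context coordinatised
begin

section \<open>Normal cones\<close>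

abbreviation tuple :: "('l \<Rightarrow> 'a option) \<Rightarrow> bool" where "tuple t \<equiv> \<forall>l\<in>L. t l \<in> K"
abbreviation nonzero :: "('l \<Rightarrow> 'a option) \<Rightarrow> bool" where "nonzero t \<equiv> \<exists>l\<in>L. t l \<noteq> None"
abbreviation scale :: "('l \<Rightarrow> 'a option) \<Rightarrow> 'a option \<Rightarrow> 'l \<Rightarrow> 'a option"
  where "scale t g \<equiv> (\<lambda>l. zmult G (t l) g)"
abbreviation cone :: "('l \<Rightarrow> 'a option) \<Rightarrow> 'l option \<Rightarrow> 'o \<Rightarrow> 'm" where "cone \<equiv> tcone \<Phi> L"
abbreviation label :: "('l \<Rightarrow> 'a option) \<Rightarrow> 'l option \<Rightarrow> 'a option"
  where "label t a \<equiv> (case a of None \<Rightarrow> None | Some l \<Rightarrow> t l)"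

lemma label_in_zarr:
  "tuple t \<Longrightarrow> a \<in> with_zero L \<Longrightarrow> Some l \<in> with_zero L \<Longrightarrow> (a, label t a, Some l) \<in> zarr G L"
  by (auto simp: zarr_iff split: option.splits)

lemma zero_in_zarr: "a \<in> with_zero L \<Longrightarrow> b \<in> with_zero L \<Longrightarrow> (a, None, b) \<in> zarr G L"
  by (auto simp: zarr_iff)

lemma cone_at:
  assumes "a \<in> with_zero L"
  shows "cone t c (ob a) = (if c = None \<or> \<not> nonzero t then ar a None None else ar a (label t a) c)"
  using assms inj_ob by (simp add: tcone_def)

lemma cone_extensional: "cone t c \<in> extensional (Obj C)"
  by (simp add: tcone_def Obj_eq)

lemma cone_eqI:
  assumes "\<gamma> \<in> extensional (Obj C)" "\<And>a. a \<in> with_zero L \<Longrightarrow> \<gamma> (ob a) = cone t c (ob a)"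
  shows "\<gamma> = cone t c"
  by (rule extensionalityI[OF assms(1) cone_extensional]) (auto simp: assms(2) elim: ObjE)

lemma cone_zero: "c = None \<or> \<not> nonzero t \<Longrightarrow> cone t c = cone (\<lambda>_. None) None"
  by (rule cone_eqI[OF cone_extensional]) (auto simp: cone_at)

lemma cone_zero_eq: "c = None \<or> \<not> nonzero t \<Longrightarrow> c = None \<or> \<not> nonzero s \<Longrightarrow> cone t c = cone s c"
  using cone_zero[of c t] cone_zero[of c s] by simp

lemma cone_cong: "(\<And>l. l \<in> L \<Longrightarrow> t l = s l) \<Longrightarrow> cone t c = cone s c"
  by (rule cone_eqI[OF cone_extensional]) (auto simp: cone_at split: option.splits)

text \<open>The component at 0 reveals the apex: it ends at c for a cone (t; c) that is not the zero
  cone, and at 0 for the zero cone. Once the apexes agree, the component at l gives the entry t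
  l.\<close>

lemma cone_eqD:
  assumes eq: "cone t c = cone s d" and ts: "tuple t" "tuple s"
      and cd: "c \<in> with_zero L" "d \<in> with_zero L"
    and nz: "c \<noteq> None" "nonzero t"
  shows "c = d" "nonzero s" "\<And>l. l \<in> L \<Longrightarrow> t l = s l"
proof -
  obtain k where k: "c = Some k" "k \<in> L" using nz cd by auto
  have *: "(if c = None \<or> \<not> nonzero t then ar a None None else ar a (label t a) c) =
      (if d = None \<or> \<not> nonzero s then ar a None None else ar a (label s a) d)"
    if "a \<in> with_zero L" for a
    using arg_cong[OF eq, of "\<lambda>h. h (ob a)"] that by (simp only: cone_at)
  have z: "(None, None, d) \<in> zarr G L" "(None, None, c) \<in> zarr G L" "(None, None, None) \<in> zarr G L"
    using cd by (auto simp: zarr_iff)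
  have d: "d \<noteq> None \<and> nonzero s \<and> c = d"
    using *[of None] nz z by (auto split: if_splits)
  then show "c = d" "nonzero s" by auto
  fix l assume "l \<in> L"
  then have "(Some l, t l, c) \<in> zarr G L" "(Some l, s l, c) \<in> zarr G L"
    using ts k by (auto simp: zarr_iff)
  moreover have "ar (Some l) (t l) c = ar (Some l) (s l) c"
    using *[of "Some l"] \<open>l \<in> L\<close> d nz by (simp split: if_splits)
  ultimately show "t l = s l" by simp
qed

lemma cone_eq_zeroD:
  assumes "cone t c = cone s d" "tuple t" "tuple s" "c \<in> with_zero L" "d \<in> with_zero L"
    and "d = None \<or> \<not> nonzero s"
  shows "c = None \<or> \<not> nonzero t"
  using cone_eqD[OF assms(1-5)] assms(6) by blast

text \<open>Every component ends at the apex; the one at the object 0 always exists and is used to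
  read it off.\<close>

lemma apex_eq:
  assumes "normal_cone C d \<gamma>"
  shows "apex C \<gamma> = d"
proof -
  have *: "Cod C (\<gamma> (ob None)) = e" if "normal_cone C e \<gamma>" for e
    using that by (auto simp: normal_cone_def mor_def)
  show ?thesis
    unfolding apex_def by (rule the_equality) (use assms * in auto)
qed

text \<open>In the reduced form, the case distinction of \<open>tcone\<close> disappears: the zero
  cone is then (0; 0), and its components follow the same formula as all others.\<close>

lemma cone_at_reduced:
  assumes "tuple t" "c \<in> with_zero L" "nonzero t \<longleftrightarrow> c \<noteq> None" "a \<in> with_zero L"
  shows "cone t c (ob a) = ar a (label t a) c" "(a, label t a, c) \<in> zarr G L"
  using assms by (cases a; cases c; auto simp: cone_at zarr_iff)+

lemma normal_cone_cone:
  assumes t: "tuple t" "c \<in> with_zero L" "nonzero t \<longleftrightarrow> c \<noteq> None"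
  shows "normal_cone C (ob c) (cone t c)"
  unfolding normal_cone_def
proof (intro conjI ballI impI)
  note at = cone_at_reduced[OF t]
  show "ob c \<in> Obj C" using t by simp
  show "cone t c \<in> extensional (Obj C)" by (rule cone_extensional)
  \<comment> \<open>The component at \<open>l\<close> will be the isomorphism: any index with a
    nonzero entry, or the object 0 if the apex is 0.\<close>
  obtain l where "l \<in> with_zero L" "c = None \<and> l = None \<or> label t l \<noteq> None"
  proof (cases c)
    case (Some k)
    then obtain l where "l \<in> L" "t l \<noteq> None" using t by auto
    then show ?thesis using that[of "Some l"] by simp
  qed (use that[of None] in simp)
  then have "is_iso C (cone t c (ob l))" "ob l \<in> Obj C" using at by (auto simp: is_iso_iff)
  then show "\<exists>a\<in>Obj C. is_iso C (cone t c a)" by blast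
  fix x assume "x \<in> Obj C"
  then obtain a where a: "a \<in> with_zero L" "x = ob a" by (rule ObjE)
  then show "cone t c x \<in> mor C x (ob c)" using at t by (simp add: ar_in_mor)
  fix y assume "y \<in> Obj C"
  then obtain b where b: "b \<in> with_zero L" "y = ob b" by (rule ObjE)
  assume "subobj C x y"
  with a b have ab: "a = b \<or> a = None" by (simp add: subobj_iff)
  moreover have "(a, unit_label a, b) \<in> zarr G L" using ab a b by (auto simp: zarr_iff)
  moreover have "zmult G (unit_label a) (label t b) = label t a"
    using ab unit_label_zmult(1)[OF at(2)[OF a(1)]] by auto
  ultimately show "incl C x y \<Zsemi>\<^bsub>C\<^esub> cone t c y = cone t c x"
    using a b at by (simp add: incl_eq Cmp_ar)
qed

text \<open>Components of a cone with apex c are arrows into c, so they amount to labels. If c = 0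
  all are 0; if not, the isomorphism among the components has a nonzero label, which makes the tuple
  nonzero.\<close>

lemma cones_iff:
  "\<gamma> \<in> cones C \<longleftrightarrow> (\<exists>t c. tuple t \<and> c \<in> with_zero L \<and> (nonzero t \<longleftrightarrow> c \<noteq> None) \<and> \<gamma> = cone t c)"
proof
  assume "\<gamma> \<in> cones C"
  then obtain d where n: "normal_cone C d \<gamma>" by (auto simp: cones_def)
  then obtain c where c: "c \<in> with_zero L" "d = ob c" by (auto simp: normal_cone_def elim: ObjE)
  have ext: "\<gamma> \<in> extensional (Obj C)" using n by (simp add: normal_cone_def)
  have m: "\<exists>g. (a, g, c) \<in> zarr G L \<and> \<gamma> (ob a) = ar a g c" if "a \<in> with_zero L" for a
  proof -
    have "\<gamma> (ob a) \<in> mor C (ob a) (ob c)" using n c that by (auto simp: normal_cone_def)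
    then show ?thesis using that c by (auto simp: mor_eq)
  qed
  show "\<exists>t c. tuple t \<and> c \<in> with_zero L \<and> (nonzero t \<longleftrightarrow> c \<noteq> None) \<and> \<gamma> = cone t c"
  proof (cases c)
    case None
    have "\<gamma> = cone (\<lambda>_. None) None"
      by (rule cone_eqI[OF ext]) (use m None in \<open>fastforce simp: cone_at zarr_iff\<close>)
    then show ?thesis by (intro exI[of _ "\<lambda>_. None"] exI[of _ None]) simp
  next
    case (Some k)
    define t where "t l = (SOME g. (Some l, g, c) \<in> zarr G L \<and> \<gamma> (ob (Some l)) = ar (Some l) g c)"
        for l
    have t: "(Some l, t l, c) \<in> zarr G L \<and> \<gamma> (ob (Some l)) = ar (Some l) (t l) c" if "l \<in> L" for l
      unfolding t_def by (rule someI_ex) (use m[of "Some l"] that in simp)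
    have tup: "tuple t" using t by (auto simp: zarr_iff)
    have None: "\<gamma> (ob None) = ar None None c" using m[of None] by (auto simp: zarr_iff)
    obtain x where "x \<in> Obj C" "is_iso C (\<gamma> x)" using n by (auto simp: normal_cone_def)
    then obtain a where a: "a \<in> with_zero L" "is_iso C (\<gamma> (ob a))" by (auto elim: ObjE)
    then have nz: "nonzero t"
    proof (cases a)
      case None
      then show ?thesis using a \<open>\<gamma> (ob None) = _\<close> Some c zero_in_zarr[of None c]
          by (simp add: is_iso_iff)
    next
      case (Some l)
      with a have "l \<in> L" by simp
      moreover have "t l \<noteq> None" using t[OF \<open>l \<in> L\<close>] a Some by (auto simp: is_iso_iff)
      ultimately show ?thesis by auto
    qed
    have "\<gamma> = cone t c"
    proof (rule cone_eqI[OF ext])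
      fix b assume "b \<in> with_zero L"
      then show "\<gamma> (ob b) = cone t c (ob b)"
        using nz t None Some by (cases b) (auto simp: cone_at)
    qed
    with tup c nz Some show ?thesis by blast
  qed
next
  assume "\<exists>t c. tuple t \<and> c \<in> with_zero L \<and> (nonzero t \<longleftrightarrow> c \<noteq> None) \<and> \<gamma> = cone t c"
  then show "\<gamma> \<in> cones C" using normal_cone_cone unfolding cones_def by blast
qed

lemma apex_cone:
  "tuple t \<Longrightarrow> c \<in> with_zero L \<Longrightarrow> (nonzero t \<longleftrightarrow> c \<noteq> None) \<Longrightarrow> apex C (cone t c) = ob c"
  by (intro apex_eq normal_cone_cone)

lemma cone_in_cones: "tuple t \<Longrightarrow> c \<in> with_zero L \<Longrightarrow> cone t c \<in> cones C"
proof -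
  assume t: "tuple t" "c \<in> with_zero L"
  show ?thesis
  proof (cases "c = None \<or> \<not> nonzero t")
    case True
    then show ?thesis using cone_zero[of c t] normal_cone_cone[of "\<lambda>_. None" None]
        by (auto simp: cones_def)
  next
    case False
    then show ?thesis using t cones_iff by blast
  qed
qed

section \<open>Idempotent cones and unambiguity\<close>

definition idem_tuple :: "('l \<Rightarrow> 'a option) \<Rightarrow> 'l option \<Rightarrow> bool" where
  "idem_tuple t c \<longleftrightarrow> tuple t \<and> c \<in> with_zero L \<and> (nonzero t \<longleftrightarrow> c \<noteq> None) \<and> label t c = unit_label c"

lemma idem_tupleD:
  assumes "idem_tuple t c"
  shows "tuple t" "c \<in> with_zero L" "nonzero t \<longleftrightarrow> c \<noteq> None" "label t c = unit_label c"
    "apex C (cone t c) = ob c"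
  using assms apex_cone[of t c] unfolding idem_tuple_def by blast+

lemma idem_cones_iff: "\<mu> \<in> idem_cones C \<longleftrightarrow> (\<exists>t c. idem_tuple t c \<and> \<mu> = cone t c)"
proof -
  have "cone t c (ob c) = Id C (ob c) \<longleftrightarrow> label t c = unit_label c"
    if "tuple t" "c \<in> with_zero L" "nonzero t \<longleftrightarrow> c \<noteq> None" for t c
  proof (cases c)
    case None
    then show ?thesis using that by (simp add: cone_at Id_ob zid_eq)
  next
    case (Some k)
    then have "(c, label t c, c) \<in> zarr G L" "(c, unit_label c, c) \<in> zarr G L"
      using that by (auto simp: zarr_iff)
    then show ?thesis using that Some by (auto simp: cone_at Id_ob zid_eq)
  qed
  then have *: "cone t c (apex C (cone t c)) = Id C (apex C (cone t c)) \<longleftrightarrow> label t c = unit_label c"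
    if "tuple t" "c \<in> with_zero L" "nonzero t \<longleftrightarrow> c \<noteq> None" for t c
    using that by (simp only: apex_cone)
  show ?thesis
  proof
    assume "\<mu> \<in> idem_cones C"
    then obtain t c where t: "tuple t" "c \<in> with_zero L" "nonzero t \<longleftrightarrow> c \<noteq> None" "\<mu> = cone t c"
      and i: "\<mu> (apex C \<mu>) = Id C (apex C \<mu>)"
      unfolding idem_cones_def cones_iff by blast
    then show "\<exists>t c. idem_tuple t c \<and> \<mu> = cone t c"
      using * unfolding idem_tuple_def by blast
  next
    assume "\<exists>t c. idem_tuple t c \<and> \<mu> = cone t c"
    then show "\<mu> \<in> idem_cones C"
      using * unfolding idem_cones_def idem_tuple_def cones_iff by blast
  qed
qed

lemma unambiguous: "unambiguous C"
  unfolding unambiguous_def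
proof (intro conjI ballI)
  show "cat_with_subobjects C" by (rule cat_with_subobjects)
  fix j assume "j \<in> Inc C"
  then show "\<exists>!r. r \<in> mor C (Cod C j) (Dom C j) \<and> j \<Zsemi>\<^bsub>C\<^esub> r = Id C (Dom C j)"
    by (rule unique_retraction)
next
  fix f assume "f \<in> Arr C"
  then obtain a g b where f: "(a, g, b) \<in> zarr G L" "f = ar a g b" by (rule ArrE)
  then show "\<exists>!t. normal_factn C f t"
    by (cases g) (auto simp: normal_factn_zero normal_factn_nonzero)
next
  fix x assume "x \<in> Obj C"
  then obtain c where c: "c \<in> with_zero L" "x = ob c" by (rule ObjE)
  have "idem_tuple (\<lambda>_. unit_label c) c"
    using c by (cases c) (auto simp: idem_tuple_def)
  then have "cone (\<lambda>_. unit_label c) c \<in> idem_cones C" "apex C (cone (\<lambda>_. unit_label c) c) = x"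
    using c idem_tupleD(5) by (auto simp: idem_cones_iff)
  then show "\<exists>\<mu>\<in>cones C. \<mu> x = Id C x"
    by (auto simp: idem_cones_def)
qed

text \<open>For a nonzero label the epimorphic part is the morphism itself and the tuple is
  multiplied entrywise. For the zero label the epimorphic part ends at 0 and both sides are the zero
  cone.\<close>

lemma cone_star_cone:
  assumes t: "tuple t" "nonzero t \<longleftrightarrow> c \<noteq> None" and g: "(c, g, b) \<in> zarr G L"
  shows "cone_star C (cone t c) (epi_part C (ar c g b)) = cone (scale t g) b"
proof (rule cone_eqI)
  show "cone_star C (cone t c) (epi_part C (ar c g b)) \<in> extensional (Obj C)"
    by (simp add: cone_star_def)
  fix a assume a: "a \<in> with_zero L"
  have c: "c \<in> with_zero L" using g by (simp add: zarr_iff)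
  note at = cone_at_reduced[OF t(1) c t(2) a]
  show "cone_star C (cone t c) (epi_part C (ar c g b)) (ob a) = cone (scale t g) b (ob a)"
  proof (cases g)
    case None
    then show ?thesis
      using a at zero_in_zarr[OF c, of None] g
          by (simp add: cone_star_def epi_part_ar Cmp_ar cone_at)
  next
    case (Some x)
    then have nz: "b \<noteq> None" "nonzero (scale t g)" using g t by (auto simp: zarr_iff)
    have "cone_star C (cone t c) (epi_part C (ar c g b)) (ob a) = ar a (zmult G (label t a) g) b"
      using a g at Some by (simp add: cone_star_def epi_part_ar Cmp_ar)
    also have "\<dots> = cone (scale t g) b (ob a)"
      using a nz by (cases a) (auto simp: cone_at)
    finally show ?thesis .
  qed
qed

lemma scale_assoc:
  "tuple t \<Longrightarrow> x \<in> K \<Longrightarrow> y \<in> K \<Longrightarrow> cone (scale (scale t x) y) b = cone (scale t (zmult G x y)) b"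
  by (rule cone_cong) (simp add: zmult_assoc)

lemma scale_one: "tuple t \<Longrightarrow> cone (scale t (Some \<one>)) b = cone t b"
  by (rule cone_cong) simp

text \<open>The scalar is recovered by cancelling a nonzero entry of \<open>t\<close>. At the apex 0
  all cones coincide, hence the condition on \<open>b\<close>.\<close>

lemma cone_scale_inj:
  assumes t: "tuple t" "nonzero t" and xy: "x \<in> K" "y \<in> K" and b: "b \<in> with_zero L" "b \<noteq> None"
    and eq: "cone (scale t x) b = cone (scale t y) b"
  shows "x = y"
proof (cases "x = None")
  case True
  then have "\<not> nonzero (scale t x)" by simp
  then have "\<not> nonzero (scale t y)"
    using cone_eq_zeroD[OF eq[symmetric]] t xy b by auto
  then show ?thesis using True t by auto
next
  case False
  then have nz: "nonzero (scale t x)" using t by auto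
  obtain l where l: "l \<in> L" "t l \<noteq> None" using t by auto
  have "zmult G (t l) x = zmult G (t l) y"
    using cone_eqD(3)[OF eq _ _ b(1) b(1) b(2) nz l(1)] t xy by auto
  then show ?thesis using zmult_left_cancel t xy l by auto
qed

section \<open>The H-functors\<close>

lemma H_obj_cone:
  assumes t: "idem_tuple t c" and b: "b \<in> with_zero L"
  shows "H_obj C (cone t c) (ob b) = {cone (scale t x) b | x. x \<in> K}"
proof -
  note D = idem_tupleD[OF t]
  have "H_obj C (cone t c) (ob b) =
      {cone_star C (cone t c) (epi_part C (ar c x b)) | x. (c, x, b) \<in> zarr G L}"
    using D b by (auto simp: H_obj_def mor_eq)
  also have "\<dots> = {cone (scale t x) b | x. (c, x, b) \<in> zarr G L}"
    using D cone_star_cone by (metis (no_types, lifting))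
  also have "\<dots> = {cone (scale t x) b | x. x \<in> K}"
  \<comment> \<open>If \<open>c\<close> or \<open>b\<close> is 0, only the zero label is allowed,
    but then every scalar gives the zero cone, so letting \<open>x\<close> range over all of
    \<open>K\<close> adds nothing.\<close>
  proof (cases "c = None \<or> b = None")
    case True
    then have "b = None \<or> \<not> nonzero (scale t x)" for x using D by auto
    then have "cone (scale t x) b = cone (\<lambda>_. None) None" for x by (intro cone_zero) blast
    moreover have "(c, None, b) \<in> zarr G L" "None \<in> K" using b D zero_in_zarr[of c b] by auto
    ultimately show ?thesis by (metis (no_types, lifting))
  next
    case False
    then show ?thesis using b D by (auto simp: zarr_iff)
  qed
  finally show ?thesis .
qed

text \<open>The scalar is taken as the label of an arrow c -> b because only then is it determined
  by the cone: at the object 0 different scalars give the same cone, while the label must be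
  0.\<close>

lemma eta_cone:
  assumes t: "idem_tuple t c" and x: "(c, x, b) \<in> zarr G L"
  shows "eta C (cone t c) (ob b) (cone (scale t x) b) = ar c x b"
  unfolding eta_def
proof (rule the_equality)
  note D = idem_tupleD[OF t]
  have xb: "x \<in> K" "b \<in> with_zero L" using x by (auto simp: zarr_iff)
  show "ar c x b \<in> mor C (apex C (cone t c)) (ob b) \<and>
      cone (scale t x) b = cone_star C (cone t c) (epi_part C (ar c x b))"
    using D xb x cone_star_cone[OF D(1,3) x] by (simp add: ar_in_mor)
  fix f assume f: "f \<in> mor C (apex C (cone t c)) (ob b) \<and>
      cone (scale t x) b = cone_star C (cone t c) (epi_part C f)"
  then obtain y where y: "(c, y, b) \<in> zarr G L" "f = ar c y b" using D xb by (auto simp: mor_eq)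
  have eq: "cone (scale t x) b = cone (scale t y) b" using f y cone_star_cone[OF D(1,3)] by simp
  have "x = y"
  proof (cases "c = None \<or> b = None")
    case True
    then show ?thesis using x y by (auto simp: zarr_iff)
  next
    case False
    then show ?thesis using cone_scale_inj[OF D(1) _ _ _ _ _ eq] D x y by (auto simp: zarr_iff)
  qed
  then show "f = ar c x b" using y by simp
qed

text \<open>\<open>is_H F t\<close> says that \<open>F\<close> is the \<open>H\<close>-functor written \<open>tG\<^sup>0\<close>.\<close>

definition is_H :: "('o, 'm) hfun \<Rightarrow> ('l \<Rightarrow> 'a option) \<Rightarrow> bool" where
  "is_H F t \<longleftrightarrow> F \<in> H_fun C ` idem_cones C \<and> tuple t \<and>
     (\<forall>b\<in>with_zero L. SObj F (ob b) = {cone (scale t x) b | x. x \<in> K}) \<and>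
     (\<forall>b h d x. (b, h, d) \<in> zarr G L \<longrightarrow> x \<in> K \<longrightarrow>
        SMap F (ar b h d) (cone (scale t x) b) = cone (scale t (zmult G x h)) d)"

lemma is_HD:
  assumes "is_H F t"
  shows "F \<in> H_fun C ` idem_cones C" "tuple t"
    "\<And>b. b \<in> with_zero L \<Longrightarrow> SObj F (ob b) = {cone (scale t x) b | x. x \<in> K}"
    "\<And>b h d x. (b, h, d) \<in> zarr G L \<Longrightarrow> x \<in> K \<Longrightarrow>
        SMap F (ar b h d) (cone (scale t x) b) = cone (scale t (zmult G x h)) d"
  using assms unfolding is_H_def by blast+

text \<open>Under \<open>eta\<close> an element (tx; b) becomes the arrow labelled x; composing with
  an arrow labelled h multiplies this on the right, giving (txh; d).\<close>

lemma is_H_H_fun: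
  assumes t: "idem_tuple t c"
  shows "is_H (H_fun C (cone t c)) t"
  unfolding is_H_def
proof (intro conjI ballI allI impI)
  note D = idem_tupleD[OF t]
  show "H_fun C (cone t c) \<in> H_fun C ` idem_cones C" using t idem_cones_iff by blast
  fix l assume "l \<in> L" then show "t l \<in> K" using D(1) by blast
next
  fix b assume "b \<in> with_zero L"
  then show "SObj (H_fun C (cone t c)) (ob b) = {cone (scale t x) b | x. x \<in> K}"
    by (simp add: H_fun_def H_obj_cone[OF t])
next
  note D = idem_tupleD[OF t]
  fix b h d x assume h: "(b, h, d) \<in> zarr G L" and x: "x \<in> K"
  then have bd: "b \<in> with_zero L" "d \<in> with_zero L" "h \<in> K" by (auto simp: zarr_iff)
  have mem: "cone (scale t x) b \<in> H_obj C (cone t c) (ob b)"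
    if "x \<in> K" for x using that bd by (auto simp: H_obj_cone[OF t])
  have main: "SMap (H_fun C (cone t c)) (ar b h d) (cone (scale t x) b) =
      cone (scale t (zmult G x h)) d"
    if x: "(c, x, b) \<in> zarr G L" for x
  proof -
    have "SMap (H_fun C (cone t c)) (ar b h d) (cone (scale t x) b) =
        cone_star C (cone t c) (epi_part C (eta C (cone t c) (ob b) (cone (scale t x) b) \<Zsemi>\<^bsub>C\<^esub> ar b h
            d))"
      using h x mem[of x] by (simp add: H_fun_def ar_in_Arr Dom_ar zarr_iff)
    also have "\<dots> = cone_star C (cone t c) (epi_part C (ar c (zmult G x h) d))"
      using h x by (simp add: eta_cone[OF t] Cmp_ar)
    also have "\<dots> = cone (scale t (zmult G x h)) d"
      by (rule cone_star_cone[OF D(1,3) Cmp_closed[OF x h]])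
    finally show ?thesis .
  qed
  show "SMap (H_fun C (cone t c)) (ar b h d) (cone (scale t x) b) = cone (scale t (zmult G x h)) d"
  \<comment> \<open>The calculation in \<open>main\<close> needs x to label an arrow c -> b. If
    \<open>c\<close> or \<open>b\<close> is 0, x is first replaced by the scalar 0, which changes
    neither side.\<close>
  proof (cases "c = None \<or> b = None")
    case True
    then have 1: "cone (scale t x) b = cone (scale t None) b"
      using cone_zero[of b "scale t x"] cone_zero[of b "scale t None"] D by force
    have 2: "cone (scale t (zmult G x h)) d = cone (scale t (zmult G None h)) d"
      using cone_zero[of d "scale t (zmult G x h)"] cone_zero[of d
          "scale t (zmult G None h)"] D True h
      by (force simp: zarr_iff)
    show ?thesis unfolding 1 2 by (rule main) (use D bd in \<open>simp add: zarr_iff\<close>)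
  next
    case False
    then show ?thesis using x D bd by (intro main) (auto simp: zarr_iff)
  qed
qed

lemma is_H_ex: "F \<in> H_fun C ` idem_cones C \<Longrightarrow> \<exists>t. is_H F t"
  using is_H_H_fun by (metis idem_cones_iff imageE)

lemma is_H_cong:
  assumes "is_H F t" "\<And>l. l \<in> L \<Longrightarrow> t l = s l"
  shows "is_H F s"
proof -
  have "cone (scale s x) b = cone (scale t x) b" for x b
    by (rule cone_cong) (simp add: assms(2))
  moreover have "tuple s" using is_HD(2)[OF assms(1)] assms(2) by auto
  ultimately show ?thesis using assms(1) by (simp add: is_H_def)
qed

text \<open>Substituting g^-1 x for x shows that tg and t run through the same cones, and left
  factors of x do not interfere with the right multiplication by h.\<close>

lemma is_H_scale:
  assumes H: "is_H F t" and g: "g \<in> K" "g \<noteq> None"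
  shows "is_H F (scale t g)"
proof -
  note D = is_HD[OF H]
  have eq: "{cone (scale (scale t g) x) b | x. x \<in> K} = {cone (scale t x) b | x. x \<in> K}" for b
  proof (intro equalityI subsetI)
    fix z assume "z \<in> {cone (scale (scale t g) x) b | x. x \<in> K}"
    then show "z \<in> {cone (scale t x) b | x. x \<in> K}" using g D(2) by (auto simp: scale_assoc)
  next
    fix z assume "z \<in> {cone (scale t x) b | x. x \<in> K}"
    then obtain x where x: "x \<in> K" "z = cone (scale t x) b" by auto
    have "zmult G g (zmult G (zinv G g) x) = x" using g x
        by (auto simp flip: zmult_assoc simp: zinv_zmult)
    then have "z = cone (scale (scale t g) (zmult G (zinv G g) x)) b"
      using g x D(2) by (simp add: scale_assoc)
    then show "z \<in> {cone (scale (scale t g) x) b | x. x \<in> K}" using g x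
      by (intro CollectI exI[of _ "zmult G (zinv G g) x"] conjI) auto
  qed
  have "SMap F (ar b h d) (cone (scale (scale t g) x) b) = cone (scale (scale t g) (zmult G x h)) d"
    if "(b, h, d) \<in> zarr G L" "x \<in> K" for b h d x
    using that g D(2) D(4)[OF that(1), of "zmult G g x"]
        by (simp add: scale_assoc zarr_iff zmult_assoc)
  then show ?thesis using D g unfolding is_H_def eq by simp
qed

text \<open>Dividing a nonzero tuple by one of its nonzero entries, say at l, puts 1 there and makes
  it the tuple of an idempotent cone with apex l; scaling back by that entry recovers t.\<close>

lemma is_H_tuple:
  assumes t: "tuple t"
  shows "\<exists>F. is_H F t"
proof (cases "nonzero t")
  case False
  have "idem_tuple (\<lambda>_. None) None" by (simp add: idem_tuple_def)
  then have "is_H (H_fun C (cone (\<lambda>_. None) None)) (\<lambda>_. None)" by (rule is_H_H_fun)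
  then have "is_H (H_fun C (cone (\<lambda>_. None) None)) t" by (rule is_H_cong) (use False in auto)
  then show ?thesis ..
next
  case True
  then obtain l where l: "l \<in> L" "t l \<noteq> None" by auto
  have K: "t l \<in> K" using t l by auto
  have "idem_tuple (scale t (zinv G (t l))) (Some l)"
    using l t K by (auto simp: idem_tuple_def zinv_zmult)
  then have "is_H (H_fun C (cone (scale t (zinv G (t l))) (Some l))) (scale t (zinv G (t l)))"
    by (rule is_H_H_fun)
  then have "is_H (H_fun C (cone (scale t (zinv G (t l))) (Some l))) (scale (scale t (zinv G (t l)))
      (t l))"
    by (rule is_H_scale) (use K l in auto)
  then have "is_H (H_fun C (cone (scale t (zinv G (t l))) (Some l))) t"
    by (rule is_H_cong) (use K l t in \<open>auto simp: zmult_assoc zinv_zmult\<close>)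
  then show ?thesis ..
qed

text \<open>H-functors are \<open>undefined\<close> outside their domains, and inside both the sets
  and the action on each cone (tx; b) are expressed through t alone.\<close>

lemma is_H_unique:
  assumes "is_H F t" "is_H F' t"
  shows "F = F'"
proof -
  note D = is_HD[OF assms(1)] and D' = is_HD[OF assms(2)]
  obtain \<mu> \<mu>' where \<mu>: "F = H_fun C \<mu>" "F' = H_fun C \<mu>'" using D(1) D'(1) by auto
  have S: "SObj F (ob b) = SObj F' (ob b)" if "b \<in> with_zero L" for b using D(3) D'(3) that by simp
  have 1: "SObj F = SObj F'"
    by (rule extensionalityI[of _ "Obj C"]) (auto simp: S elim!: ObjE, auto simp: \<mu> H_fun_def)
  have 2: "SMap F = SMap F'"
  proof (rule extensionalityI[of _ "Arr C"])
    show "SMap F \<in> extensional (Arr C)" "SMap F' \<in> extensional (Arr C)"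
        by (simp_all add: \<mu> H_fun_def)
    fix f assume f: "f \<in> Arr C"
    then obtain b h d where h: "(b, h, d) \<in> zarr G L" "f = ar b h d" by (rule ArrE)
    then have b: "b \<in> with_zero L" by (simp add: zarr_iff)
    show "SMap F f = SMap F' f"
    proof (rule extensionalityI[of _ "SObj F (ob b)"])
      show "SMap F f \<in> extensional (SObj F (ob b))" using f h b by (simp add: \<mu> H_fun_def Dom_ar)
      show "SMap F' f \<in> extensional (SObj F (ob b))"
        unfolding S[OF b] using f h b by (simp add: \<mu> H_fun_def Dom_ar)
      fix z assume "z \<in> SObj F (ob b)"
      then obtain x where "x \<in> K" "z = cone (scale t x) b" using D(3)[OF b] by auto
      then show "SMap F f z = SMap F' f z" using D(4) D'(4) h by simp
    qed
  qed
  show ?thesis using 1 2 by (cases F; cases F') simp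
qed

text \<open>The cone of s itself lies in the class of s, for the scalar 1, and so has the form (tx;
  l). Since s is nonzero, x is nonzero.\<close>

lemma cone_class_proportional:
  assumes s: "tuple s" "nonzero s" and t: "tuple t" and l: "l \<in> L"
    and eq: "{cone (scale s x) (Some l) | x. x \<in> K} = {cone (scale t x) (Some l) | x. x \<in> K}"
  shows "\<exists>x\<in>K. x \<noteq> None \<and> (\<forall>k\<in>L. s k = zmult G (t k) x)"
proof -
  have b: "Some l \<in> with_zero L" "Some l \<noteq> None" using l by auto
  have "cone (scale s (Some \<one>)) (Some l) \<in> {cone (scale s x) (Some l) | x. x \<in> K}"
    by (rule CollectI, rule exI[of _ "Some \<one>"]) simp
  then obtain x where x: "x \<in> K" "cone s (Some l) = cone (scale t x) (Some l)"
    unfolding eq scale_one[OF s(1)] by auto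
  have tx: "tuple (scale t x)" using t x by auto
  note E = cone_eqD[OF x(2) s(1) tx b(1) b(1) b(2) s(2)]
  then show ?thesis using x by auto
qed

text \<open>The sets of an H-functor determine its class of tuples; the action on morphisms comes
  for free. This matters because \<open>is_Gamma_P\<close> prescribes only the sets. The value at
  one object l in L is enough.\<close>

lemma is_H_proportional:
  assumes L: "L \<noteq> {}" and H: "is_H F t" and s: "tuple s"
    and S: "\<And>b. b \<in> with_zero L \<Longrightarrow> SObj F (ob b) = {cone (scale s x) b | x. x \<in> K}"
  shows "is_H F s"
proof -
  note D = is_HD[OF H]
  obtain l where l: "l \<in> L" using L by auto
  then have b: "Some l \<in> with_zero L" "Some l \<noteq> None" by auto
  have eq: "{cone (scale s x) (Some l) | x. x \<in> K} = {cone (scale t x) (Some l) | x. x \<in> K}"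
    using S[OF b(1)] D(3)[OF b(1)] by simp
  show ?thesis
  proof (cases "nonzero s")
    case True
    then obtain x where x: "x \<in> K" "x \<noteq> None" "\<forall>k\<in>L. s k = zmult G (t k) x"
      using cone_class_proportional[OF s _ D(2) l eq] by blast
    then have "is_H F (scale t x)" using H is_H_scale by blast
    then show ?thesis by (rule is_H_cong) (simp add: x)
  next
    case False
    have "\<not> nonzero t"
    proof
      assume "nonzero t"
      then obtain x where "\<forall>k\<in>L. t k = zmult G (s k) x"
        using cone_class_proportional[OF D(2) _ s l eq[symmetric]] by blast
      with False \<open>nonzero t\<close> show False by auto
    qed
    then show ?thesis using False by (intro is_H_cong[OF H]) auto
  qed
qed

end

context coordinatised
begin

section \<open>Natural transformations between H-functors\<close>

text \<open>The analogue of the condition in \<open>zarr\<close>: if one of the two H-functors is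
  zero, every scalar induces the same transformation, and 0 is declared to be its label.\<close>

definition admissible :: "('l \<Rightarrow> 'a option) \<Rightarrow> 'a option \<Rightarrow> ('l \<Rightarrow> 'a option) \<Rightarrow> bool" where
  "admissible t g s \<longleftrightarrow> g \<in> K \<and> (\<not> nonzero t \<or> \<not> nonzero s \<longrightarrow> g = None)"

text \<open>\<open>\<tau>\<close> is the transformation \<open>\<sigma>\<^sub>g : tG\<^sup>0 \<rightarrow> sG\<^sup>0\<close>.\<close>

definition acts ::
    "('o \<Rightarrow> ('o \<Rightarrow> 'm) \<Rightarrow> ('o \<Rightarrow> 'm)) \<Rightarrow> ('l \<Rightarrow> 'a option) \<Rightarrow> 'a option \<Rightarrow> ('l \<Rightarrow> 'a option) \<Rightarrow> bool" where
  "acts \<tau> t g s \<longleftrightarrow> (\<forall>b\<in>with_zero L. \<forall>x\<in>K. \<tau> (ob b) (cone (scale t x) b) =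
      cone (scale s (zmult G g x)) b)"

lemma actsD:
  "acts \<tau> t g s \<Longrightarrow> b \<in> with_zero L \<Longrightarrow> x \<in> K \<Longrightarrow>
   \<tau> (ob b) (cone (scale t x) b) = cone (scale s (zmult G g x)) b"
  by (simp add: acts_def)

lemma nat_transD:
  assumes "nat_trans C F \<tau> F'"
  shows "\<tau> \<in> extensional (Obj C)"
    "\<And>b. b \<in> with_zero L \<Longrightarrow> \<tau> (ob b) \<in> SObj F (ob b) \<rightarrow>\<^sub>E SObj F' (ob b)"
    "\<And>b h d z. (b, h, d) \<in> zarr G L \<Longrightarrow> z \<in> SObj F (ob b) \<Longrightarrow>
       \<tau> (ob d) (SMap F (ar b h d) z) = SMap F' (ar b h d) (\<tau> (ob b) z)"
proof -
  show "\<tau> \<in> extensional (Obj C)" using assms by (simp add: nat_trans_def)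
  show "\<tau> (ob b) \<in> SObj F (ob b) \<rightarrow>\<^sub>E SObj F' (ob b)" if "b \<in> with_zero L" for b
    using assms that by (simp add: nat_trans_def)
  show "\<tau> (ob d) (SMap F (ar b h d) z) = SMap F' (ar b h d) (\<tau> (ob b) z)"
    if "(b, h, d) \<in> zarr G L" "z \<in> SObj F (ob b)" for b h d z
    using assms that Dom_ar[OF that(1)] Cod_ar[OF that(1)] ar_in_Arr[OF that(1)]
    unfolding nat_trans_def by metis
qed

lemma acts_unique:
  assumes F: "is_H F t" and a: "acts \<tau> t g s" "acts \<tau>' t g s"
    and \<tau>: "\<tau> \<in> extensional (Obj C)" "\<And>b. b \<in> with_zero L \<Longrightarrow> \<tau> (ob b) \<in> extensional (SObj F (ob b))"
    and \<tau>': "\<tau>' \<in> extensional (Obj C)"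
        "\<And>b. b \<in> with_zero L \<Longrightarrow> \<tau>' (ob b) \<in> extensional (SObj F (ob b))"
  shows "\<tau> = \<tau>'"
proof (rule extensionalityI[OF \<tau>(1) \<tau>'(1)])
  fix y assume "y \<in> Obj C"
  then obtain b where b: "b \<in> with_zero L" "y = ob b" by (rule ObjE)
  show "\<tau> y = \<tau>' y"
    unfolding b(2)
  proof (rule extensionalityI[OF \<tau>(2)[OF b(1)] \<tau>'(2)[OF b(1)]])
    fix z assume "z \<in> SObj F (ob b)"
    then obtain x where "x \<in> K" "z = cone (scale t x) b" using is_HD(3)[OF F b(1)] by auto
    then show "\<tau> (ob b) z = \<tau>' (ob b) z" using actsD[OF a(1) b(1)] actsD[OF a(2) b(1)] by simp
  qed
qed

lemma nat_trans_extensional: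
  assumes "nat_trans C F \<tau> F'"
  shows "\<tau> \<in> extensional (Obj C)" "\<And>b. b \<in> with_zero L \<Longrightarrow> \<tau> (ob b) \<in> extensional (SObj F (ob b))"
  using nat_transD[OF assms] by (auto simp: PiE_def)

text \<open>The transformation multiplies scalars on the left, the H-functors act on them by right
  multiplication, and associativity makes the two commute.\<close>

lemma acts_nat_trans:
  assumes F: "is_H F t" and F': "is_H F' s" and g: "g \<in> K" and a: "acts \<tau> t g s"
    and ext: "\<tau> \<in> extensional (Obj C)"
        "\<And>b. b \<in> with_zero L \<Longrightarrow> \<tau> (ob b) \<in> extensional (SObj F (ob b))"
  shows "nat_trans C F \<tau> F'"
  unfolding nat_trans_def
proof (intro conjI ballI)
  note D = is_HD[OF F] and D' = is_HD[OF F']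
  show "\<tau> \<in> extensional (Obj C)" by fact
  fix y assume "y \<in> Obj C"
  then obtain b where b: "b \<in> with_zero L" "y = ob b" by (rule ObjE)
  show "\<tau> y \<in> SObj F y \<rightarrow>\<^sub>E SObj F' y"
    unfolding b(2)
  proof (rule PiE_I)
    fix z assume "z \<in> SObj F (ob b)"
    then obtain x where "x \<in> K" "z = cone (scale t x) b" using D(3)[OF b(1)] by auto
    then show "\<tau> (ob b) z \<in> SObj F' (ob b)"
      using actsD[OF a b(1)] D'(3)[OF b(1)] g by auto
  next
    fix z assume "z \<notin> SObj F (ob b)"
    then show "\<tau> (ob b) z = undefined" using ext(2)[OF b(1)] by (simp add: extensional_def)
  qed
next
  note D = is_HD[OF F] and D' = is_HD[OF F']
  fix f z assume "f \<in> Arr C" and z: "z \<in> SObj F (Dom C f)"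
  then obtain b h d where f: "(b, h, d) \<in> zarr G L" "f = ar b h d" by (auto elim: ArrE)
  then have b: "b \<in> with_zero L" "d \<in> with_zero L" "h \<in> K" by (auto simp: zarr_iff)
  obtain x where x: "x \<in> K" "z = cone (scale t x) b" using z f D(3)[OF b(1)] by (auto simp: Dom_ar)
  have "\<tau> (ob d) (SMap F (ar b h d) z) = cone (scale s (zmult G g (zmult G x h))) d"
    using x b f by (simp add: D(4) actsD[OF a])
  also have "\<dots> = SMap F' (ar b h d) (\<tau> (ob b) z)"
    using x b f g by (simp add: actsD[OF a] D'(4) zmult_assoc)
  finally show "\<tau> (Cod C f) (SMap F f z) = SMap F' f (\<tau> (Dom C f) z)"
    using f by (simp add: Dom_ar Cod_ar)
qed

lemma acts_exists:
  assumes F: "is_H F t" and F': "is_H F' s" and g: "admissible t g s"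
  shows "\<exists>\<tau>. nat_trans C F \<tau> F' \<and> acts \<tau> t g s"
proof -
  note D = is_HD[OF F] and D' = is_HD[OF F']
  have gK: "g \<in> K" using g by (simp add: admissible_def)
  define \<tau> where "\<tau> = (\<lambda>y\<in>Obj C. \<lambda>z\<in>SObj F y.
    let b = inv_into (with_zero L) ob y; x = (SOME x. x \<in> K \<and> z = cone (scale t x) b)
    in cone (scale s (zmult G g x)) b)"
  have "acts \<tau> t g s"
    unfolding acts_def
  proof (intro ballI)
    fix b x assume b: "b \<in> with_zero L" and x: "x \<in> K"
    define y where "y = (SOME y. y \<in> K \<and> cone (scale t x) b = cone (scale t y) b)"
    have "y \<in> K \<and> cone (scale t x) b = cone (scale t y) b"
      unfolding y_def by (rule someI[of _ x]) (simp add: x)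
    then have y: "y \<in> K" "cone (scale t x) b = cone (scale t y) b" by auto
    have "cone (scale t x) b \<in> SObj F (ob b)" using x D(3)[OF b] by auto
    then have "\<tau> (ob b) (cone (scale t x) b) = cone (scale s (zmult G g y)) b"
      using b inj_ob by (simp add: \<tau>_def y_def)
    also have "\<dots> = cone (scale s (zmult G g x)) b"
    \<comment> \<open>Independence of the chosen scalar: either the result is the zero cone for
      every scalar, or \<open>t\<close> is nonzero by admissibility and the scalar is determined by
      the cone.\<close>
    proof (cases "b = None \<or> g = None \<or> \<not> nonzero s")
      case True
      then have "b = None \<or> \<not> nonzero (scale s (zmult G g z))" for z by auto
      from cone_zero_eq[OF this[of y] this[of x]] show ?thesis .
    next
      case False
      then have "nonzero t" using g by (auto simp: admissible_def)
      then have "x = y" by (rule cone_scale_inj[OF D(2) _ x y(1) b _ y(2)]) (use False in simp)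
      then show ?thesis by simp
    qed
    finally show "\<tau> (ob b) (cone (scale t x) b) = cone (scale s (zmult G g x)) b" .
  qed
  moreover have "nat_trans C F \<tau> F'"
    by (rule acts_nat_trans[OF F F' gK calculation]) (simp_all add: \<tau>_def)
  ultimately show ?thesis by blast
qed

text \<open>Yoneda: a transformation is determined by the image of the idempotent cone.\<close>

lemma nat_trans_acts:
  assumes F: "is_H F t" and F': "is_H F' s" and n: "nat_trans C F \<tau> F'"
  shows "\<exists>g. admissible t g s \<and> acts \<tau> t g s"
proof -
  note D = is_HD[OF F] and D' = is_HD[OF F'] and N = nat_transD[OF n]
  \<comment> \<open>Any object with (t; c) reduced can serve as representing object: all cones (tx;
    b) with x the label of an arrow c -> b are images of the cone (t; c).\<close>
  obtain c where c: "c \<in> with_zero L" "nonzero t \<longleftrightarrow> c \<noteq> None"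
  proof (cases "nonzero t")
    case True
    then obtain l where "l \<in> L" by auto
    then show ?thesis using that[of "Some l"] True by simp
  qed (use that[of None] in auto)
  have unit: "cone (scale t (unit_label c)) c \<in> SObj F (ob c)" using D(3)[OF c(1)] by auto
  then have "\<tau> (ob c) (cone (scale t (unit_label c)) c) \<in> SObj F' (ob c)" using N(2)[OF c(1)]
      by auto
  then obtain g' where g': "g' \<in> K" "\<tau> (ob c) (cone (scale t (unit_label c)) c) =
      cone (scale s g') c"
    using D'(3)[OF c(1)] by auto
  \<comment> \<open>The image at \<open>c\<close> does not determine \<open>g'\<close> when it is
    forced to be the zero cone; then the admissible choice is 0.\<close>
  define g where "g = (if c = None \<or> \<not> nonzero s then None else g')"
  have "cone (scale s g') c = cone (scale s g) c"
  proof (cases "c = None \<or> \<not> nonzero s")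
    case True
    then have "c = None \<or> \<not> nonzero (scale s z)" for z by auto
    from cone_zero_eq[OF this[of g'] this[of g]] show ?thesis .
  qed (auto simp: g_def)
  with g' have g: "\<tau> (ob c) (cone (scale t (unit_label c)) c) = cone (scale s g) c" "g \<in> K"
    "c = None \<or> \<not> nonzero s \<longrightarrow> g = None"
    by (auto simp: g_def)
  have main: "\<tau> (ob b) (cone (scale t x) b) = cone (scale s (zmult G g x)) b"
    if x: "(c, x, b) \<in> zarr G L" for x b
  proof -
    have "\<tau> (ob b) (cone (scale t x) b) =
        \<tau> (ob b) (SMap F (ar c x b) (cone (scale t (unit_label c)) c))"
      using x by (simp add: D(4) unit_label_zmult)
    also have "\<dots> = SMap F' (ar c x b) (cone (scale s g) c)"
      using N(3)[OF x unit] g(1) by simp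
    also have "\<dots> = cone (scale s (zmult G g x)) b" using D'(4)[OF x g(2)] .
    finally show ?thesis .
  qed
  have "acts \<tau> t g s"
    unfolding acts_def
  proof (intro ballI)
    fix b x assume b: "b \<in> with_zero L" and x: "x \<in> K"
    show "\<tau> (ob b) (cone (scale t x) b) = cone (scale s (zmult G g x)) b"
    proof (cases "c = None \<or> b = None")
      case True
      have z: "b = None \<or> \<not> nonzero (scale t z)" "b = None \<or> \<not> nonzero (scale s (zmult G g z))"
          for z
        using True c g by auto
      have "cone (scale t x) b = cone (scale t None) b"
        "cone (scale s (zmult G g x)) b = cone (scale s (zmult G g None)) b"
        using cone_zero_eq[OF z(1)[of x] z(1)[of None]] cone_zero_eq[OF z(2)[of x] z(2)[of None]] .
      then show ?thesis using main[of None b] zero_in_zarr[OF c(1) b] by simp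
    next
      case False
      then have "(c, x, b) \<in> zarr G L" using x b c by (auto simp: zarr_iff)
      then show ?thesis by (rule main)
    qed
  qed
  moreover have "admissible t g s" using g c by (auto simp: admissible_def)
  ultimately show ?thesis by blast
qed

text \<open>Evaluating at the scalar 1 and a nonzero object gives (sg; l) = (sh; l), from which g =
  h by cancellation. If t or s is zero, admissibility forces both labels to be 0.\<close>

lemma acts_label_unique:
  assumes F': "is_H F' s" and adm: "admissible t g s" "admissible t h s"
      and a: "acts \<tau> t g s" "acts \<tau> t h s"
  shows "g = h"
proof (cases "nonzero t \<and> nonzero s")
  case False
  then show ?thesis using adm by (auto simp: admissible_def)
next
  case True
  then obtain l where l: "l \<in> L" by auto
  have K: "g \<in> K" "h \<in> K" using adm by (auto simp: admissible_def)
  have "cone (scale s g) (Some l) = cone (scale s h) (Some l)"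
    using actsD[OF a(1), of "Some l" "Some \<one>"] actsD[OF a(2), of "Some l" "Some \<one>"] l K by simp
  then show ?thesis using cone_scale_inj[of s g h "Some l"] is_HD(2)[OF F'] True K l by auto
qed

lemma acts_id:
  assumes "is_H F t" "g = Some \<one> \<or> \<not> nonzero t \<and> g = None"
  shows "acts (\<lambda>c\<in>Obj C. \<lambda>x\<in>SObj F c. x) t g t"
proof -
  have "cone (scale t (zmult G g x)) b = cone (scale t x) b" if "x \<in> K" for x b
    using assms(2) that by (intro cone_cong) auto
  then show ?thesis using is_HD(3)[OF assms(1)] by (auto simp: acts_def)
qed

text \<open>The later label ends up on the left. This reversal is what puts the dual over the
  opposite group.\<close>

lemma acts_compose:
  assumes "is_H F t" "acts \<tau> t g s" "acts \<tau>' s h r" "g \<in> K" "h \<in> K"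
  shows "acts (\<lambda>c\<in>Obj C. compose (SObj F c) (\<tau>' c) (\<tau> c)) t (zmult G h g) r"
  using is_HD(3)[OF assms(1)] assms(4,5)
  by (auto simp: acts_def compose_def actsD[OF assms(2)] actsD[OF assms(3)] zmult_assoc)

section \<open>Coordinates of the dual category\<close>

definition H_zero :: "('o, 'm) hfun" where "H_zero = H_fun C (cone (\<lambda>_. None) None)"

text \<open>The nonzero H-functors themselves serve as index set of the coordinates of the dual, in
  place of tuples, because proportional tuples define the same functor.\<close>

definition H_nonzero :: "('o, 'm) hfun set" where "H_nonzero = H_fun C ` idem_cones C - {H_zero}"

text \<open>A representative tuple is chosen for each H-functor; labels of transformations are
  measured relative to these choices.\<close>

definition H_tuple :: "('o, 'm) hfun option \<Rightarrow> 'l \<Rightarrow> 'a option" where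
  "H_tuple a = (case a of None \<Rightarrow> \<lambda>_. None | Some F \<Rightarrow> SOME t. is_H F t)"

definition dual_ob :: "('o, 'm) hfun option \<Rightarrow> ('o, 'm) hfun" where
  "dual_ob a = (case a of None \<Rightarrow> H_zero | Some F \<Rightarrow> F)"

definition dual_coord ::
    "(('o, 'm) hfun option, (('o, 'm) hfun, 'a) larr, ('o, 'm) hfun, ('o, 'm) htrans) fctr" where
  "dual_coord = \<lparr>FObj = dual_ob,
     FArr = (\<lambda>(a, g, b). (dual_ob a,
       SOME \<tau>. nat_trans C (dual_ob a) \<tau> (dual_ob b) \<and> acts \<tau> (H_tuple a) g (H_tuple b), dual_ob
           b))\<rparr>"

lemma is_H_zero: "is_H H_zero (\<lambda>_. None)"
  unfolding H_zero_def by (rule is_H_H_fun) (simp add: idem_tuple_def)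

lemma is_H_zero_iff:
  assumes "is_H F t"
  shows "F = H_zero \<longleftrightarrow> \<not> nonzero t"
proof
  assume F: "F = H_zero"
  show "\<not> nonzero t"
  proof
    assume nz: "nonzero t"
    then obtain l where l: "l \<in> L" by auto
    have "{cone (scale t x) (Some l) | x. x \<in> K} = {cone (scale (\<lambda>_. None) x) (Some l) | x. x \<in> K}"
      using is_HD(3)[OF assms, of "Some l"] is_HD(3)[OF is_H_zero, of "Some l"] l F by simp
    from cone_class_proportional[OF is_HD(2)[OF assms] nz _ l this] nz show False by auto
  qed
next
  assume "\<not> nonzero t"
  then have "is_H F (\<lambda>_. None)" using is_H_cong[OF assms] by auto
  then show "F = H_zero" using is_H_unique is_H_zero by blast
qed

lemma is_H_dual_ob: "a \<in> with_zero H_nonzero \<Longrightarrow> is_H (dual_ob a) (H_tuple a)"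
  using is_H_zero someI_ex[OF is_H_ex]
  by (auto simp: dual_ob_def H_tuple_def H_nonzero_def elim!: with_zero_cases)

lemma nonzero_H_tuple: "a \<in> with_zero H_nonzero \<Longrightarrow> nonzero (H_tuple a) \<longleftrightarrow> a \<noteq> None"
  using is_H_zero_iff[OF is_H_dual_ob[of a]]
  by (auto simp: H_nonzero_def dual_ob_def elim!: with_zero_cases)

lemma admissible_H_tuple:
  "a \<in> with_zero H_nonzero \<Longrightarrow> b \<in> with_zero H_nonzero \<Longrightarrow>
   admissible (H_tuple a) g (H_tuple b) \<longleftrightarrow> (a, g, b) \<in> zarr G H_nonzero"
  using nonzero_H_tuple[of a] nonzero_H_tuple[of b] unfolding admissible_def zarr_def by auto

lemma dual_obE:
  assumes "F \<in> H_fun C ` idem_cones C"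
  obtains a where "a \<in> with_zero H_nonzero" "F = dual_ob a"
  using assms that[of None] that[of "Some F"]
      by (cases "F = H_zero") (auto simp: dual_ob_def H_nonzero_def)

lemma dual_ar:
  assumes "(a, g, b) \<in> zarr G H_nonzero"
  obtains \<tau> where "FArr dual_coord (a, g, b) = (dual_ob a, \<tau>, dual_ob b)"
    "nat_trans C (dual_ob a) \<tau> (dual_ob b)" "acts \<tau> (H_tuple a) g (H_tuple b)"
proof -
  have ab: "a \<in> with_zero H_nonzero" "b \<in> with_zero H_nonzero" using assms by (auto simp: zarr_def)
  have "\<exists>\<tau>. nat_trans C (dual_ob a) \<tau> (dual_ob b) \<and> acts \<tau> (H_tuple a) g (H_tuple b)"
    by (rule acts_exists) (use ab assms is_H_dual_ob admissible_H_tuple in auto)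
  from someI_ex[OF this] that show thesis by (simp add: dual_coord_def)
qed

text \<open>Frees the coordinates from the choice in \<open>dual_coord\<close>: a transformation
  that is extensional and acts by the given label must be the chosen one. Identities and composites
  in the dual are recognised in this way.\<close>

lemma dual_ar_eqI:
  assumes "(a, g, b) \<in> zarr G H_nonzero" and a: "acts \<tau> (H_tuple a) g (H_tuple b)"
    and "\<tau> \<in> extensional (Obj C)"
        "\<And>c. c \<in> with_zero L \<Longrightarrow> \<tau> (ob c) \<in> extensional (SObj (dual_ob a) (ob c))"
  shows "FArr dual_coord (a, g, b) = (dual_ob a, \<tau>, dual_ob b)"
proof -
  obtain \<tau>' where \<tau>': "FArr dual_coord (a, g, b) = (dual_ob a, \<tau>', dual_ob b)"
    "nat_trans C (dual_ob a) \<tau>' (dual_ob b)" "acts \<tau>' (H_tuple a) g (H_tuple b)"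
    by (rule dual_ar[OF assms(1)])
  have "is_H (dual_ob a) (H_tuple a)" using assms(1) is_H_dual_ob by (auto simp: zarr_def)
  then have "\<tau>' = \<tau>"
    by (rule acts_unique[OF _ \<tau>'(3) a nat_trans_extensional[OF \<tau>'(2)] assms(3,4)])
  with \<tau>' show ?thesis by simp
qed

lemma dual_ar_surj:
  assumes "nat_trans C F \<tau> F'" "F \<in> H_fun C ` idem_cones C" "F' \<in> H_fun C ` idem_cones C"
  obtains a g b where "(a, g, b) \<in> zarr G H_nonzero" "F = dual_ob a" "F' = dual_ob b"
    "acts \<tau> (H_tuple a) g (H_tuple b)" "FArr dual_coord (a, g, b) = (F, \<tau>, F')"
proof -
  obtain a where a: "a \<in> with_zero H_nonzero" "F = dual_ob a" using assms(2) by (rule dual_obE)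
  obtain b where b: "b \<in> with_zero H_nonzero" "F' = dual_ob b" using assms(3) by (rule dual_obE)
  obtain g where g: "admissible (H_tuple a) g (H_tuple b)" "acts \<tau> (H_tuple a) g (H_tuple b)"
    using nat_trans_acts[OF is_H_dual_ob[OF a(1)] is_H_dual_ob[OF b(1)]] assms(1) a b by auto
  have z: "(a, g, b) \<in> zarr G H_nonzero" using g a b admissible_H_tuple by blast
  have "FArr dual_coord (a, g, b) = (F, \<tau>, F')"
    using dual_ar_eqI[OF z g(2)] nat_trans_extensional[OF assms(1)] a b by auto
  with that z a b g show thesis by blast
qed

lemma dual_Arr: "Arr (dual C) = FArr dual_coord ` zarr G H_nonzero"
proof
  show "Arr (dual C) \<subseteq> FArr dual_coord ` zarr G H_nonzero"
  proof
    fix f assume "f \<in> Arr (dual C)"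
    then obtain F \<tau> F' where f: "f = (F, \<tau>, F')" and
      F: "nat_trans C F \<tau> F'" "F \<in> H_fun C ` idem_cones C" "F' \<in> H_fun C ` idem_cones C"
      by (auto simp: dual_def)
    from dual_ar_surj[OF F] show "f \<in> FArr dual_coord ` zarr G H_nonzero" unfolding f
        by (metis (no_types, opaque_lifting) imageI)
  qed
  show "FArr dual_coord ` zarr G H_nonzero \<subseteq> Arr (dual C)"
  proof
    fix f assume "f \<in> FArr dual_coord ` zarr G H_nonzero"
    then obtain a g b where z: "(a, g, b) \<in> zarr G H_nonzero" "f = FArr dual_coord (a, g, b)"
        by auto
    then have "dual_ob a \<in> H_fun C ` idem_cones C" "dual_ob b \<in> H_fun C ` idem_cones C"
      using is_HD(1)[OF is_H_dual_ob] by (auto simp: zarr_def)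
    then show "f \<in> Arr (dual C)"
      unfolding z(2) by - (rule dual_ar[OF z(1)], simp add: dual_def)
  qed
qed

lemma dual_Id:
  assumes "a \<in> with_zero H_nonzero"
  shows "FArr dual_coord (zid G a) = Id (dual C) (dual_ob a)"
proof -
  note H = is_H_dual_ob[OF assms]
  have "acts (\<lambda>c\<in>Obj C. \<lambda>x\<in>SObj (dual_ob a) c. x) (H_tuple a) (if a =
      None then None else Some \<one>) (H_tuple a)"
    by (rule acts_id[OF H]) (simp add: H_tuple_def)
  then show ?thesis
    unfolding zid_def using assms by (subst dual_ar_eqI) (auto simp: zarr_def dual_def)
qed

lemma dual_Cmp:
  assumes g: "(a, g, b) \<in> zarr G H_nonzero" and h: "(b, h, c) \<in> zarr G H_nonzero"
  shows "FArr dual_coord (a, g, b) \<Zsemi>\<^bsub>dual C\<^esub> FArr dual_coord (b, h, c) =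
    FArr dual_coord (a, zmult G h g, c)"
proof -
  obtain \<tau> where \<tau>: "FArr dual_coord (a, g, b) = (dual_ob a, \<tau>, dual_ob b)"
    "nat_trans C (dual_ob a) \<tau> (dual_ob b)" "acts \<tau> (H_tuple a) g (H_tuple b)"
        by (rule dual_ar[OF g])
  obtain \<tau>' where \<tau>': "FArr dual_coord (b, h, c) = (dual_ob b, \<tau>', dual_ob c)"
    "nat_trans C (dual_ob b) \<tau>' (dual_ob c)" "acts \<tau>' (H_tuple b) h (H_tuple c)"
        by (rule dual_ar[OF h])
  have K: "g \<in> K" "h \<in> K" and abc: "a \<in> with_zero H_nonzero" using g h by (auto simp: zarr_def)
  have z: "(a, zmult G h g, c) \<in> zarr G H_nonzero" using g h by (auto simp: zarr_def)
  have "acts (\<lambda>x\<in>Obj C. compose (SObj (dual_ob a) x) (\<tau>' x) (\<tau> x)) (H_tuple a) (zmult G h g)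
      (H_tuple c)"
    by (rule acts_compose[OF is_H_dual_ob[OF abc] \<tau>(3) \<tau>'(3) K])
  then show ?thesis
    using \<tau>(1) \<tau>'(1) by (subst dual_ar_eqI[OF z]) (auto simp: dual_def compose_def)
qed

lemma dual_Inc:
  "Inc (dual C) = FArr dual_coord ` (zid G ` with_zero H_nonzero \<union> {(None, None,
      Some F) | F. F \<in> H_nonzero})"
    (is "_ = FArr dual_coord ` ?Z")
proof
  show "Inc (dual C) \<subseteq> FArr dual_coord ` ?Z"
  proof
    fix f assume "f \<in> Inc (dual C)"
    then obtain F \<tau> F' where f: "f = (F, \<tau>, F')" and
      n: "nat_trans C F \<tau> F'" "F \<in> H_fun C ` idem_cones C" "F' \<in> H_fun C ` idem_cones C" and
      i: "\<And>c x. c \<in> Obj C \<Longrightarrow> x \<in> SObj F c \<Longrightarrow> \<tau> c x = x"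
      by (auto simp: dual_def)
    obtain a g b where g: "(a, g, b) \<in> zarr G H_nonzero" "F = dual_ob a" "F' = dual_ob b"
      "acts \<tau> (H_tuple a) g (H_tuple b)" "FArr dual_coord (a, g, b) = (F, \<tau>, F')"
      by (rule dual_ar_surj[OF n])
    have ab: "a \<in> with_zero H_nonzero" "b \<in> with_zero H_nonzero" "g \<in> K" using g
        by (auto simp: zarr_def)
    note H = is_H_dual_ob[OF ab(1)] is_H_dual_ob[OF ab(2)]
    have "(a, g, b) \<in> ?Z"
    proof (cases a)
      case None
      then show ?thesis using g(1) by (cases b) (auto simp: zarr_def zid_def image_iff)
    next
      case (Some A)
      then have nz: "nonzero (H_tuple a)" using nonzero_H_tuple ab by auto
      then obtain l where l: "l \<in> L" by auto
      then have ls: "Some l \<in> with_zero L" "Some l \<noteq> None" by auto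
      \<comment> \<open>An inclusion fixes the cone (t; l) but also sends it to (sg; l), so t = sg.
        Hence the two functors coincide, and cancellation yields g = 1.\<close>
      have "cone (scale (H_tuple a) (Some \<one>)) (Some l) \<in> SObj F (ob (Some l))"
        using is_HD(3)[OF H(1) ls(1)] g(2) by auto
      then have "\<tau> (ob (Some l)) (cone (scale (H_tuple a) (Some \<one>)) (Some l)) =
          cone (scale (H_tuple a) (Some \<one>)) (Some l)"
        using i ls by auto
      then have eq: "cone (H_tuple a) (Some l) = cone (scale (H_tuple b) g) (Some l)"
        using actsD[OF g(4) ls(1), of "Some \<one>"] ab(3) by (simp add: scale_one[OF is_HD(2)[OF H(1)]])
      have "tuple (scale (H_tuple b) g)" using is_HD(2)[OF H(2)] ab(3) by auto
      note E = cone_eqD[OF eq is_HD(2)[OF H(1)] this ls(1) ls(1) ls(2) nz]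
      then have "g \<noteq> None" by auto
      have "is_H (dual_ob a) (scale (H_tuple b) g)" by (rule is_H_cong[OF H(1)]) (rule E(3))
      moreover have "is_H (dual_ob b) (scale (H_tuple b) g)"
          by (rule is_H_scale[OF H(2) ab(3) \<open>g \<noteq> None\<close>])
      ultimately have "dual_ob a = dual_ob b" by (rule is_H_unique)
      moreover have "b \<noteq> None" using g(1) \<open>g \<noteq> None\<close> by (auto simp: zarr_def)
      ultimately have "a = b" using Some by (auto simp: dual_ob_def)
      then have "cone (scale (H_tuple a) (Some \<one>)) (Some l) = cone (scale (H_tuple a) g) (Some l)"
        using eq scale_one[OF is_HD(2)[OF H(1)]] by metis
      then have "g = Some \<one>"
        using cone_scale_inj[OF is_HD(2)[OF H(1)] nz, of "Some \<one>" g "Some l"] ab(3) l by auto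
      then show ?thesis using \<open>a = b\<close> Some ab(1) by (auto simp: zid_def image_iff)
    qed
    from imageI[OF this, of "FArr dual_coord"] show "f \<in> FArr dual_coord ` ?Z" unfolding f g(5) .
  qed
  show "FArr dual_coord ` ?Z \<subseteq> Inc (dual C)"
  proof
    fix f assume "f \<in> FArr dual_coord ` ?Z"
    then consider a where "a \<in> with_zero H_nonzero" "f = FArr dual_coord (zid G a)"
      | F where "F \<in> H_nonzero" "f = FArr dual_coord (None, None, Some F)" by auto
    then show "f \<in> Inc (dual C)"
    proof cases
      case 1
      have "zid G a \<in> zarr G H_nonzero" using 1 by (auto simp: zid_def zarr_def)
      then have "f \<in> Arr (dual C)" using 1 dual_Arr by auto
      then show ?thesis unfolding 1(2) dual_Id[OF 1(1)] by (auto simp: dual_def)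
    next
      case 2
      then have z: "(None, None, Some F) \<in> zarr G H_nonzero" by (simp add: zarr_def)
      have F: "is_H F (H_tuple (Some F))" using is_H_dual_ob[of "Some F"] 2
          by (simp add: dual_ob_def)
      obtain \<tau> where \<tau>: "f = (H_zero, \<tau>, F)" "nat_trans C H_zero \<tau> F"
          "acts \<tau> (\<lambda>_. None) None (H_tuple (Some F))"
        using dual_ar[OF z] 2(2) by (auto simp: dual_ob_def H_tuple_def)
      \<comment> \<open>The zero functor has the zero cone as its only value. Writing this cone as a
        zero multiple of the tuple of \<open>F\<close> shows that it belongs to \<open>F\<close> as
        well.\<close>
      have 0: "cone (scale (\<lambda>_. None) x) b = cone (scale (H_tuple (Some F)) None) b" for x b
        using cone_zero[of b] by (intro cone_cong) simp
      have "SObj H_zero c \<subseteq> SObj F c \<and> (\<forall>x\<in>SObj H_zero c. \<tau> c x = x)" if "c \<in> Obj C" for c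
      proof -
        from that obtain b where b: "b \<in> with_zero L" "c = ob b" by (rule ObjE)
        have 1: "SObj H_zero c = {cone (scale (H_tuple (Some F)) None) b}"
          using is_HD(3)[OF is_H_zero b(1)] b(2) None_with_zero[of "carrier G"] unfolding 0 by blast
        have "\<tau> c (cone (scale (H_tuple (Some F)) None) b) = cone (scale (H_tuple (Some F)) None) b"
          using actsD[OF \<tau>(3) b(1), of None] b(2) by simp
        moreover have "cone (scale (H_tuple (Some F)) None) b \<in> SObj F c"
          using is_HD(3)[OF F b(1)] b(2) by (auto intro!: exI[of _ None])
        ultimately show ?thesis unfolding 1 by auto
      qed
      then show ?thesis using \<tau>(1,2) is_HD(1)[OF F] is_HD(1)[OF is_H_zero] by (auto simp: dual_def)
    qed
  qed
qed

lemma coordinatised_dual: "coordinatised (opp G) H_nonzero (dual C) dual_coord"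
proof (intro coordinatised.intro coordinatised_axioms.intro)
  have FObj: "FObj dual_coord = dual_ob" by (simp add: dual_coord_def)
  show "group (opp G)" by (rule group_opp)
  show "inj_on (FObj dual_coord) (with_zero H_nonzero)"
    by (auto simp: FObj inj_on_def dual_ob_def H_nonzero_def elim!: with_zero_cases)
  show "Obj (dual C) = FObj dual_coord ` with_zero H_nonzero"
  proof
    show "FObj dual_coord ` with_zero H_nonzero \<subseteq> Obj (dual C)"
      using is_HD(1)[OF is_H_dual_ob] by (auto simp: FObj dual_def)
    show "Obj (dual C) \<subseteq> FObj dual_coord ` with_zero H_nonzero"
    proof
      fix F assume "F \<in> Obj (dual C)"
      then have "F \<in> H_fun C ` idem_cones C" by (simp add: dual_def)
      then show "F \<in> FObj dual_coord ` with_zero H_nonzero" unfolding FObj by (rule dual_obE) blast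
    qed
  qed
  show "Arr (dual C) = FArr dual_coord ` zarr (opp G) H_nonzero" by (simp add: dual_Arr)
  show "inj_on (FArr dual_coord) (zarr (opp G) H_nonzero)"
  proof (rule inj_onI, clarsimp)
    fix a g b a' g' b'
    assume z: "(a, g, b) \<in> zarr G H_nonzero" "(a', g', b') \<in> zarr G H_nonzero"
      and eq: "FArr dual_coord (a, g, b) = FArr dual_coord (a', g', b')"
    have o: "a \<in> with_zero H_nonzero" "b \<in> with_zero H_nonzero" "a' \<in> with_zero H_nonzero"
        "b' \<in> with_zero H_nonzero"
      using z by (auto simp: zarr_def)
    obtain \<tau> where \<tau>: "FArr dual_coord (a, g, b) = (dual_ob a, \<tau>, dual_ob b)"
      "nat_trans C (dual_ob a) \<tau> (dual_ob b)" "acts \<tau> (H_tuple a) g (H_tuple b)"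
          by (rule dual_ar[OF z(1)])
    obtain \<tau>' where \<tau>': "FArr dual_coord (a', g', b') = (dual_ob a', \<tau>', dual_ob b')"
      "nat_trans C (dual_ob a') \<tau>' (dual_ob b')" "acts \<tau>' (H_tuple a') g' (H_tuple b')"
          by (rule dual_ar[OF z(2)])
    have e: "dual_ob a = dual_ob a'" "dual_ob b = dual_ob b'" "\<tau> = \<tau>'" using eq \<tau> \<tau>' by auto
    then have ab: "a' = a" "b' = b"
      using o by (auto simp: dual_ob_def H_nonzero_def elim!: with_zero_cases)
    moreover have "g = g'"
      using acts_label_unique[OF is_H_dual_ob[OF o(2)], of
          "H_tuple a" g g' \<tau>] \<tau>(3) \<tau>'(3) z o admissible_H_tuple
      unfolding ab e by blast
    ultimately show "a = a' \<and> g = g' \<and> b = b'" by simp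
  qed
  fix a g b assume z: "(a, g, b) \<in> zarr (opp G) H_nonzero"
  then show "Dom (dual C) (FArr dual_coord (a, g, b)) = FObj dual_coord a"
    "Cod (dual C) (FArr dual_coord (a, g, b)) = FObj dual_coord b"
    by (simp_all add: dual_def dual_coord_def)
  fix h c assume "(b, h, c) \<in> zarr (opp G) H_nonzero"
  with z show "FArr dual_coord (a, g, b) \<Zsemi>\<^bsub>dual C\<^esub> FArr dual_coord (b, h, c) =
      FArr dual_coord (a, zmult (opp G) g h, c)"
    by (simp add: dual_Cmp zmult_opp)
next
  fix a assume "a \<in> with_zero H_nonzero"
  then show "Id (dual C) (FObj dual_coord a) = FArr dual_coord (zid (opp G) a)"
    by (simp add: dual_Id) (simp add: dual_coord_def)
next
  show "Inc (dual C) = FArr dual_coord ` (zid (opp G) ` with_zero H_nonzero \<union> {(None, None,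
      Some l) | l. l \<in> H_nonzero})"
    by (simp add: dual_Inc)
qed

section \<open>M-sets and the idempotent cones attached to an H-functor\<close>

lemma is_H_supports:
  assumes "is_H F t" "is_H F s" "l \<in> L"
  shows "t l = None \<longleftrightarrow> s l = None"
proof -
  have *: "s l \<noteq> None" if "is_H F t" "is_H F s" "t l \<noteq> None" for t s
  proof -
    have "\<exists>x\<in>K. x \<noteq> None \<and> (\<forall>k\<in>L. t k = zmult G (s k) x)"
      by (rule cone_class_proportional[OF _ _ _ assms(3)])
        (use that assms(3) is_HD(2) is_HD(3)[OF that(1), of "Some l"] is_HD(3)[OF that(2), of
            "Some l"] in auto)
    then show ?thesis using that(3) assms(3) zmult_eq_None by metis
  qed
  show ?thesis using *[of t s] *[of s t] assms by blast
qed

lemma cone_iso_iff: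
  assumes "tuple s" "d \<in> with_zero L" "nonzero s \<longleftrightarrow> d \<noteq> None" "c \<in> with_zero L"
  shows "is_iso C (cone s d (ob c)) \<longleftrightarrow> (if nonzero s then label s c \<noteq> None else c = None)"
  using assms cone_at_reduced[OF assms] by (auto simp: is_iso_iff split: option.splits)

text \<open>Dividing by the entry at c normalises the tuple to have 1 there. The condition on c is
  exactly that this entry is invertible, or that everything is zero.\<close>

lemma idem_tuple_scale:
  assumes t: "tuple t" and c: "c \<in> with_zero L" "if nonzero t then label t c \<noteq> None else c = None"
  shows "idem_tuple (scale t (zinv G (label t c))) c"
proof (cases c)
  case None
  then show ?thesis using c by (simp add: idem_tuple_def)
next
  case (Some l)
  then have "l \<in> L" "t l \<noteq> None" "t l \<in> K" using c t by (auto split: if_splits)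
  then show ?thesis using Some t by (auto simp: idem_tuple_def zinv_zmult)
qed

lemma H_fun_scale:
  assumes F: "is_H F t" and c: "c \<in> with_zero L" "if nonzero t then label t c \<noteq> None else c = None"
  shows "H_fun C (cone (scale t (zinv G (label t c))) c) = F"
proof -
  have "is_H F (scale t (zinv G (label t c)))"
  proof (cases "nonzero t")
    case True
    then have "label t c \<in> K" "label t c \<noteq> None" using c is_HD(2)[OF F]
        by (auto split: option.splits)
    then show ?thesis by (intro is_H_scale[OF F]) auto
  next
    case False
    then show ?thesis by (intro is_H_cong[OF F]) auto
  qed
  then show ?thesis using is_H_unique is_H_H_fun[OF idem_tuple_scale[OF is_HD(2)[OF F] c]] by blast
qed

text \<open>\<open>MH\<close> allows any idempotent cone representing F, but proportional tuples
  have the same nonzero positions, so the choice does not affect which components are isomorphisms.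
  Conversely, the tuple normalised at c supplies a cone with an identity there.\<close>

lemma MH_iff:
  assumes F: "is_H F t" and c: "c \<in> with_zero L"
  shows "ob c \<in> MH C F \<longleftrightarrow> (if nonzero t then label t c \<noteq> None else c = None)"
proof
  assume "ob c \<in> MH C F"
  then obtain s d where s: "idem_tuple s d" "F = H_fun C (cone s d)" "is_iso C (cone s d (ob c))"
    by (auto simp: MH_def idem_cones_iff)
  note D = idem_tupleD[OF s(1)]
  have Fs: "is_H F s" using is_H_H_fun[OF s(1)] s(2) by simp
  have "t l = None \<longleftrightarrow> s l = None" if "l \<in> L" for l using is_H_supports[OF F Fs that] .
  then have "nonzero t \<longleftrightarrow> nonzero s" "label t c = None \<longleftrightarrow> label s c = None"
    using c by (auto elim!: with_zero_cases)
  then show "if nonzero t then label t c \<noteq> None else c = None"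
    using s(3) cone_iso_iff[OF D(1-3) c] by (auto split: if_splits)
next
  assume *: "if nonzero t then label t c \<noteq> None else c = None"
  note i = idem_tuple_scale[OF is_HD(2)[OF F] c *]
  note D = idem_tupleD[OF i]
  have "is_iso C (cone (scale t (zinv G (label t c))) c (ob c))"
    using cone_iso_iff[OF D(1-3) c] D(3,4) by auto
  then show "ob c \<in> MH C F"
    unfolding MH_def using i H_fun_scale[OF F c *] idem_cones_iff ob_in_Obj[OF c] by blast
qed

lemma conn_cone_eq:
  assumes F: "is_H (FObj \<Gamma> d) t" and c: "c \<in> with_zero L" and MH: "ob c \<in> MH C (FObj \<Gamma> d)"
  shows "conn_cone C \<Gamma> (ob c) d = cone (scale t (zinv G (label t c))) c"
  unfolding conn_cone_def
proof (rule the_equality)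
  have *: "if nonzero t then label t c \<noteq> None else c = None" using MH MH_iff[OF F c] by blast
  note i = idem_tuple_scale[OF is_HD(2)[OF F] c *]
  show "cone (scale t (zinv G (label t c))) c \<in> idem_cones C \<and>
      apex C (cone (scale t (zinv G (label t c))) c) = ob c \<and>
      H_fun C (cone (scale t (zinv G (label t c))) c) = FObj \<Gamma> d"
    using i idem_cones_iff idem_tupleD(5)[OF i] H_fun_scale[OF F c *] by blast
  fix \<mu> assume \<mu>: "\<mu> \<in> idem_cones C \<and> apex C \<mu> = ob c \<and> H_fun C \<mu> = FObj \<Gamma> d"
  then obtain s c' where s': "idem_tuple s c'" "\<mu> = cone s c'" unfolding idem_cones_iff by blast
  then have "c' = c" using \<mu> idem_tupleD(2,5)[OF s'(1)] c by auto
  with s' have s: "idem_tuple s c" "\<mu> = cone s c" by auto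
  note D = idem_tupleD[OF s(1)]
  have Fs: "is_H (FObj \<Gamma> d) s" using is_H_H_fun[OF s(1)] s(2) \<mu> by simp
  show "\<mu> = cone (scale t (zinv G (label t c))) c"
  proof (cases c)
    case None
    then show ?thesis using s cone_zero[of c s] cone_zero[of c "scale t (zinv G (label t c))"]
        by simp
  next
    case (Some l)
    then have l: "l \<in> L" using c by simp
    have nz: "nonzero s" using D(3) Some by simp
    \<comment> \<open>Two idempotent cones of the same functor have proportional tuples s = tx;
      since s has entry 1 at the apex l, the factor x is the inverse of t l.\<close>
    have "\<exists>x\<in>K. x \<noteq> None \<and> (\<forall>k\<in>L. s k = zmult G (t k) x)"
      by (rule cone_class_proportional[OF D(1) nz is_HD(2)[OF F] l])
        (use l is_HD(3)[OF F, of "Some l"] is_HD(3)[OF Fs, of "Some l"] in auto)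
    then obtain x where x: "x \<in> K" "\<And>k. k \<in> L \<Longrightarrow> s k = zmult G (t k) x" by blast
    have tl: "t l \<in> K" using is_HD(2)[OF F] l by blast
    have "zmult G (t l) x = Some \<one>" using x(2)[OF l] D(4) Some by simp
    moreover from this have "t l \<noteq> None" by (metis zmult_None(1) option.distinct(1))
    ultimately have "zmult G (zinv G (t l)) (zmult G (t l) x) = zinv G (t l)" "t l \<noteq> None" using tl
        by auto
    then have "x = zinv G (t l)" using tl x(1)
        by (simp flip: zmult_assoc add: zinv_zmult split: if_splits)
    then show ?thesis unfolding s(2) using x(2) Some by (intro cone_cong) simp
  qed
qed

end

section \<open>Local isomorphisms\<close>

lemma is_category_full_sub:
  assumes "is_category C"
  shows "is_category (full_sub C A)"
proof -
  have "mor (full_sub C A) a b = (if a \<in> A \<and> b \<in> A then mor C a b else {})" for a b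
    by (auto simp: mor_def full_sub_def)
  then show ?thesis using assms unfolding is_category_def by (simp add: full_sub_def)
qed

text \<open>For a fully faithful functor, bijectivity on objects is all that is left to check:
  injectivity on objects separates the hom-sets, and within each hom-set the functor is
  bijective.\<close>

lemma is_cat_iso_full_sub:
  assumes F: "is_functor C D F"
    and ff: "\<And>a b. a \<in> Obj C \<Longrightarrow> b \<in> Obj C \<Longrightarrow>
        bij_betw (FArr F) (mor C a b) (mor D (FObj F a) (FObj F b))"
    and bij: "bij_betw (FObj F) (Obj (full_sub C A)) (Obj (full_sub D B))"
  shows "is_cat_iso (full_sub C A) (full_sub D B)
    \<lparr>FObj = restrict (FObj F) (Obj (full_sub C A)), FArr = restrict (FArr F) (Arr (full_sub C A))\<rparr>"
proof -
  have C: "is_category C" and D: "is_category D" using F by (auto simp: is_functor_def)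
  have FO: "FObj F a \<in> Obj D" if "a \<in> Obj C" for a using F that by (auto simp: is_functor_def)
  have FA: "FArr F f \<in> Arr D" "Dom D (FArr F f) = FObj F (Dom C f)"
      "Cod D (FArr F f) = FObj F (Cod C f)"
    if "f \<in> Arr C" for f using F that by (auto simp: is_functor_def)
  have inB: "FObj F a \<in> B" if "a \<in> Obj C" "a \<in> A" for a
    using bij that by (auto simp: bij_betw_def full_sub_def)
  have inj: "a = b" if "a \<in> Obj C" "a \<in> A" "b \<in> Obj C" "b \<in> A" "FObj F a = FObj F b" for a b
    using bij that by (auto simp: bij_betw_def full_sub_def inj_on_def)
  have surj: "\<exists>a\<in>Obj C. a \<in> A \<and> FObj F a = d" if "d \<in> Obj D" "d \<in> B" for d
  proof -
    have "d \<in> FObj F ` Obj (full_sub C A)" using bij that by (simp add: bij_betw_def full_sub_def)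
    then show ?thesis by (auto simp: full_sub_def)
  qed
  have dc: "Dom C f \<in> Obj C" "Cod C f \<in> Obj C" if "f \<in> Arr C" for f using C that
      by (auto simp: is_category_def)
  have dc': "Dom D f \<in> Obj D" "Cod D f \<in> Obj D" if "f \<in> Arr D" for f using D that
      by (auto simp: is_category_def)
  have "bij_betw (FArr F) (Arr (full_sub C A)) (Arr (full_sub D B))"
    unfolding bij_betw_def
  proof
    show "inj_on (FArr F) (Arr (full_sub C A))"
    proof (rule inj_onI)
      fix f g assume fg: "f \<in> Arr (full_sub C A)" "g \<in> Arr (full_sub C A)" "FArr F f = FArr F g"
      then have m: "f \<in> Arr C" "g \<in> Arr C" "Dom C f \<in> A" "Cod C f \<in> A" "Dom C g \<in> A" "Cod C g \<in> A"
        by (auto simp: full_sub_def)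
      then have "Dom C f = Dom C g" "Cod C f = Cod C g"
        using inj[OF dc(1)[OF m(1)] m(3) dc(1)[OF m(2)] m(5)] inj[OF dc(2)[OF m(1)] m(4) dc(2)[OF
            m(2)] m(6)]
          FA[OF m(1)] FA[OF m(2)] fg(3) by auto
      then have "f \<in> mor C (Dom C f) (Cod C f)" "g \<in> mor C (Dom C f) (Cod C f)" using m
          by (auto simp: mor_def)
      then show "f = g" using bij_betw_imp_inj_on[OF ff[OF dc[OF m(1)]]] fg(3)
          by (auto dest: inj_onD)
    qed
    show "FArr F ` Arr (full_sub C A) = Arr (full_sub D B)"
    proof
      show "FArr F ` Arr (full_sub C A) \<subseteq> Arr (full_sub D B)"
        using FA inB dc by (auto simp: full_sub_def)
      show "Arr (full_sub D B) \<subseteq> FArr F ` Arr (full_sub C A)"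
      proof
        fix h assume "h \<in> Arr (full_sub D B)"
        then have h: "h \<in> Arr D" "Dom D h \<in> B" "Cod D h \<in> B" by (auto simp: full_sub_def)
        obtain a where a: "a \<in> Obj C" "a \<in> A" "FObj F a = Dom D h"
            using surj[OF dc'(1)[OF h(1)] h(2)] by blast
        obtain b where b: "b \<in> Obj C" "b \<in> A" "FObj F b = Cod D h"
            using surj[OF dc'(2)[OF h(1)] h(3)] by blast
        have "h \<in> mor D (FObj F a) (FObj F b)" using a b h by (simp add: mor_def)
        then have "h \<in> FArr F ` mor C a b" using ff[OF a(1) b(1)] by (simp add: bij_betw_def)
        then show "h \<in> FArr F ` Arr (full_sub C A)" using a b by (auto simp: mor_def full_sub_def)
      qed
    qed
  qed
  moreover have "is_functor (full_sub C A) (full_sub D B)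
     \<lparr>FObj = restrict (FObj F) (Obj (full_sub C A)), FArr = restrict (FArr F) (Arr (full_sub C A))\<rparr>"
  proof -
    have cmp: "f \<Zsemi>\<^bsub>C\<^esub> g \<in> Arr C" "Dom C (f \<Zsemi>\<^bsub>C\<^esub> g) = Dom C f" "Cod C (f \<Zsemi>\<^bsub>C\<^esub> g) = Cod C g"
      if "f \<in> Arr C" "g \<in> Arr C" "Cod C f = Dom C g" for f g
      using C that by (auto simp: is_category_def mor_def)
    have id: "Id C a \<in> Arr C" "Dom C (Id C a) = a" "Cod C (Id C a) = a" if "a \<in> Obj C" for a
      using C that by (auto simp: is_category_def mor_def)
    show ?thesis
      unfolding is_functor_def
      using F is_category_full_sub[OF C, of A] is_category_full_sub[OF D, of B] FO FA inB dc
      by (auto simp: full_sub_def cmp id is_functor_def)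
  qed
  moreover have "bij_betw (restrict (FObj F) (Obj (full_sub C A))) (Obj (full_sub C A)) (Obj
      (full_sub D B))"
    using bij by (simp cong: bij_betw_cong)
  ultimately show ?thesis
    by (simp add: is_cat_iso_def cong: bij_betw_cong)
qed

text \<open>Below an object \<open>c\<close> of a coordinatised category lie only \<open>0\<close> and \<open>c\<close>, so a fully faithful
  functor respecting \<open>0\<close> is a local isomorphism.\<close>

lemma local_isoI:
  assumes "coordinatised G L C \<Phi>" and "coordinatised G' L' D \<Psi>" and F: "is_functor C D F"
    and ff: "\<And>a b. a \<in> Obj C \<Longrightarrow> b \<in> Obj C \<Longrightarrow>
        bij_betw (FArr F) (mor C a b) (mor D (FObj F a) (FObj F b))"
    and zero: "FObj F (FObj \<Phi> None) = FObj \<Psi> None"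
    and nonzero: "\<And>l. l \<in> L \<Longrightarrow> \<exists>k\<in>L'. FObj F (FObj \<Phi> (Some l)) = FObj \<Psi> (Some k)"
  shows "local_iso C D F"
proof -
  interpret C: coordinatised G L C \<Phi> by fact
  interpret D: coordinatised G' L' D \<Psi> by fact
  have FA: "FArr F f \<in> Arr D" "Dom D (FArr F f) = FObj F (Dom C f)"
      "Cod D (FArr F f) = FObj F (Cod C f)"
    if "f \<in> Arr C" for f using F that by (auto simp: is_functor_def)
  have obF: "\<exists>b\<in>with_zero L'. FObj F (C.ob a) = D.ob b \<and> (b = None \<longleftrightarrow> a = None)" if "a \<in> with_zero L"
      for a
    using that zero nonzero by (cases a) force+
  have down_C: "Obj C \<inter> {d \<in> Obj C. subobj C d (C.ob c)} = {C.ob None, C.ob c}" if "c \<in> with_zero L"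
      for c
    using that by (auto simp: C.subobj_iff elim!: C.ObjE)
  have down_D: "Obj D \<inter> {d \<in> Obj D. subobj D d (D.ob c)} = {D.ob None, D.ob c}"
      if "c \<in> with_zero L'" for c
    using that by (auto simp: D.subobj_iff elim!: D.ObjE)
  show ?thesis
    unfolding local_iso_def
  proof (intro conjI ballI)
    show "unambiguous C" by (rule C.unambiguous)
    show "unambiguous D" by (rule D.unambiguous)
    show "is_functor C D F" by (rule F)
    show "bij_betw (FArr F) (mor C a b) (mor D (FObj F a) (FObj F b))" if "a \<in> Obj C" "b \<in> Obj C"
        for a b
      using ff that .
    fix f assume f: "f \<in> Inc C"
    then obtain a g b where z: "(a, g, b) \<in> zarr G L" "f = C.ar a g b"
      "(a = b \<and> g = C.unit_label a) \<or> a = None" by (rule C.IncE)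
    have fA: "f \<in> Arr C" using f C.Inc_subset_Arr by blast
    have ab: "a \<in> with_zero L" "b \<in> with_zero L" using z by (auto simp: C.zarr_iff)
    show "FArr F f \<in> Inc D"
    \<comment> \<open>Every arrow out of 0 is an inclusion, so it suffices that 0 goes to 0; the
      remaining inclusions are identities.\<close>
    proof (cases "a = None")
      case True
      have "FArr F f \<in> mor D (D.ob None) (FObj F (C.ob b))"
        using FA[OF fA] z True zero by (simp add: mor_def C.Dom_ar C.Cod_ar)
      moreover obtain b' where "b' \<in> with_zero L'" "FObj F (C.ob b) = D.ob b'" using obF[OF ab(2)]
          by blast
      ultimately show ?thesis by (auto simp: D.mor_eq D.ar_in_Inc)
    next
      case False
      then have "f = Id C (C.ob a)" using z ab by (auto simp: C.Id_ob C.zid_eq)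
      then have "FArr F f = Id D (FObj F (C.ob a))" using F ab by (simp add: is_functor_def)
      moreover have "FObj F (C.ob a) \<in> Obj D" using obF[OF ab(1)] by auto
      ultimately show ?thesis using D.cat_with_subobjects by (simp add: cat_with_subobjects_def)
    qed
  next
    fix x assume "x \<in> Obj C"
    then obtain c where c: "c \<in> with_zero L" "x = C.ob c" by (rule C.ObjE)
    obtain d where d: "d \<in> with_zero L'" "FObj F (C.ob c) = D.ob d" "d = None \<longleftrightarrow> c = None"
      using obF[OF c(1)] by blast
    \<comment> \<open>These are two-element sets, or singletons if c = 0; that the image is 0 only
      when c is 0 makes the sizes agree.\<close>
    have "bij_betw (FObj F) {C.ob None, C.ob c} {D.ob None, D.ob d}"
      using c d zero by (auto simp: bij_betw_def inj_on_def)
    then show "is_cat_iso (down C x) (down D (FObj F x))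
        \<lparr>FObj = restrict (FObj F) (Obj (down C x)), FArr = restrict (FArr F) (Arr (down C x))\<rparr>"
      unfolding down_def c(2) d(2)
      by (intro is_cat_iso_full_sub[OF F ff]) (use down_C[OF c(1)] down_D[OF d(1)] in \<open>simp_all add:
          full_sub_def\<close>)
  qed
qed

section \<open>The functor of a sandwich matrix\<close>

lemma m_inv_opp: "inv\<^bsub>opp G\<^esub> x = inv\<^bsub>G\<^esub> x"
  by (simp add: m_inv_def conj_commute)

lemma zinv_opp [simp]: "zinv (opp G) = zinv G"
  by (auto simp: zinv_def m_inv_opp fun_eq_iff intro: option.map_cong)

lemma coordinatised_opp_opp:
  assumes "coordinatised G L C \<Phi>"
  shows "coordinatised (opp (opp G)) L C \<Phi>"
proof -
  interpret coordinatised G L C \<Phi> by fact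
  show ?thesis
    by (intro coordinatised.intro coordinatised_axioms.intro)
      (simp_all add: group.group_opp group_opp inj_ob Obj_eq inj_ar Arr_eq Dom_ar Cod_ar Id_ob
          Cmp_ar Inc_eq zmult_opp)
qed

text \<open>Collects what the column functor requires. Nonzero columns ensure that an index in I is
  not sent to the zero functor. The second category lives over \<open>opp G\<close> because
  \<open>\<lambda>\<^sub>g\<close> followed by \<open>\<lambda>\<^sub>h\<close> has label
  hg.\<close>

locale sandwich = C: coordinatised G L C \<Phi> + D: coordinatised "opp G" I D \<Psi>
  for G :: "('g, 'x) monoid_scheme" and L :: "'l set" and C :: "('o, 'm) cat" and \<Phi>
    and I :: "'i set" and D :: "('p, 'n) cat" and \<Psi> +
  fixes P :: "'l \<Rightarrow> 'i \<Rightarrow> 'g option"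
  assumes L_nonempty: "L \<noteq> {}"
    and P_closed: "l \<in> L \<Longrightarrow> i \<in> I \<Longrightarrow> P l i \<in> with_zero (carrier G)"
    and P_col: "i \<in> I \<Longrightarrow> \<exists>l\<in>L. P l i \<noteq> None"
begin

abbreviation is_Gamma :: "('p, 'n, 'o, 'm) conn \<Rightarrow> bool" where
  "is_Gamma \<equiv> is_Gamma_P G I L P C \<Phi> D \<Psi>"

lemma tuple_col: "j \<in> with_zero I \<Longrightarrow> C.tuple (col P j)"
  using P_closed by (auto simp: col_def elim!: with_zero_cases)

lemma nonzero_col: "j \<in> with_zero I \<Longrightarrow> C.nonzero (col P j) \<longleftrightarrow> j \<noteq> None"
  using P_col by (auto simp: col_def elim!: with_zero_cases)

lemma admissible_col:
  "i \<in> with_zero I \<Longrightarrow> j \<in> with_zero I \<Longrightarrow> C.admissible (col P i) g (col P j) \<longleftrightarrow> (i, g, j) \<in> zarr G I"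
  using nonzero_col[of i] nonzero_col[of j] unfolding C.admissible_def zarr_def by auto

text \<open>The two sides differ only in bracketing: \<open>acts\<close> multiplies the column by
  gx, the definition of the functor multiplies it by g and then by x.\<close>

lemma acts_col_iff:
  assumes "(i, g, j) \<in> zarr G I"
  shows "C.acts \<tau> (col P i) g (col P j) \<longleftrightarrow>
    (\<forall>c\<in>with_zero L. \<forall>x\<in>with_zero (carrier G). \<tau> (C.ob c) (C.cone (\<lambda>l. zmult G (col P i l) x) c) =
      C.cone (\<lambda>l. zmult G (zmult G (col P j l) g) x) c)"
proof -
  have j: "j \<in> with_zero I" "g \<in> C.K" using assms by (auto simp: zarr_def)
  show ?thesis
    unfolding C.acts_def by (intro ball_cong refl) (use tuple_col[OF j(1)] j(2) in \<open>simp add: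
        C.scale_assoc\<close>)
qed

lemma Gamma_is_H:
  assumes "is_Gamma \<Gamma>" "j \<in> with_zero I"
  shows "C.is_H (FObj \<Gamma> (D.ob j)) (col P j)"
proof -
  have "FObj \<Gamma> (D.ob j) \<in> Obj (dual C)"
    using assms by (auto simp: is_Gamma_P_def is_functor_def)
  then have "FObj \<Gamma> (D.ob j) \<in> H_fun C ` idem_cones C" by (simp add: dual_def)
  then obtain t where "C.is_H (FObj \<Gamma> (D.ob j)) t" using C.is_H_ex by blast
  then show ?thesis
    by (rule C.is_H_proportional[OF L_nonempty _ tuple_col[OF assms(2)]])
      (use assms in \<open>simp add: is_Gamma_P_def\<close>)
qed

lemma Gamma_ar:
  assumes \<Gamma>: "is_Gamma \<Gamma>" and z: "(i, g, j) \<in> zarr G I"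
  obtains \<tau> where "FArr \<Gamma> (D.ar i g j) = (FObj \<Gamma> (D.ob i), \<tau>, FObj \<Gamma> (D.ob j))"
    "nat_trans C (FObj \<Gamma> (D.ob i)) \<tau> (FObj \<Gamma> (D.ob j))" "C.acts \<tau> (col P i) g (col P j)"
proof -
  have F: "is_functor D (dual C) \<Gamma>" using \<Gamma> by (simp add: is_Gamma_P_def)
  have z': "(i, g, j) \<in> zarr (opp G) I" using z by simp
  obtain F \<tau> F' where f: "FArr \<Gamma> (D.ar i g j) = (F, \<tau>, F')" by (cases "FArr \<Gamma> (D.ar i g j)")
  have "FArr \<Gamma> (D.ar i g j) \<in> Arr (dual C)"
    "Dom (dual C) (FArr \<Gamma> (D.ar i g j)) = FObj \<Gamma> (D.ob i)"
    "Cod (dual C) (FArr \<Gamma> (D.ar i g j)) = FObj \<Gamma> (D.ob j)"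
    using F D.ar_in_Arr[OF z'] by (auto simp: is_functor_def D.Dom_ar[OF z'] D.Cod_ar[OF z'])
  moreover have "\<forall>(i, g, j)\<in>zarr G I. \<forall>c\<in>with_zero L. \<forall>x\<in>with_zero (carrier G).
        component (FArr \<Gamma> (D.ar i g j)) (C.ob c) (C.cone (\<lambda>l. zmult G (col P i l) x) c) =
        C.cone (\<lambda>l. zmult G (zmult G (col P j l) g) x) c"
    using \<Gamma> by (simp add: is_Gamma_P_def)
  then have "C.acts \<tau> (col P i) g (col P j)"
    unfolding acts_col_iff[OF z] using z f by fastforce
  ultimately show thesis using that[of \<tau>] f by (auto simp: dual_def)
qed

text \<open>The images of objects agree because their H-functors have the same column, and those of
  arrows because a transformation is determined by its label; outside the category both functors are
  \<open>undefined\<close>.\<close>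

lemma Gamma_unique:
  assumes "is_Gamma \<Gamma>" "is_Gamma \<Gamma>'"
  shows "\<Gamma> = \<Gamma>'"
proof -
  have F: "is_functor D (dual C) \<Gamma>" "is_functor D (dual C) \<Gamma>'" using assms
      by (simp_all add: is_Gamma_P_def)
  have ext: "FObj \<Gamma> \<in> extensional (Obj D)" "FObj \<Gamma>' \<in> extensional (Obj D)"
    "FArr \<Gamma> \<in> extensional (Arr D)" "FArr \<Gamma>' \<in> extensional (Arr D)"
    using F by (auto simp: is_functor_def PiE_def)
  have o: "FObj \<Gamma> (D.ob j) = FObj \<Gamma>' (D.ob j)" if "j \<in> with_zero I" for j
    using C.is_H_unique Gamma_is_H[OF assms(1) that] Gamma_is_H[OF assms(2) that] by blast
  have 1: "FObj \<Gamma> = FObj \<Gamma>'"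
    by (rule extensionalityI[of _ "Obj D"]) (use ext o in \<open>auto elim!: D.ObjE\<close>)
  have 2: "FArr \<Gamma> = FArr \<Gamma>'"
  proof (rule extensionalityI[of _ "Arr D"])
    show "FArr \<Gamma> \<in> extensional (Arr D)" "FArr \<Gamma>' \<in> extensional (Arr D)" by (fact ext)+
    fix f assume "f \<in> Arr D"
    then obtain i g j where "(i, g, j) \<in> zarr (opp G) I" and f: "f = D.ar i g j" by (rule D.ArrE)
    then have z: "(i, g, j) \<in> zarr G I" by simp
    then have ij: "i \<in> with_zero I" "j \<in> with_zero I" by (auto simp: zarr_def)
    obtain \<tau> where \<tau>: "FArr \<Gamma> (D.ar i g j) = (FObj \<Gamma> (D.ob i), \<tau>, FObj \<Gamma> (D.ob j))"
      "nat_trans C (FObj \<Gamma> (D.ob i)) \<tau> (FObj \<Gamma> (D.ob j))" "C.acts \<tau> (col P i) g (col P j)"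
      by (rule Gamma_ar[OF assms(1) z])
    obtain \<tau>' where \<tau>': "FArr \<Gamma>' (D.ar i g j) = (FObj \<Gamma>' (D.ob i), \<tau>', FObj \<Gamma>' (D.ob j))"
      "nat_trans C (FObj \<Gamma>' (D.ob i)) \<tau>' (FObj \<Gamma>' (D.ob j))" "C.acts \<tau>' (col P i) g (col P j)"
      by (rule Gamma_ar[OF assms(2) z])
    have "\<tau> = \<tau>'"
      by (rule C.acts_unique[OF Gamma_is_H[OF assms(1) ij(1)] \<tau>(3) \<tau>'(3)
            C.nat_trans_extensional[OF \<tau>(2)] C.nat_trans_extensional[OF \<tau>'(2), folded 1]])
    then show "FArr \<Gamma> f = FArr \<Gamma>' f" unfolding f \<tau>(1) \<tau>'(1) 1 by simp
  qed
  show ?thesis using 1 2 by (cases \<Gamma>; cases \<Gamma>') simp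
qed

lemma Gamma_exists: "\<exists>\<Gamma>. is_Gamma \<Gamma>"
proof -
  \<comment> \<open>Images of objects and arrows are merely chosen with the required column or
    label. Functoriality then follows because a transformation with a given label is unique.\<close>
  define go where "go j = (SOME F. C.is_H F (col P j))" for j
  have go: "C.is_H (go j) (col P j)" if "j \<in> with_zero I" for j
    unfolding go_def by (rule someI_ex[OF C.is_H_tuple[OF tuple_col[OF that]]])
  define ga where "ga i g j = (SOME \<tau>. nat_trans C (go i) \<tau> (go j) \<and>
      C.acts \<tau> (col P i) g (col P j))" for i g j
  have ga: "nat_trans C (go i) (ga i g j) (go j)" "C.acts (ga i g j) (col P i) g (col P j)"
    if "(i, g, j) \<in> zarr G I" for i g j
  proof -
    have ij: "i \<in> with_zero I" "j \<in> with_zero I" using that by (auto simp: zarr_def)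
    have "\<exists>\<tau>. nat_trans C (go i) \<tau> (go j) \<and> C.acts \<tau> (col P i) g (col P j)"
      by (rule C.acts_exists[OF go[OF ij(1)] go[OF ij(2)]]) (use that ij admissible_col in blast)
    from someI_ex[OF this] show "nat_trans C (go i) (ga i g j) (go j)"
        "C.acts (ga i g j) (col P i) g (col P j)"
      by (auto simp: ga_def)
  qed
  define \<Gamma> where "\<Gamma> = \<lparr>FObj = (\<lambda>d\<in>Obj D. go (inv_into (with_zero I) D.ob d)),
    FArr = (\<lambda>f\<in>Arr D. case inv_into (zarr (opp G) I) (FArr \<Psi>) f of (i, g, j) \<Rightarrow> (go i, ga i g j, go
        j))\<rparr>"
  have \<Gamma>o: "FObj \<Gamma> (D.ob j) = go j" if "j \<in> with_zero I" for j
    using that D.inj_ob by (simp add: \<Gamma>_def)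
  have \<Gamma>a: "FArr \<Gamma> (D.ar i g j) = (go i, ga i g j, go j)" if "(i, g, j) \<in> zarr G I" for i g j
    using that D.inj_ar D.ar_in_Arr[of i g j] inv_into_f_f[OF D.inj_ar, of "(i, g, j)"]
        by (simp add: \<Gamma>_def)
  have mem: "(go i, ga i g j, go j) \<in> Arr (dual C)" if "(i, g, j) \<in> zarr G I" for i g j
    using ga[OF that] C.is_HD(1)[OF go] that by (auto simp: dual_def zarr_def)
  have "is_functor D (dual C) \<Gamma>"
    unfolding is_functor_def
  proof (intro conjI ballI impI)
    show "is_category D" by (rule D.is_category)
    show "is_category (dual C)" by (rule coordinatised.is_category[OF C.coordinatised_dual])
    show "FObj \<Gamma> \<in> Obj D \<rightarrow>\<^sub>E Obj (dual C)"
    proof (rule PiE_I)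
      fix x assume "x \<in> Obj D"
      then show "FObj \<Gamma> x \<in> Obj (dual C)"
        using C.is_HD(1)[OF go] by (auto simp: \<Gamma>o dual_def elim!: D.ObjE)
    qed (simp add: \<Gamma>_def)
    show "FArr \<Gamma> \<in> Arr D \<rightarrow>\<^sub>E Arr (dual C)"
    proof (rule PiE_I)
      fix f assume "f \<in> Arr D"
      then show "FArr \<Gamma> f \<in> Arr (dual C)" by (rule D.ArrE) (simp add: \<Gamma>a mem)
    qed (simp add: \<Gamma>_def)
    fix f assume "f \<in> Arr D"
    then obtain i g j where "(i, g, j) \<in> zarr (opp G) I" and f: "f = D.ar i g j" by (rule D.ArrE)
    then have z: "(i, g, j) \<in> zarr G I" by simp
    then have ij: "i \<in> with_zero I" "j \<in> with_zero I" "g \<in> C.K" by (auto simp: zarr_def)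
    show "Dom (dual C) (FArr \<Gamma> f) = FObj \<Gamma> (Dom D f)" "Cod (dual C) (FArr \<Gamma> f) = FObj \<Gamma> (Cod D f)"
      using z ij by (simp_all add: f \<Gamma>a \<Gamma>o D.Dom_ar D.Cod_ar) (simp_all add: dual_def)
    fix f' assume "f' \<in> Arr D"
    then obtain i' g' j' where "(i', g', j') \<in> zarr (opp G) I" and f': "f' = D.ar i' g' j'"
        by (rule D.ArrE)
    then have z': "(i', g', j') \<in> zarr G I" by simp
    then have ij': "i' \<in> with_zero I" "j' \<in> with_zero I" "g' \<in> C.K" by (auto simp: zarr_def)
    assume "Cod D f = Dom D f'"
    then have eq: "i' = j" using z z' ij ij' by (simp add: f f' D.Dom_ar D.Cod_ar)
    have zz: "(i, zmult G g' g, j') \<in> zarr G I" using z z' by (auto simp: zarr_def eq)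
    have "C.acts (\<lambda>c\<in>Obj C. compose (SObj (go i) c) (ga j g' j' c) (ga i g j c)) (col P i) (zmult G
        g' g) (col P j')"
      by (rule C.acts_compose[OF go[OF ij(1)] ga(2)[OF z] ga(2)[OF z'[unfolded eq]] ij(3) ij'(3)])
    then have "ga i (zmult G g' g) j' =
        (\<lambda>c\<in>Obj C. compose (SObj (go i) c) (ga j g' j' c) (ga i g j c))"
      by (rule C.acts_unique[OF go[OF ij(1)] ga(2)[OF zz] _ C.nat_trans_extensional[OF ga(1)[OF
          zz]]])
        (auto simp: compose_def)
    then show "FArr \<Gamma> (f \<Zsemi>\<^bsub>D\<^esub> f') = FArr \<Gamma> f \<Zsemi>\<^bsub>dual C\<^esub> FArr \<Gamma> f'"
      using z z' zz by (simp add: f f' eq D.Cmp_ar \<Gamma>a zmult_opp) (simp add: dual_def)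
  next
    fix x assume "x \<in> Obj D"
    then obtain j where j: "j \<in> with_zero I" "x = D.ob j" by (rule D.ObjE)
    define u where "u = (if j = None then None else Some \<one>\<^bsub>G\<^esub>)"
    have z: "(j, u, j) \<in> zarr G I" using j by (auto simp: zarr_def u_def)
    have "C.acts (\<lambda>c\<in>Obj C. \<lambda>x\<in>SObj (go j) c. x) (col P j) u (col P j)"
      by (rule C.acts_id[OF go[OF j(1)]]) (simp add: col_def u_def)
    then have "ga j u j = (\<lambda>c\<in>Obj C. \<lambda>x\<in>SObj (go j) c. x)"
      by (rule C.acts_unique[OF go[OF j(1)] ga(2)[OF z] _ C.nat_trans_extensional[OF ga(1)[OF z]]])
          auto
    moreover have "Id D x = D.ar j u j" using j by (simp add: D.Id_ob zid_def u_def)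
    ultimately show "FArr \<Gamma> (Id D x) = Id (dual C) (FObj \<Gamma> x)"
      using j z by (simp add: \<Gamma>a \<Gamma>o) (simp add: dual_def)
  qed
  moreover have "SObj (FObj \<Gamma> (D.ob j)) (C.ob c) =
      {C.cone (\<lambda>l. zmult G (col P j l) x) c | x. x \<in> C.K}"
    if "j \<in> with_zero I" "c \<in> with_zero L" for j c
    using that C.is_HD(3)[OF go] by (simp add: \<Gamma>o)
  moreover have "\<forall>c\<in>with_zero L. \<forall>x\<in>C.K. component (FArr \<Gamma> (D.ar i g j)) (C.ob c) (C.cone (\<lambda>l. zmult
      G (col P i l) x) c) =
      C.cone (\<lambda>l. zmult G (zmult G (col P j l) g) x) c" if "(i, g, j) \<in> zarr G I" for i g j
    using ga(2)[OF that] that by (simp add: \<Gamma>a acts_col_iff)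
  ultimately show ?thesis unfolding is_Gamma_P_def by (intro exI[of _ \<Gamma>]) blast
qed

text \<open>Proportional columns are sent to the same H-functor, so the functor need not be
  injective on objects. It is fully faithful since arrows and transformations have the same labels,
  and it keeps 0 apart from the other objects.\<close>

lemma Gamma_local_iso:
  assumes \<Gamma>: "is_Gamma \<Gamma>"
  shows "local_iso D (dual C) \<Gamma>"
proof (rule local_isoI[OF D.coordinatised_axioms C.coordinatised_dual])
  show F: "is_functor D (dual C) \<Gamma>" using \<Gamma> by (simp add: is_Gamma_P_def)
  have FObj: "FObj C.dual_coord = C.dual_ob" by (simp add: C.dual_coord_def)
  have "FObj \<Gamma> (D.ob None) = C.H_zero"
    using C.is_H_zero_iff[OF Gamma_is_H[OF \<Gamma>, of None]] nonzero_col[of None] by simp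
  then show "FObj \<Gamma> (D.ob None) = FObj C.dual_coord None" by (simp add: FObj C.dual_ob_def)
  fix i assume i: "i \<in> I"
  then have "FObj \<Gamma> (D.ob (Some i)) \<noteq> C.H_zero"
    using C.is_H_zero_iff[OF Gamma_is_H[OF \<Gamma>, of "Some i"]] nonzero_col[of "Some i"] by simp
  then have "FObj \<Gamma> (D.ob (Some i)) \<in> C.H_nonzero"
    using C.is_HD(1)[OF Gamma_is_H[OF \<Gamma>, of "Some i"]] i by (auto simp: C.H_nonzero_def)
  then show "\<exists>k\<in>C.H_nonzero. FObj \<Gamma> (D.ob (Some i)) = FObj C.dual_coord (Some k)"
    by (auto simp: FObj C.dual_ob_def)
next
  fix x y assume "x \<in> Obj D" "y \<in> Obj D"
  then obtain i j where i: "i \<in> with_zero I" "x = D.ob i" and j: "j \<in> with_zero I" "y = D.ob j"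
    by (auto elim!: D.ObjE)
  note Hi = Gamma_is_H[OF \<Gamma> i(1)] and Hj = Gamma_is_H[OF \<Gamma> j(1)]
  have mor: "mor D x y = {D.ar i g j | g. (i, g, j) \<in> zarr G I}" using i j by (simp add: D.mor_eq)
  have mor': "mor (dual C) (FObj \<Gamma> x) (FObj \<Gamma> y) =
      {(FObj \<Gamma> x, \<tau>, FObj \<Gamma> y) | \<tau>. nat_trans C (FObj \<Gamma> x) \<tau> (FObj \<Gamma> y)}"
    using C.is_HD(1)[OF Hi] C.is_HD(1)[OF Hj] i j by (auto simp: mor_def dual_def)
  show "bij_betw (FArr \<Gamma>) (mor D x y) (mor (dual C) (FObj \<Gamma> x) (FObj \<Gamma> y))"
    unfolding bij_betw_def
  proof
    show "inj_on (FArr \<Gamma>) (mor D x y)"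
    proof (rule inj_onI)
      fix f f' assume "f \<in> mor D x y" "f' \<in> mor D x y" and eq: "FArr \<Gamma> f = FArr \<Gamma> f'"
      then obtain g g' where z: "(i, g, j) \<in> zarr G I" "f = D.ar i g j" "(i, g', j) \<in> zarr G I"
          "f' = D.ar i g' j"
        unfolding mor by auto
      obtain \<tau> where \<tau>: "FArr \<Gamma> (D.ar i g j) = (FObj \<Gamma> (D.ob i), \<tau>, FObj \<Gamma> (D.ob j))"
        "C.acts \<tau> (col P i) g (col P j)" by (rule Gamma_ar[OF \<Gamma> z(1)])
      obtain \<tau>' where \<tau>': "FArr \<Gamma> (D.ar i g' j) = (FObj \<Gamma> (D.ob i), \<tau>', FObj \<Gamma> (D.ob j))"
        "C.acts \<tau>' (col P i) g' (col P j)" by (rule Gamma_ar[OF \<Gamma> z(3)])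
      have "\<tau> = \<tau>'" using eq \<tau> \<tau>' z by simp
      then have "g = g'"
        using C.acts_label_unique[OF Hj, of
            "col P i" g g' \<tau>] \<tau> \<tau>' z(1,3) admissible_col[OF i(1) j(1)] by simp
      then show "f = f'" using z by simp
    qed
    show "FArr \<Gamma> ` mor D x y = mor (dual C) (FObj \<Gamma> x) (FObj \<Gamma> y)"
    proof
      show "FArr \<Gamma> ` mor D x y \<subseteq> mor (dual C) (FObj \<Gamma> x) (FObj \<Gamma> y)"
      proof
        fix t assume "t \<in> FArr \<Gamma> ` mor D x y"
        then obtain g where z: "(i, g, j) \<in> zarr G I" "t = FArr \<Gamma> (D.ar i g j)" unfolding mor
            by auto
        show "t \<in> mor (dual C) (FObj \<Gamma> x) (FObj \<Gamma> y)"
          unfolding mor' by (rule Gamma_ar[OF \<Gamma> z(1)]) (use z i j in auto)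
      qed
      show "mor (dual C) (FObj \<Gamma> x) (FObj \<Gamma> y) \<subseteq> FArr \<Gamma> ` mor D x y"
      proof
        fix t assume "t \<in> mor (dual C) (FObj \<Gamma> x) (FObj \<Gamma> y)"
        then obtain \<tau> where t: "t = (FObj \<Gamma> x, \<tau>, FObj \<Gamma> y)"
            and n: "nat_trans C (FObj \<Gamma> x) \<tau> (FObj \<Gamma> y)"
          unfolding mor' by blast
        obtain g where g: "C.admissible (col P i) g (col P j)" "C.acts \<tau> (col P i) g (col P j)"
          using C.nat_trans_acts[OF Hi Hj] n i j by blast
        then have z: "(i, g, j) \<in> zarr G I" using admissible_col i j by blast
        obtain \<tau>' where \<tau>': "FArr \<Gamma> (D.ar i g j) = (FObj \<Gamma> (D.ob i), \<tau>', FObj \<Gamma> (D.ob j))"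
          "nat_trans C (FObj \<Gamma> (D.ob i)) \<tau>' (FObj \<Gamma> (D.ob j))" "C.acts \<tau>' (col P i) g (col P j)"
          by (rule Gamma_ar[OF \<Gamma> z])
        have "\<tau> = \<tau>'"
          by (rule C.acts_unique[OF Hi g(2) \<tau>'(3) C.nat_trans_extensional[OF n[unfolded i j]]
                C.nat_trans_extensional[OF \<tau>'(2)]])
        then have "t = FArr \<Gamma> (D.ar i g j)" using t \<tau>'(1) i j by simp
        then show "t \<in> FArr \<Gamma> ` mor D x y" unfolding mor using z by blast
      qed
    qed
  qed
qed

end

text \<open>In the opposite group a scalar on the right of a row becomes one on its left. What
  remains is the bracketing: (xg)p on one side, x(gp) on the other.\<close>

lemma is_Delta_P_eq_is_Gamma_P:
  assumes "group G" and P: "\<And>l i. l \<in> L \<Longrightarrow> i \<in> I \<Longrightarrow> P l i \<in> with_zero (carrier G)"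
  shows "is_Delta_P G I L P C \<Phi> D \<Psi> = is_Gamma_P (opp G) L I (\<lambda>i l. P l i) D \<Psi> C \<Phi>"
proof
  fix \<Delta>
  interpret group G by fact
  have rc: "row P c = col (\<lambda>i l. P l i) c" for c by (simp add: row_def col_def)
  have assoc: "tcone \<Psi> I (\<lambda>i. zmult G (zmult G x g) (row P d i)) j =
      tcone \<Psi> I (\<lambda>i. zmult G x (zmult G g (row P d i))) j"
    if "(c, g, d) \<in> zarr G L" "x \<in> with_zero (carrier G)" for c g d x j
  proof -
    have "row P d i \<in> with_zero (carrier G)" if "i \<in> I" for i
      using that \<open>(c, g, d) \<in> zarr G L\<close> P by (auto simp: zarr_def row_def elim!: with_zero_cases)
    then have "zmult G (zmult G x g) (row P d i) = zmult G x (zmult G g (row P d i))" if "i \<in> I"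
        for i
      using that \<open>(c, g, d) \<in> zarr G L\<close> \<open>x \<in> _\<close> by (auto simp: zarr_def zmult_assoc)
    then show ?thesis
      unfolding tcone_def Let_def
      by (intro restrict_ext) (auto split: option.splits dest!: inv_into_into)
  qed
  show "is_Delta_P G I L P C \<Phi> D \<Psi> \<Delta> \<longleftrightarrow> is_Gamma_P (opp G) L I (\<lambda>i l. P l i) D \<Psi> C \<Phi> \<Delta>"
    unfolding is_Delta_P_def is_Gamma_P_def rc[symmetric] zmult_opp opp_simps zarr_opp
    using assoc by (intro conj_cong ball_cong refl) auto
qed

section \<open>Rees matrix semigroups\<close>

lemma rees_smul [simp]:
  "None \<cdot>\<^bsub>rees G I L P\<^esub> y = None" "x \<cdot>\<^bsub>rees G I L P\<^esub> None = None"
  "Some (i, a, l) \<cdot>\<^bsub>rees G I L P\<^esub> Some (j, b, k) =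
    (case P l j of None \<Rightarrow> None | Some p \<Rightarrow> Some (i, a \<otimes>\<^bsub>G\<^esub> p \<otimes>\<^bsub>G\<^esub> b, k))"
  by (auto simp: rees_def split: option.splits)

lemma rees_carrier [simp]:
  "None \<in> carrier (rees G I L P)"
  "Some (i, a, l) \<in> carrier (rees G I L P) \<longleftrightarrow> i \<in> I \<and> a \<in> carrier G \<and> l \<in> L"
  by (auto simp: rees_def)

lemma rees_carrierE:
  assumes "x \<in> carrier (rees G I L P)"
  obtains "x = None" | i a l where "x = Some (i, a, l)" "i \<in> I" "a \<in> carrier G" "l \<in> L"
  using assms by (auto simp: rees_def with_zero_def)

lemma rees_closed:
  assumes "group G" and P: "\<And>l i. l \<in> L \<Longrightarrow> i \<in> I \<Longrightarrow> P l i \<in> with_zero (carrier G)"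
    and "x \<in> carrier (rees G I L P)" "y \<in> carrier (rees G I L P)"
  shows "x \<cdot>\<^bsub>rees G I L P\<^esub> y \<in> carrier (rees G I L P)"
proof -
  interpret group G by fact
  show ?thesis
    using assms(3)
  proof (cases rule: rees_carrierE)
    case x: (2 i a l)
    from assms(4) show ?thesis
    proof (cases rule: rees_carrierE)
      case (2 j b k)
      then show ?thesis using x P[of l j] by (auto split: option.splits)
    qed simp
  qed simp
qed

section \<open>The cross-connection of a regular matrix\<close>

context coordinatised
begin

text \<open>The second factor enters only through its component at the apex of the first, whose
  label is \<open>label s c\<close>. If this label is 0, the product is the zero cone.\<close>

lemma cone_mult_cone:
  assumes "tuple t" "c \<in> with_zero L" "nonzero t \<longleftrightarrow> c \<noteq> None"
    and "tuple s" "d \<in> with_zero L" "nonzero s \<longleftrightarrow> d \<noteq> None"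
  shows "cone_mult C (cone t c) (cone s d) = cone (scale t (label s c)) d"
proof -
  note at = cone_at_reduced[OF assms(4-6,2)]
  show ?thesis
    using cone_star_cone[OF assms(1,3) at(2)] at(1)
        by (simp add: cone_mult_def apex_cone[OF assms(1-3)])
qed

end

locale sandwich_pair = sandwich G L C \<Phi> I D \<Psi> P
  for G :: "('g, 'x) monoid_scheme" and L :: "'l set" and C :: "('o, 'm) cat" and \<Phi>
    and I :: "'i set" and D :: "('p, 'n) cat" and \<Psi> and P +
  assumes I_nonempty: "I \<noteq> {}" and P_row: "l \<in> L \<Longrightarrow> \<exists>i\<in>I. P l i \<noteq> None"
begin

text \<open>Conditions on rows are conditions on columns of the transposed matrix, so all results on
  the column functor become available for the row functor under the prefix \<open>T\<close>.\<close>

sublocale T: sandwich "opp G" I D \<Psi> L C \<Phi> "\<lambda>i l. P l i"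
  by (intro sandwich.intro sandwich_axioms.intro)
    (use coordinatised_opp_opp[OF C.coordinatised_axioms] D.coordinatised_axioms I_nonempty P_row
        P_closed in auto)

abbreviation Pt :: "'i \<Rightarrow> 'l \<Rightarrow> 'g option" where "Pt \<equiv> \<lambda>i l. P l i"

definition entry :: "'l option \<Rightarrow> 'i option \<Rightarrow> 'g option" where
  "entry c d = (case c of None \<Rightarrow> None | Some l \<Rightarrow> (case d of None \<Rightarrow> None | Some i \<Rightarrow> P l i))"

text \<open>The set \<open>E\<^sub>\<Omega>\<close> in coordinates, with (0, 0) among its elements.
  The word refers here to pairs of objects, not to linked pairs of cones.\<close>

definition linked :: "'l option \<Rightarrow> 'i option \<Rightarrow> bool" where
  "linked c d \<longleftrightarrow> c \<in> with_zero L \<and> d \<in> with_zero I \<and> (c = None \<longleftrightarrow> d = None) \<and> (c \<noteq> None \<longrightarrow>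
      entry c d \<noteq> None)"

lemma entry_None [simp]: "entry None d = None" "entry c None = None"
  by (auto simp: entry_def split: option.splits)

lemma entry_Some [simp]: "entry (Some l) (Some i) = P l i"
  by (simp add: entry_def)

lemma label_col: "C.label (col P d) c = entry c d" "D.label (col Pt c) d = entry c d"
  by (auto simp: entry_def col_def split: option.splits)

lemma entry_closed: "c \<in> with_zero L \<Longrightarrow> d \<in> with_zero I \<Longrightarrow> entry c d \<in> C.K"
  using P_closed by (auto simp: entry_def split: option.splits)

context
  fixes \<Gamma> :: "('p, 'n, 'o, 'm) conn" and \<Delta> :: "('o, 'm, 'p, 'n) conn"
  assumes \<Gamma>: "is_Gamma \<Gamma>" and \<Delta>: "T.is_Gamma \<Delta>"
begin

lemma MH_Gamma:
  assumes "c \<in> with_zero L" "d \<in> with_zero I"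
  shows "C.ob c \<in> MH C (FObj \<Gamma> (D.ob d)) \<longleftrightarrow> linked c d"
  using C.MH_iff[OF Gamma_is_H[OF \<Gamma> assms(2)] assms(1)] assms nonzero_col[OF assms(2)]
  unfolding label_col linked_def by auto

lemma MH_Delta:
  assumes "c \<in> with_zero L" "d \<in> with_zero I"
  shows "D.ob d \<in> MH D (FObj \<Delta> (C.ob c)) \<longleftrightarrow> linked c d"
  using D.MH_iff[OF T.Gamma_is_H[OF \<Delta> assms(1)] assms(2)] assms T.nonzero_col[OF assms(1)]
  unfolding label_col linked_def by auto

lemma cross_connection: "cross_connection C D \<Gamma> \<Delta>"
  unfolding cross_connection_def
proof (intro conjI ballI)
  show "unambiguous C" by (rule C.unambiguous)
  show "unambiguous D" by (rule D.unambiguous)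
  show "local_iso D (dual C) \<Gamma>" by (rule Gamma_local_iso[OF \<Gamma>])
  show "local_iso C (dual D) \<Delta>" by (rule T.Gamma_local_iso[OF \<Delta>])
  fix x y assume "x \<in> Obj C" "y \<in> Obj D"
  then show "x \<in> MH C (FObj \<Gamma> y) \<longleftrightarrow> y \<in> MH D (FObj \<Delta> x)"
    by (auto simp: MH_Gamma MH_Delta elim!: C.ObjE D.ObjE)
qed

section \<open>Transposes and the bijection chi in coordinates\<close>

lemma conn_cone_Gamma:
  assumes "linked c d"
  shows "conn_cone C \<Gamma> (C.ob c) (D.ob d) = C.cone (C.scale (col P d) (zinv G (entry c d))) c"
    and "C.idem_tuple (C.scale (col P d) (zinv G (entry c d))) c"
proof -
  have cd: "c \<in> with_zero L" "d \<in> with_zero I" using assms by (auto simp: linked_def)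
  have MH: "C.ob c \<in> MH C (FObj \<Gamma> (D.ob d))" using MH_Gamma cd assms by blast
  note H = Gamma_is_H[OF \<Gamma> cd(2)]
  show "conn_cone C \<Gamma> (C.ob c) (D.ob d) = C.cone (C.scale (col P d) (zinv G (entry c d))) c"
    using C.conn_cone_eq[where \<Gamma>=\<Gamma>, OF H cd(1) MH] unfolding label_col .
  show "C.idem_tuple (C.scale (col P d) (zinv G (entry c d))) c"
    using C.idem_tuple_scale[OF C.is_HD(2)[OF H] cd(1)] MH C.MH_iff[OF H cd(1)] unfolding label_col
        by blast
qed

lemma conn_cone_Delta:
  assumes "linked c d"
  shows "conn_cone D \<Delta> (D.ob d) (C.ob c) = D.cone (D.scale (col Pt c) (zinv G (entry c d))) d"
    and "D.idem_tuple (D.scale (col Pt c) (zinv G (entry c d))) d"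
proof -
  have cd: "c \<in> with_zero L" "d \<in> with_zero I" using assms by (auto simp: linked_def)
  have MH: "D.ob d \<in> MH D (FObj \<Delta> (C.ob c))" using MH_Delta cd assms by blast
  note H = T.Gamma_is_H[OF \<Delta> cd(1)]
  show "conn_cone D \<Delta> (D.ob d) (C.ob c) = D.cone (D.scale (col Pt c) (zinv G (entry c d))) d"
    using D.conn_cone_eq[where \<Gamma>=\<Delta>, OF H cd(2) MH] unfolding label_col zinv_opp .
  show "D.idem_tuple (D.scale (col Pt c) (zinv G (entry c d))) d"
    using D.idem_tuple_scale[OF D.is_HD(2)[OF H] cd(2)] MH D.MH_iff[OF H cd(2)]
        unfolding label_col zinv_opp by blast
qed

text \<open>The cone delta(c,d) has the row of c divided by p = \<open>entry c d\<close> as its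
  tuple, so y times the row is yp times this tuple. Tuples of \<open>D\<close> are scaled over the
  opposite group, that is, from the left.\<close>

lemma eta_Delta:
  assumes cd: "linked c d" and e: "e \<in> with_zero I" and y: "y \<in> C.K" "e = None \<longrightarrow> y = None"
  shows "eta D (conn_cone D \<Delta> (D.ob d) (C.ob c)) (D.ob e) (D.cone (D.scale (col Pt c) y) e) =
    D.ar d (zmult G y (entry c d)) e"
proof -
  have cd': "c \<in> with_zero L" "d \<in> with_zero I" using cd by (auto simp: linked_def)
  have p: "entry c d \<in> C.K" using entry_closed cd' .
  have z: "(d, zmult G y (entry c d), e) \<in> zarr (opp G) I"
    using cd' e y p by (auto simp: zarr_def)
  have "D.cone (D.scale (D.scale (col Pt c) (zinv G (entry c d))) (zmult G y (entry c d))) e =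
      D.cone (D.scale (col Pt c) y) e"
  proof (cases c)
    case None
    then show ?thesis by (intro D.cone_cong) (simp add: col_def)
  next
    case (Some l)
    then have "entry c d \<noteq> None" using cd by (auto simp: linked_def)
    then have "zmult G (zmult G y (entry c d)) (zinv G (entry c d)) = y"
      using p y by (auto simp: C.zmult_assoc C.zinv_zmult)
    then show ?thesis
      using D.scale_assoc[OF T.tuple_col[OF cd'(1)], of "zinv G (entry c d)"
          "zmult G y (entry c d)" e] p y
      by (simp add: zmult_opp)
  qed
  then show ?thesis
    using D.eta_cone[OF conn_cone_Delta(2)[OF cd] z] unfolding conn_cone_Delta(1)[OF cd] by simp
qed

text \<open>The element of scalar y is taken to an arrow labelled y g p(c,d') along one way round
  and, through an arrow labelled k, to y p(c',d) k along the other. Solving for k gives the stated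
  product.\<close>

lemma transpose_eq:
  assumes c'd: "linked c' d" and cd': "linked c d'" and g: "(c', g, c) \<in> zarr G L"
  defines "k \<equiv> zmult G (zmult G (zinv G (entry c' d)) g) (entry c d')"
  shows "transpose D \<Delta> (C.ob c') (D.ob d) (C.ob c) (D.ob d') (C.ar c' g c) = D.ar d' k d"
    and "(d', k, d) \<in> zarr G I"
proof -
  have o: "c \<in> with_zero L" "d \<in> with_zero I" "c' \<in> with_zero L" "d' \<in> with_zero I" "g \<in> C.K"
    using assms by (auto simp: linked_def zarr_def)
  have K: "entry c' d \<in> C.K" "entry c d' \<in> C.K" using entry_closed o by auto
  show k: "(d', k, d) \<in> zarr G I"
    using o K g c'd cd' unfolding k_def by (auto simp: zarr_def linked_def)
  then have k': "(d', k, d) \<in> zarr (opp G) I" by simp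
  obtain \<tau> where \<tau>: "FArr \<Delta> (C.ar c' g c) = (FObj \<Delta> (C.ob c'), \<tau>, FObj \<Delta> (C.ob c))"
    "D.acts \<tau> (col Pt c') g (col Pt c)"
    using T.Gamma_ar[OF \<Delta>, of c' g c] g by (metis zarr_opp)
  have lhs: "eta D (conn_cone D \<Delta> (D.ob d') (C.ob c)) (D.ob e)
      (component (FArr \<Delta> (C.ar c' g c)) (D.ob e) (D.cone (D.scale (col Pt c') y) e)) =
      D.ar d' (zmult G (zmult G y g) (entry c d')) e"
    if "e \<in> with_zero I" "y \<in> C.K" "e = None \<longrightarrow> y = None" for e y
  proof -
    have "\<tau> (D.ob e) (D.cone (D.scale (col Pt c') y) e) =
        D.cone (D.scale (col Pt c) (zmult G y g)) e"
      using D.actsD[OF \<tau>(2) that(1)] that(2) by (simp add: zmult_opp)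
    then show ?thesis using eta_Delta[OF cd' that(1), of "zmult G y g"] that o by (simp add: \<tau>(1))
  qed
  have rhs: "zmult G (zmult G y (entry c' d)) k = zmult G (zmult G y g) (entry c d')"
      if y: "y \<in> C.K" for y
  proof (cases c')
    case None
    then have "g = None" using g by (auto simp: zarr_def)
    then show ?thesis by (simp add: k_def)
  next
    case (Some l)
    then have "entry c' d \<noteq> None" using c'd by (auto simp: linked_def)
    then have e1: "zmult G (entry c' d) (zinv G (entry c' d)) = Some \<one>\<^bsub>G\<^esub>" using K C.zinv_zmult
        by auto
    have "zmult G (zmult G y (entry c' d)) k =
        zmult G y (zmult G (zmult G (entry c' d) (zinv G (entry c' d))) (zmult G g (entry c d')))"
      unfolding k_def using y K o by (simp add: C.zmult_assoc)
    also have "\<dots> = zmult G (zmult G y g) (entry c d')" unfolding e1 using y K o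
        by (simp add: C.zmult_assoc)
    finally show ?thesis .
  qed
  have SObj: "SObj (FObj \<Delta> (C.ob c')) (D.ob e) = {D.cone (D.scale (col Pt c') y) e | y. y \<in> C.K}"
    if "e \<in> with_zero I" for e using D.is_HD(3)[OF T.Gamma_is_H[OF \<Delta> o(3)] that] by simp
  show "transpose D \<Delta> (C.ob c') (D.ob d) (C.ob c) (D.ob d') (C.ar c' g c) = D.ar d' k d"
    unfolding transpose_def
  proof (rule the_equality)
    show "D.ar d' k d \<in> mor D (D.ob d') (D.ob d) \<and>
     (\<forall>e\<in>Obj D. \<forall>x\<in>SObj (FObj \<Delta> (C.ob c')) e.
        eta D (conn_cone D \<Delta> (D.ob d') (C.ob c)) e (component (FArr \<Delta> (C.ar c' g c)) e x) =
        D.ar d' k d \<Zsemi>\<^bsub>D\<^esub> eta D (conn_cone D \<Delta> (D.ob d) (C.ob c')) e x)"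
    proof (intro conjI ballI)
      show "D.ar d' k d \<in> mor D (D.ob d') (D.ob d)" using o k' by (simp add: D.ar_in_mor)
      fix y x assume "y \<in> Obj D" and x: "x \<in> SObj (FObj \<Delta> (C.ob c')) y"
      then obtain e where e: "e \<in> with_zero I" "y = D.ob e" by (auto elim: D.ObjE)
      then obtain u where u: "u \<in> C.K" "x = D.cone (D.scale (col Pt c') u) e" using x SObj by auto
      \<comment> \<open>At e = 0 all scalars give the same cone, but only the scalar 0 labels an
        arrow, as \<open>eta_Delta\<close> requires.\<close>
      have "\<exists>u. u \<in> C.K \<and> x = D.cone (D.scale (col Pt c') u) e \<and> (e = None \<longrightarrow> u = None)"
      proof (cases e)
        case None
        then have "x = D.cone (D.scale (col Pt c') None) e" unfolding u(2)
            by (intro D.cone_zero_eq) auto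
        then show ?thesis using None_with_zero by blast
      qed (use u in auto)
      then obtain v where v: "v \<in> C.K" "x = D.cone (D.scale (col Pt c') v) e" "e = None \<longrightarrow> v = None"
          by blast
      have z: "(d, zmult G v (entry c' d), e) \<in> zarr (opp G) I" using v o e K
          by (auto simp: zarr_def)
      show "eta D (conn_cone D \<Delta> (D.ob d') (C.ob c)) y (component (FArr \<Delta> (C.ar c' g c)) y x) =
        D.ar d' k d \<Zsemi>\<^bsub>D\<^esub> eta D (conn_cone D \<Delta> (D.ob d) (C.ob c')) y x"
        unfolding e(2) v(2) lhs[OF e(1) v(1,3)] eta_Delta[OF c'd e(1) v(1,3)] D.Cmp_ar[OF k' z]
        by (simp add: zmult_opp rhs v(1))
    qed
  next
    fix h assume h: "h \<in> mor D (D.ob d') (D.ob d) \<and>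
     (\<forall>e\<in>Obj D. \<forall>x\<in>SObj (FObj \<Delta> (C.ob c')) e.
        eta D (conn_cone D \<Delta> (D.ob d') (C.ob c)) e (component (FArr \<Delta> (C.ar c' g c)) e x) =
        h \<Zsemi>\<^bsub>D\<^esub> eta D (conn_cone D \<Delta> (D.ob d) (C.ob c')) e x)"
    then obtain m where m: "(d', m, d) \<in> zarr (opp G) I" "h = D.ar d' m d" using o
        by (auto simp: D.mor_eq)
    \<comment> \<open>Chosen so that \<open>eta\<close> sends the corresponding element to the
      identity at d; the defining equation at d then becomes a formula for \<open>h\<close>
      itself.\<close>
    define v where "v = zinv G (entry c' d)"
    have v: "v \<in> C.K" "d = None \<longrightarrow> v = None" using K by (auto simp: v_def)
    have vp: "zmult G v (entry c' d) = D.unit_label d"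
      using c'd K by (cases d) (auto simp: v_def C.zinv_zmult linked_def)
    have z: "(d, D.unit_label d, d) \<in> zarr (opp G) I" using D.zid_in_zarr o by blast
    have "D.cone (D.scale (col Pt c') v) d \<in> SObj (FObj \<Delta> (C.ob c')) (D.ob d)"
      using SObj[OF o(2)] v(1) by auto
    with h have "eta D (conn_cone D \<Delta> (D.ob d') (C.ob c)) (D.ob d)
        (component (FArr \<Delta> (C.ar c' g c)) (D.ob d) (D.cone (D.scale (col Pt c') v) d)) =
        h \<Zsemi>\<^bsub>D\<^esub> eta D (conn_cone D \<Delta> (D.ob d) (C.ob c')) (D.ob d) (D.cone (D.scale (col Pt c') v) d)"
      using o by auto
    then have "D.ar d' k d = h \<Zsemi>\<^bsub>D\<^esub> D.ar d (D.unit_label d) d"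
      unfolding lhs[OF o(2) v] eta_Delta[OF c'd o(2) v] vp by (simp add: k_def v_def)
    also have "\<dots> = h" unfolding m(2) D.Cmp_ar[OF m(1) z] D.unit_label_zmult(2)[OF m(1)] ..
    finally show "h = D.ar d' k d" ..
  qed
qed

text \<open>In the second cone the factor p(c,d') of the transpose meets its inverse from the
  normalisation of delta(c,d'). Both cones are left with the scalar p(c',d)^-1 g, so chi can be
  computed from this scalar alone.\<close>

lemma linked_cones:
  assumes c'd: "linked c' d" and cd': "linked c d'" and g: "(c', g, c) \<in> zarr G L"
  shows "cone_star C (conn_cone C \<Gamma> (C.ob c') (D.ob d)) (epi_part C (C.ar c' g c)) =
      C.cone (C.scale (col P d) (zmult G (zinv G (entry c' d)) g)) c" (is ?A)
    and "cone_star D (conn_cone D \<Delta> (D.ob d') (C.ob c))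
        (epi_part D (transpose D \<Delta> (C.ob c') (D.ob d) (C.ob c) (D.ob d') (C.ar c' g c))) =
      D.cone (D.scale (col Pt c) (zmult G (zinv G (entry c' d)) g)) d" (is ?B)
proof -
  have o: "c \<in> with_zero L" "d \<in> with_zero I" "c' \<in> with_zero L" "d' \<in> with_zero I" "g \<in> C.K"
    using assms by (auto simp: linked_def zarr_def)
  have K: "entry c' d \<in> C.K" "entry c d' \<in> C.K" using entry_closed o by auto
  note i = C.idem_tupleD[OF conn_cone_Gamma(2)[OF c'd]]
  show ?A
    unfolding conn_cone_Gamma(1)[OF c'd] C.cone_star_cone[OF i(1,3) g]
    using C.scale_assoc[OF tuple_col[OF o(2)]] o K by simp
  note j = D.idem_tupleD[OF conn_cone_Delta(2)[OF cd']]
  define k where "k = zmult G (zmult G (zinv G (entry c' d)) g) (entry c d')"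
  have k: "(d', k, d) \<in> zarr (opp G) I" "k \<in> C.K"
    using transpose_eq(2)[OF assms] by (auto simp: k_def zarr_def)
  have "cone_star D (conn_cone D \<Delta> (D.ob d') (C.ob c))
        (epi_part D (transpose D \<Delta> (C.ob c') (D.ob d) (C.ob c) (D.ob d') (C.ar c' g c))) =
      D.cone (D.scale (D.scale (col Pt c) (zinv G (entry c d'))) k) d"
    unfolding transpose_eq(1)[OF assms] k_def[symmetric] conn_cone_Delta(1)[OF cd']
        D.cone_star_cone[OF j(1,3) k(1)] ..
  also have "\<dots> = D.cone (D.scale (col Pt c) (zmult G (zinv G (entry c' d)) g)) d"
  proof (cases c)
    case None
    then show ?thesis by (intro D.cone_cong) (simp add: col_def)
  next
    case (Some l)
    then have "entry c d' \<noteq> None" using cd' by (auto simp: linked_def)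
    then have "zmult G k (zinv G (entry c d')) = zmult G (zinv G (entry c' d)) g"
      using K o by (auto simp: k_def C.zmult_assoc C.zinv_zmult)
    then show ?thesis
      using D.scale_assoc[OF T.tuple_col[OF o(1)], of "zinv G (entry c d')" k d] K k(2)
          by (simp add: zmult_opp)
  qed
  finally show ?B .
qed

lemma linked_left: "d \<in> with_zero I \<Longrightarrow> \<exists>c. linked c d"
  using P_col by (cases d) (force simp: linked_def intro: exI[of _ "Some _"])+

lemma linked_right: "c \<in> with_zero L \<Longrightarrow> \<exists>d. linked c d"
  using P_row by (cases c) (force simp: linked_def intro: exI[of _ "Some _"])+

text \<open>The value does not depend on c', d' and f: they enter both cones through one common
  scalar, which the first cone determines by cancellation unless c or d is 0, where all values are
  zero cones.\<close>

lemma chi_cone: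
  assumes o: "c \<in> with_zero L" "d \<in> with_zero I" and a: "a \<in> C.K"
  shows "chi C D \<Gamma> \<Delta> (C.ob c) (D.ob d) (C.cone (C.scale (col P d) a) c) =
      D.cone (D.scale (col Pt c) a) d"
  unfolding chi_def
proof (rule the_equality)
  obtain c' where c': "linked c' d" using linked_left o by blast
  obtain d' where d': "linked c d'" using linked_right o by blast
  have o': "c' \<in> with_zero L" "d' \<in> with_zero I" using c' d' by (auto simp: linked_def)
  have K: "entry c' d \<in> C.K" using entry_closed o o' by auto
  \<comment> \<open>The label for which p(c',d)^-1 g equals a. When c or d is 0 it has to be 0, and
    the scalar has no effect on either cone.\<close>
  define g where "g = (if c = None \<or> d = None then None else zmult G (entry c' d) a)"
  have g: "(c', g, c) \<in> zarr G L" using o o' a K c' by (auto simp: g_def zarr_def linked_def)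
  have 1: "C.cone (C.scale (col P d) a) c =
      C.cone (C.scale (col P d) (zmult G (zinv G (entry c' d)) g)) c \<and>
     D.cone (D.scale (col Pt c) a) d = D.cone (D.scale (col Pt c) (zmult G (zinv G (entry c' d)) g))
         d"
  proof (cases "c = None \<or> d = None")
    case True
    then show ?thesis by (intro conjI C.cone_zero_eq D.cone_zero_eq) (auto simp: col_def)
  next
    case False
    then have "entry c' d \<noteq> None" using c' by (auto simp: linked_def)
    then have "zmult G (zmult G (zinv G (entry c' d)) (entry c' d)) a = a" using a K
        by (auto simp: C.zinv_zmult)
    then have "zmult G (zinv G (entry c' d)) g = a" using False a K
        by (auto simp: g_def C.zmult_assoc)
    then show ?thesis by simp
  qed
  show "\<exists>x y f. x \<in> MH C (FObj \<Gamma> (D.ob d)) \<and> y \<in> MH D (FObj \<Delta> (C.ob c)) \<and> f \<in> mor C x (C.ob c) \<and>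
     C.cone (C.scale (col P d) a) c = cone_star C (conn_cone C \<Gamma> x (D.ob d)) (epi_part C f) \<and>
     D.cone (D.scale (col Pt c) a) d =
       cone_star D (conn_cone D \<Delta> y (C.ob c)) (epi_part D (transpose D \<Delta> x (D.ob d) (C.ob c) y f))"
    by (rule exI[of _ "C.ob c'"], rule exI[of _ "D.ob d'"], rule exI[of _ "C.ar c' g c"])
      (use MH_Gamma MH_Delta o o' c' d' g linked_cones[OF c' d' g] 1 in \<open>simp add: C.ar_in_mor\<close>)
  fix w
  assume "\<exists>x y f. x \<in> MH C (FObj \<Gamma> (D.ob d)) \<and> y \<in> MH D (FObj \<Delta> (C.ob c)) \<and> f \<in> mor C x (C.ob c) \<and>
     C.cone (C.scale (col P d) a) c = cone_star C (conn_cone C \<Gamma> x (D.ob d)) (epi_part C f) \<and>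
     w = cone_star D (conn_cone D \<Delta> y (C.ob c)) (epi_part D (transpose D \<Delta> x (D.ob d) (C.ob c) y
         f))"
  then obtain x y f where x: "x \<in> MH C (FObj \<Gamma> (D.ob d))" and y: "y \<in> MH D (FObj \<Delta> (C.ob c))"
    and f: "f \<in> mor C x (C.ob c)"
    and eq: "C.cone (C.scale (col P d) a) c = cone_star C (conn_cone C \<Gamma> x (D.ob d)) (epi_part C f)"
    and w: "w = cone_star D (conn_cone D \<Delta> y (C.ob c)) (epi_part D (transpose D \<Delta> x (D.ob d) (C.ob
        c) y f))"
    by blast
  obtain c1 where c1: "c1 \<in> with_zero L" "x = C.ob c1" using x by (auto simp: MH_def elim: C.ObjE)
  obtain d1 where d1: "d1 \<in> with_zero I" "y = D.ob d1" using y by (auto simp: MH_def elim: D.ObjE)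
  have l: "linked c1 d" "linked c d1" using x y c1 d1 MH_Gamma MH_Delta o by auto
  obtain h where h: "(c1, h, c) \<in> zarr G L" "f = C.ar c1 h c" using f c1 o by (auto simp: C.mor_eq)
  define b where "b = zmult G (zinv G (entry c1 d)) h"
  have b: "b \<in> C.K" using h c1 o entry_closed by (auto simp: b_def zarr_def)
  have w': "w = D.cone (D.scale (col Pt c) b) d"
    unfolding w c1(2) d1(2) h(2) linked_cones(2)[OF l h(1)] b_def ..
  have eq': "C.cone (C.scale (col P d) a) c = C.cone (C.scale (col P d) b) c"
    unfolding eq c1(2) h(2) linked_cones(1)[OF l h(1)] b_def ..
  show "w = D.cone (D.scale (col Pt c) a) d"
    unfolding w'
  proof (cases "c = None \<or> d = None")
    case True
    then show "D.cone (D.scale (col Pt c) b) d = D.cone (D.scale (col Pt c) a) d"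
      by (intro D.cone_zero_eq) (auto simp: col_def)
  next
    case False
    then have "a = b"
      using C.cone_scale_inj[OF tuple_col[OF o(2)] _ a b o(1) _ eq'] nonzero_col[OF o(2)] by blast
    then show "D.cone (D.scale (col Pt c) b) d = D.cone (D.scale (col Pt c) a) d" by simp
  qed
qed

section \<open>Parametrisation of the linked pairs by the Rees matrix semigroup\<close>

definition pair_cone :: "('i \<times> 'g \<times> 'l) option \<Rightarrow> ('o \<Rightarrow> 'm) \<times> ('p \<Rightarrow> 'n)" where
  "pair_cone x = (case x of None \<Rightarrow> (C.cone (\<lambda>_. None) None, D.cone (\<lambda>_. None) None)
     | Some (i, a, l) \<Rightarrow> (C.cone (C.scale (col P (Some i)) (Some a)) (Some l),
                         D.cone (D.scale (col Pt (Some l)) (Some a)) (Some i)))"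

text \<open>By \<open>chi_cone\<close>, a linked pair at (c, d) is given by one scalar a. If one of
  c, d, a is 0, both cones are zero cones, so all these cases collapse to the single zero
  element.\<close>

lemma carrier_cc: "carrier (cc_semigroup C D \<Gamma> \<Delta>) = pair_cone ` carrier (rees G I L P)"
proof
  show "carrier (cc_semigroup C D \<Gamma> \<Delta>) \<subseteq> pair_cone ` carrier (rees G I L P)"
  proof
    fix z assume "z \<in> carrier (cc_semigroup C D \<Gamma> \<Delta>)"
    then obtain \<gamma> \<delta> c d where z: "z = (\<gamma>, \<delta>)" and o: "c \<in> with_zero L" "d \<in> with_zero I"
      and m: "\<gamma> \<in> SObj (FObj \<Gamma> (D.ob d)) (C.ob c)" "\<delta> = chi C D \<Gamma> \<Delta> (C.ob c) (D.ob d) \<gamma>"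
      by (auto simp: cc_semigroup_def elim!: C.ObjE D.ObjE)
    from m(1) obtain a where a: "a \<in> C.K" "\<gamma> = C.cone (C.scale (col P d) a) c"
      using C.is_HD(3)[OF Gamma_is_H[OF \<Gamma> o(2)] o(1)] by auto
    have \<delta>: "\<delta> = D.cone (D.scale (col Pt c) a) d" unfolding m(2) a(2) by (rule chi_cone[OF o a(1)])
    show "z \<in> pair_cone ` carrier (rees G I L P)"
    proof (cases "c = None \<or> d = None \<or> a = None")
      case True
      have "\<gamma> = C.cone (\<lambda>_. None) None"
        unfolding a(2) by (rule C.cone_zero) (use True in \<open>auto simp: col_def\<close>)
      moreover have "\<delta> = D.cone (\<lambda>_. None) None"
        unfolding \<delta> by (rule D.cone_zero) (use True in \<open>auto simp: col_def\<close>)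
      ultimately have "z = pair_cone None" by (simp add: z pair_cone_def)
      then show ?thesis by (simp add: rees_def)
    next
      case False
      then obtain l i x where "c = Some l" "d = Some i" "a = Some x" by auto
      then have "z = pair_cone (Some (i, x, l))" "Some (i, x, l) \<in> carrier (rees G I L P)"
        using o a \<delta> by (auto simp: z pair_cone_def rees_def)
      then show ?thesis by blast
    qed
  qed
  have main: "(C.cone (C.scale (col P d) a) c,
      D.cone (D.scale (col Pt c) a) d) \<in> carrier (cc_semigroup C D \<Gamma> \<Delta>)"
    if o: "c \<in> with_zero L" "d \<in> with_zero I" and a: "a \<in> C.K" for c d a
  proof -
    have "C.tuple (C.scale (col P d) a)" "D.tuple (D.scale (col Pt c) a)"
      using tuple_col[OF o(2)] T.tuple_col[OF o(1)] a by (auto simp: zmult_opp)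
    then have "C.cone (C.scale (col P d) a) c \<in> cones C" "D.cone (D.scale (col Pt c) a) d \<in> cones D"
      by (intro C.cone_in_cones D.cone_in_cones; use o in simp)+
    moreover have "C.cone (C.scale (col P d) a) c \<in> SObj (FObj \<Gamma> (D.ob d)) (C.ob c)"
      using C.is_HD(3)[OF Gamma_is_H[OF \<Gamma> o(2)] o(1)] a by auto
    moreover have "C.ob c \<in> Obj C" "D.ob d \<in> Obj D" using o by auto
    ultimately show ?thesis
      unfolding cc_semigroup_def using chi_cone[OF o a]
      by (auto intro!: bexI[of _ "C.ob c"] bexI[of _ "D.ob d"])
  qed
  show "pair_cone ` carrier (rees G I L P) \<subseteq> carrier (cc_semigroup C D \<Gamma> \<Delta>)"
  proof
    fix z assume "z \<in> pair_cone ` carrier (rees G I L P)"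
    then consider "z = pair_cone None" | i a l
        where "z = pair_cone (Some (i, a, l))" "i \<in> I" "a \<in> carrier G" "l \<in> L"
      by (auto simp: rees_def with_zero_def)
    then show "z \<in> carrier (cc_semigroup C D \<Gamma> \<Delta>)"
    proof cases
      case 1
      have "C.cone (C.scale (col P None) None) None = C.cone (\<lambda>_. None) None"
        "D.cone (D.scale (col Pt None) None) None = D.cone (\<lambda>_. None) None" by simp_all
      with main[of None None None] show ?thesis by (simp add: 1 pair_cone_def)
    next
      case 2
      with main[of "Some l" "Some i" "Some a"] show ?thesis by (simp add: pair_cone_def)
    qed
  qed
qed

lemma scaled_col:
  assumes "i \<in> I" "a \<in> carrier G" "l \<in> L"
  shows "C.nonzero (C.scale (col P (Some i)) (Some a))"
      "D.nonzero (D.scale (col Pt (Some l)) (Some a))"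
    "C.tuple (C.scale (col P (Some i)) (Some a))" "D.tuple (D.scale (col Pt (Some l)) (Some a))"
  using assms nonzero_col[of "Some i"] T.nonzero_col[of "Some l"] tuple_col[of
      "Some i"] T.tuple_col[of "Some l"]
  by (auto simp: zmult_opp)

text \<open>The apex of the first cone gives l, that of the second gives i, and then cancellation
  gives a. The second cone is essential: for proportional columns, different i can share the same
  first cone.\<close>

lemma pair_cone_inj: "inj_on pair_cone (carrier (rees G I L P))"
proof (rule inj_onI)
  note nz = scaled_col
  have ne: "pair_cone (Some (i, a, l)) \<noteq> pair_cone None" if m: "i \<in> I" "a \<in> carrier G" "l \<in> L"
      for i a l
  proof
    assume "pair_cone (Some (i, a, l)) = pair_cone None"
    then have e: "C.cone (C.scale (col P (Some i)) (Some a)) (Some l) = C.cone (\<lambda>_. None) None"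
      by (simp add: pair_cone_def)
    show False using C.cone_eq_zeroD[OF e nz(3)[OF m]] nz(1)[OF m] m by auto
  qed
  have eq: "i = j \<and> a = b \<and> l = k" if e: "pair_cone (Some (i, a, l)) = pair_cone (Some (j, b, k))"
    and m: "i \<in> I" "a \<in> carrier G" "l \<in> L" and m': "j \<in> I" "b \<in> carrier G" "k \<in> L" for i a l j b k
  proof -
    have e1: "C.cone (C.scale (col P (Some i)) (Some a)) (Some l) =
        C.cone (C.scale (col P (Some j)) (Some b)) (Some k)"
      and e2: "D.cone (D.scale (col Pt (Some l)) (Some a)) (Some i) =
          D.cone (D.scale (col Pt (Some k)) (Some b)) (Some j)"
      using e by (auto simp: pair_cone_def)
    have "Some l = Some k"
      by (rule C.cone_eqD(1)[OF e1 nz(3)[OF m] nz(3)[OF m'] _ _ _ nz(1)[OF m]]) (use m m' in auto)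
    moreover have "Some i = Some j"
      by (rule D.cone_eqD(1)[OF e2 nz(4)[OF m] nz(4)[OF m'] _ _ _ nz(2)[OF m]]) (use m m' in auto)
    moreover have "Some a = Some b"
      by (rule C.cone_scale_inj[of "col P (Some i)" _ _ "Some l"])
        (use e1 calculation m m' tuple_col[of "Some i"] nonzero_col[of "Some i"] in auto)
    ultimately show ?thesis by simp
  qed
  fix x y assume "x \<in> carrier (rees G I L P)" "y \<in> carrier (rees G I L P)"
      "pair_cone x = pair_cone y"
  then show "x = y"
    using ne ne[symmetric] eq by (auto simp: rees_def with_zero_def)
qed

text \<open>With p = \<open>P l j\<close>, the first cones multiply to the column of i times a(pb),
  and the second, in reversed order, to (ap)b times the row of k. The parameters agree by
  associativity, and the apexes are k and i. If p = 0 both are zero cones.\<close>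

lemma pair_cone_mult:
  assumes "x \<in> carrier (rees G I L P)" "y \<in> carrier (rees G I L P)"
  shows "pair_cone (x \<cdot>\<^bsub>rees G I L P\<^esub> y) = pair_cone x \<cdot>\<^bsub>cc_semigroup C D \<Gamma> \<Delta>\<^esub> pair_cone y"
proof -
  define t where "t x =
      (case x of None \<Rightarrow> \<lambda>_. None | Some (i, a, l) \<Rightarrow> C.scale (col P (Some i)) (Some a))"
    for x :: "('i \<times> 'g \<times> 'l) option"
  define s where "s x =
      (case x of None \<Rightarrow> \<lambda>_. None | Some (i, a, l) \<Rightarrow> D.scale (col Pt (Some l)) (Some a))"
    for x :: "('i \<times> 'g \<times> 'l) option"
  define left where "left x = map_option (\<lambda>(i, a, l). i) x" for x :: "('i \<times> 'g \<times> 'l) option"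
  define right where "right x = map_option (\<lambda>(i, a, l). l) x" for x :: "('i \<times> 'g \<times> 'l) option"
  have pc: "pair_cone x = (C.cone (t x) (right x), D.cone (s x) (left x))" for x
    by (auto simp: pair_cone_def t_def s_def left_def right_def split: option.splits)
  have D: "C.tuple (t x)" "right x \<in> with_zero L" "C.nonzero (t x) \<longleftrightarrow> right x \<noteq> None"
    "D.tuple (s x)" "left x \<in> with_zero I" "D.nonzero (s x) \<longleftrightarrow> left x \<noteq> None"
    if "x \<in> carrier (rees G I L P)" for x
  proof -
    from that consider "x = None" | i a l where "x = Some (i, a, l)" "i \<in> I" "a \<in> carrier G" "l \<in> L"
      by (auto simp: rees_def with_zero_def)
    then have "C.tuple (t x) \<and> right x \<in> with_zero L \<and> (C.nonzero (t x) \<longleftrightarrow> right x \<noteq> None) \<and>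
      D.tuple (s x) \<and> left x \<in> with_zero I \<and> (D.nonzero (s x) \<longleftrightarrow> left x \<noteq> None)"
    proof cases
      case 2
      note sc = scaled_col[OF 2(2-4)]
      have "t x = C.scale (col P (Some i)) (Some a)" "s x = D.scale (col Pt (Some l)) (Some a)"
        "left x = Some i" "right x = Some l"
        using 2 by (simp_all add: t_def s_def left_def right_def)
      then show ?thesis using sc 2 by auto
    qed (simp add: t_def s_def left_def right_def)
    then show "C.tuple (t x)" "right x \<in> with_zero L" "C.nonzero (t x) \<longleftrightarrow> right x \<noteq> None"
      "D.tuple (s x)" "left x \<in> with_zero I" "D.nonzero (s x) \<longleftrightarrow> left x \<noteq> None"
      by blast+
  qed
  have "pair_cone x \<cdot>\<^bsub>cc_semigroup C D \<Gamma> \<Delta>\<^esub> pair_cone y =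
      (C.cone (C.scale (t x) (C.label (t y) (right x))) (right y),
       D.cone (D.scale (s y) (D.label (s x) (left y))) (left x))"
    unfolding pc using C.cone_mult_cone[OF D(1-3)[OF assms(1)] D(1-3)[OF assms(2)]]
      D.cone_mult_cone[OF D(4-6)[OF assms(2)] D(4-6)[OF assms(1)]]
    by (simp add: cc_semigroup_def)
  also have "\<dots> = pair_cone (x \<cdot>\<^bsub>rees G I L P\<^esub> y)"
  proof (cases "x = None \<or> y = None")
    case True
    have 1: "C.cone (C.scale (t x) (C.label (t y) (right x))) (right y) = C.cone (\<lambda>_. None) None"
      by (rule C.cone_zero) (use True in \<open>auto simp: t_def right_def\<close>)
    have 2: "D.cone (D.scale (s y) (D.label (s x) (left y))) (left x) = D.cone (\<lambda>_. None) None"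
      by (rule D.cone_zero) (use True in \<open>auto simp: s_def left_def\<close>)
    have "x \<cdot>\<^bsub>rees G I L P\<^esub> y = None" using True by (auto simp: rees_def split: option.splits)
    then show ?thesis unfolding 1 2 by (simp add: pair_cone_def)
  next
    case False
    then obtain i a l j b k where xy: "x = Some (i, a, l)" "y = Some (j, b, k)" by auto
    then have m: "i \<in> I" "a \<in> carrier G" "l \<in> L" "j \<in> I" "b \<in> carrier G" "k \<in> L"
      using assms by (auto simp: rees_def)
    have t: "C.tuple (col P (Some i))" "D.tuple (col Pt (Some k))" using m tuple_col T.tuple_col
        by auto
    have K: "P l j \<in> C.K" using P_closed m by auto
    have "C.cone (C.scale (t x) (C.label (t y) (right x))) (right y) =
        C.cone (C.scale (col P (Some i)) (zmult G (Some a) (zmult G (P l j) (Some b)))) (Some k)"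
      using m K C.scale_assoc[OF t(1), of "Some a" "zmult G (P l j) (Some b)"]
      by (simp add: xy t_def right_def col_def)
    moreover have "D.cone (D.scale (s y) (D.label (s x) (left y))) (left x) =
        D.cone (D.scale (col Pt (Some k)) (zmult G (zmult G (Some a) (P l j)) (Some b))) (Some i)"
      using m K D.scale_assoc[OF t(2), of "Some b" "zmult G (Some a) (P l j)"]
      by (simp add: xy s_def left_def col_def zmult_opp)
    moreover have "zmult G (Some a) (zmult G (P l j) (Some b)) =
        zmult G (zmult G (Some a) (P l j)) (Some b)"
      using m K by (simp add: C.zmult_assoc)
    moreover have "pair_cone (x \<cdot>\<^bsub>rees G I L P\<^esub> y) =
        (C.cone (C.scale (col P (Some i)) (zmult G (zmult G (Some a) (P l j)) (Some b))) (Some k),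
         D.cone (D.scale (col Pt (Some k)) (zmult G (zmult G (Some a) (P l j)) (Some b))) (Some i))"
    proof (cases "P l j")
      case None
      then show ?thesis
        using C.cone_zero[of "Some k" "\<lambda>_. None"] D.cone_zero[of "Some i" "\<lambda>_. None"]
        by (simp add: xy rees_def pair_cone_def)
    next
      case (Some p)
      then show ?thesis by (simp add: xy rees_def pair_cone_def)
    qed
    ultimately show ?thesis by simp
  qed
  finally show ?thesis ..
qed

lemma cc_semigroup_isomorphic: "sgrp_isomorphic (cc_semigroup C D \<Gamma> \<Delta>) (rees G I L P)"
proof -
  let ?R = "rees G I L P"
  let ?\<phi> = "inv_into (carrier ?R) pair_cone"
  have closed: "x \<cdot>\<^bsub>?R\<^esub> y \<in> carrier ?R" if "x \<in> carrier ?R" "y \<in> carrier ?R" for x y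
    using rees_closed[OF C.group_axioms] P_closed that by blast
  have "bij_betw pair_cone (carrier ?R) (carrier (cc_semigroup C D \<Gamma> \<Delta>))"
    using pair_cone_inj carrier_cc by (simp add: bij_betw_def)
  then have "bij_betw ?\<phi> (carrier (cc_semigroup C D \<Gamma> \<Delta>)) (carrier ?R)" by (rule bij_betw_inv_into)
  moreover have "?\<phi> (u \<cdot>\<^bsub>cc_semigroup C D \<Gamma> \<Delta>\<^esub> v) = ?\<phi> u \<cdot>\<^bsub>?R\<^esub> ?\<phi> v"
    if uv: "u \<in> carrier (cc_semigroup C D \<Gamma> \<Delta>)" "v \<in> carrier (cc_semigroup C D \<Gamma> \<Delta>)" for u v
  proof -
    obtain x y where xy: "x \<in> carrier ?R" "u = pair_cone x" "y \<in> carrier ?R" "v = pair_cone y"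
      using uv unfolding carrier_cc by auto
    show ?thesis
      unfolding xy(2,4) pair_cone_mult[OF xy(1,3), symmetric]
      using xy closed[OF xy(1,3)] by (simp add: inv_into_f_f[OF pair_cone_inj])
  qed
  ultimately show ?thesis unfolding sgrp_isomorphic_def by blast
qed

end

end

section \<open>Complete 0-simplicity of a Rees matrix semigroup\<close>

locale rees_matrix = group G for G (structure) +
  fixes I :: "'i set" and L :: "'l set" and P :: "'l \<Rightarrow> 'i \<Rightarrow> 'a option"
  assumes I_nonempty: "I \<noteq> {}" and L_nonempty: "L \<noteq> {}" and regular: "regular_matrix G I L P"
begin

abbreviation S :: "('i \<times> 'a \<times> 'l) option sgrp" where "S \<equiv> rees G I L P"

lemma entry_closed: "l \<in> L \<Longrightarrow> i \<in> I \<Longrightarrow> P l i = Some p \<Longrightarrow> p \<in> carrier G"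
  using regular unfolding regular_matrix_def by (metis Some_with_zero)

lemma rowE: assumes "l \<in> L" obtains i p where "i \<in> I" "P l i = Some p" "p \<in> carrier G"
  using assms regular entry_closed unfolding regular_matrix_def by (metis not_None_eq)

lemma colE: assumes "i \<in> I" obtains l p where "l \<in> L" "P l i = Some p" "p \<in> carrier G"
  using assms regular entry_closed unfolding regular_matrix_def by (metis not_None_eq)

lemma rees_semigroup: "is_semigroup S"
  unfolding is_semigroup_def
proof (intro conjI ballI)
  fix x y z assume xyz: "x \<in> carrier S" "y \<in> carrier S" "z \<in> carrier S"
  show "x \<cdot>\<^bsub>S\<^esub> y \<in> carrier S" using rees_closed[OF group_axioms _ xyz(1,2)] regular
      by (simp add: regular_matrix_def)
  show "x \<cdot>\<^bsub>S\<^esub> y \<cdot>\<^bsub>S\<^esub> z = x \<cdot>\<^bsub>S\<^esub> (y \<cdot>\<^bsub>S\<^esub> z)"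
  proof (cases "x = None \<or> y = None \<or> z = None")
    case False
    then obtain i a l j b k m c n
        where *: "x = Some (i, a, l)" "y = Some (j, b, k)" "z = Some (m, c, n)" by auto
    with xyz show ?thesis
      by (cases "P l j"; cases "P k m") (auto simp: m_assoc entry_closed)
  qed auto
qed

text \<open>A nonzero triple (i, a, l) squares to itself exactly when apa = a for the entry p at (l,
  i); cancelling gives a = p^-1.\<close>

lemma idems_rees: "idems S = insert None {Some (i, inv p, l) | i l p. i \<in> I \<and> l \<in> L \<and> P l i =
    Some p}"
proof (intro equalityI subsetI)
  fix e assume "e \<in> idems S"
  then have e: "e \<in> carrier S" "e \<cdot>\<^bsub>S\<^esub> e = e" by (auto simp: idems_def)
  from e(1) show "e \<in> insert None {Some (i, inv p, l) | i l p. i \<in> I \<and> l \<in> L \<and> P l i = Some p}"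
  proof (cases rule: rees_carrierE)
    case (2 i a l)
    with e obtain p where p: "P l i = Some p" "a \<otimes> p \<otimes> a = a" by (auto split: option.splits)
    have pG: "p \<in> carrier G" using entry_closed 2 p by blast
    have "a \<otimes> p = \<one>" using p(2) pG 2 by (metis m_closed r_cancel_one)
    then have "a = inv p" using pG 2 by (metis inv_equality)
    then show ?thesis using 2 p by auto
  qed simp
next
  fix e assume "e \<in> insert None {Some (i, inv p, l) | i l p. i \<in> I \<and> l \<in> L \<and> P l i = Some p}"
  then show "e \<in> idems S" by (auto simp: idems_def entry_closed)
qed

text \<open>Regularity gives every nonzero element a nonzero product on either side with suitable
  elements, and group inverses adjust the middle coordinate, so a nonzero ideal is everything. Any
  nonzero idempotent is primitive.\<close>

lemma completely_0_simple_rees: "completely_0_simple S"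
proof -
  obtain l where l: "l \<in> L" using L_nonempty by auto
  obtain i p where i: "i \<in> I" "P l i = Some p" "p \<in> carrier G" using rowE[OF l] .
  let ?e = "Some (i, inv p, l)"
  have e: "?e \<in> idems S" "?e \<in> carrier S" "?e \<cdot>\<^bsub>S\<^esub> ?e = ?e"
    using i l by (auto simp: idems_rees)
  have "A = {None} \<or> A = carrier S" if A: "is_ideal S A" for A
  proof (cases "A \<subseteq> {None}")
    case True
    then show ?thesis using A by (auto simp: is_ideal_def)
  next
    case False
    then obtain x where x: "x \<in> A" "x \<noteq> None" by blast
    have sub: "A \<subseteq> carrier S" and id: "\<And>a x. a \<in> A \<Longrightarrow> x \<in> carrier S \<Longrightarrow> a \<cdot>\<^bsub>S\<^esub> x \<in> A \<and> x \<cdot>\<^bsub>S\<^esub> a \<in> A"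
      using A by (auto simp: is_ideal_def)
    have "x \<in> carrier S" using sub x by blast
    then obtain i a l where xs: "x = Some (i, a, l)" "i \<in> I" "a \<in> carrier G" "l \<in> L"
      using x(2) by (auto elim: rees_carrierE)
    obtain l' p where l': "l' \<in> L" "P l' i = Some p" "p \<in> carrier G" using colE[OF xs(2)] .
    obtain i' q where i': "i' \<in> I" "P l i' = Some q" "q \<in> carrier G" using rowE[OF xs(4)] .
    have "y \<in> A" if y: "y \<in> carrier S" for y
      using y
    proof (cases rule: rees_carrierE)
      case 1
      then show ?thesis using id[OF x(1), of None] by simp
    next
      case (2 j b k)
      \<comment> \<open>Multiplying on the left through a nonzero entry of column i replaces the
        first index by j.\<close>
      have 1: "Some (j, b \<otimes> p \<otimes> a, l) \<in> A"
        using id[OF x(1), of "Some (j, b, l')"] 2 l' xs by simp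
      \<comment> \<open>The middle coordinate accumulated before the last factor; the factor u^-1 b
        on the right then turns it into b.\<close>
      define u where "u = b \<otimes> p \<otimes> a \<otimes> q"
      have u: "u \<in> carrier G" using 2 l' i' xs by (simp add: u_def)
      have "Some (j, u \<otimes> (inv u \<otimes> b), k) \<in> A"
        using id[OF 1, of "Some (i', inv u \<otimes> b, k)"] 2 i' u by (simp add: u_def)
      moreover have "u \<otimes> (inv u \<otimes> b) = b" using u 2 by (simp flip: m_assoc)
      ultimately show ?thesis using 2 by simp
    qed
    then show ?thesis using sub by blast
  qed
  moreover have "is_zero S None" by (simp add: is_zero_def)
  ultimately have "zero_simple S None"
    unfolding zero_simple_def using rees_semigroup e by (metis option.distinct(1))
  moreover have "primitive_idem S None ?e"
    unfolding primitive_idem_def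
  proof (intro conjI ballI impI)
    \<comment> \<open>The two equations force f to have the indices of the given idempotent, and its
      middle coordinate is then the inverse of the same entry.\<close>
    fix f assume f: "f \<in> idems S" "f \<noteq> None \<and> ?e \<cdot>\<^bsub>S\<^esub> f = f \<and> f \<cdot>\<^bsub>S\<^esub> ?e = f"
    then obtain j k q where "f = Some (j, inv q, k)" "P k j = Some q" unfolding idems_rees by auto
    with f(2) i show "f = ?e" by (auto split: option.splits)
  qed (use e in auto)
  ultimately show ?thesis unfolding completely_0_simple_def by blast
qed

end

section \<open>Coordinates for categories of ideals\<close>

lemma Arr_ideal_cat: "Arr (ideal_cat Os As) = As"
  by (simp add: ideal_cat_def)

text \<open>The condition on \<open>\<subseteq>\<close> does double duty: applied both ways it makes
  the object map injective, and it shows which pairs carry inclusion maps. The condition on units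
  covers inclusions out of the zero ideal together with identities.\<close>

lemma coordinatised_ideal_cat:
  assumes "group G" and FArr: "\<And>c h d. FArr \<Phi> (c, h, d) = (FObj \<Phi> c, act c h d, FObj \<Phi> d)"
    and sub: "\<And>c d. c \<in> with_zero L \<Longrightarrow> d \<in> with_zero L \<Longrightarrow> FObj \<Phi> c \<subseteq> FObj \<Phi> d \<longleftrightarrow> c = None \<or> c = d"
    and inj: "\<And>c h h' d. (c, h, d) \<in> zarr G L \<Longrightarrow> (c, h', d) \<in> zarr G L \<Longrightarrow> act c h d = act c h' d \<Longrightarrow> h =
        h'"
    and id: "\<And>c d. c \<in> with_zero L \<Longrightarrow> d \<in> with_zero L \<Longrightarrow> c = None \<or> c = d \<Longrightarrow>
      act c (if c = None then None else Some \<one>\<^bsub>G\<^esub>) d = (\<lambda>x\<in>FObj \<Phi> c. x)"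
    and cmp: "\<And>a g b h c. (a, g, b) \<in> zarr G L \<Longrightarrow> (b, h, c) \<in> zarr G L \<Longrightarrow>
      act a (zmult G g h) c = compose (FObj \<Phi> a) (act b h c) (act a g b)"
  shows "coordinatised G L (ideal_cat (FObj \<Phi> ` with_zero L) (FArr \<Phi> ` zarr G L)) \<Phi>"
proof (intro coordinatised.intro coordinatised_axioms.intro)
  show "group G" by fact
  have ob: "c = d" if "c \<in> with_zero L" "d \<in> with_zero L" "FObj \<Phi> c = FObj \<Phi> d" for c d
    using sub[OF that(1,2)] sub[OF that(2,1)] that(3) by auto
  then show "inj_on (FObj \<Phi>) (with_zero L)" by (auto simp: inj_on_def)
  show "inj_on (FArr \<Phi>) (zarr G L)"
  proof (rule inj_onI, unfold split_paired_all)
    fix a g b a' g' b' assume z: "(a, g, b) \<in> zarr G L" "(a', g', b') \<in> zarr G L"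
      and eq: "FArr \<Phi> (a, g, b) = FArr \<Phi> (a', g', b')"
    then have "a = a'" "b = b'" using ob by (auto simp: FArr zarr_def)
    with z eq inj show "(a, g, b) = (a', g', b')" by (auto simp: FArr)
  qed
  show "Inc (ideal_cat (FObj \<Phi> ` with_zero L) (FArr \<Phi> ` zarr G L)) =
      FArr \<Phi> ` (zid G ` with_zero L \<union> {(None, None, Some l) | l. l \<in> L})" (is "?A = FArr \<Phi> ` ?B")
  proof (intro equalityI subsetI)
    fix f assume "f \<in> ?A"
    then obtain c d where cd: "c \<in> with_zero L" "d \<in> with_zero L"
        and f: "f = (FObj \<Phi> c, \<lambda>x\<in>FObj \<Phi> c. x, FObj \<Phi> d)"
      and "FObj \<Phi> c \<subseteq> FObj \<Phi> d" by (auto simp: ideal_cat_def)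
    then have c: "c = None \<or> c = d" using sub by blast
    have "f = FArr \<Phi> (c, if c = None then None else Some \<one>\<^bsub>G\<^esub>, d)"
      unfolding f FArr id[OF cd c] ..
    moreover have "(c, if c = None then None else Some \<one>\<^bsub>G\<^esub>, d) \<in> ?B"
      using c cd by (cases d) (auto simp: zid_def image_iff)
    ultimately show "f \<in> FArr \<Phi> ` ?B" by (rule image_eqI)
  next
    fix f assume "f \<in> FArr \<Phi> ` ?B"
    then consider c where "c \<in> with_zero L"
        "f = FArr \<Phi> (c, if c = None then None else Some \<one>\<^bsub>G\<^esub>, c)"
      | l where "l \<in> L" "f = FArr \<Phi> (None, None, Some l)" by (auto simp: zid_def)
    then show "f \<in> ?A"
    proof cases
      case 1
      then show ?thesis unfolding 1(2) FArr using id[of c c] by (simp add: ideal_cat_def)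
    next
      case 2
      then show ?thesis unfolding 2(2) FArr using id[of None "Some l"] sub[of None "Some l"]
          by (simp add: ideal_cat_def)
    qed
  qed
  fix a assume a: "a \<in> with_zero L"
  show "Id (ideal_cat (FObj \<Phi> ` with_zero L) (FArr \<Phi> ` zarr G L)) (FObj \<Phi> a) = FArr \<Phi> (zid G a)"
    unfolding zid_def FArr using id[OF a a] by (simp add: ideal_cat_def)
qed (simp_all add: ideal_cat_def FArr cmp)

section \<open>Principal ideals of a Rees matrix semigroup and the maps between them\<close>

context rees_matrix
begin

lemma obL_iff [simp]: "None \<in> obL G I c" "Some (i, a, l) \<in> obL G I c \<longleftrightarrow> i \<in> I \<and> a \<in> carrier G \<and> c =
    Some l"
  by (auto simp: obL_def)

lemma obR_iff [simp]: "None \<in> obR G L c" "Some (i, a, l) \<in> obR G L c \<longleftrightarrow> l \<in> L \<and> a \<in> carrier G \<and> c =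
    Some i"
  by (auto simp: obR_def)

lemma obLE:
  assumes "x \<in> obL G I c"
  obtains "x = None" | i a l where "x = Some (i, a, l)" "i \<in> I" "a \<in> carrier G" "c = Some l"
  using assms by (auto simp: obL_def)

lemma obRE:
  assumes "x \<in> obR G L c"
  obtains "x = None" | i a l where "x = Some (i, a, l)" "l \<in> L" "a \<in> carrier G" "c = Some i"
  using assms by (auto simp: obR_def)

lemma left_ideal_None: "left_ideal S None = obL G I None"
  by (auto simp: left_ideal_def obL_def intro: exI[of _ None])

lemma right_ideal_None: "right_ideal S None = obR G L None"
  by (auto simp: right_ideal_def obR_def intro: exI[of _ None])

text \<open>Multiplication by the idempotent fixes the last index to l, and the idempotent is a
  right identity on all elements with that index.\<close>

lemma left_ideal_Some:
  assumes "i \<in> I" "l \<in> L" "P l i = Some p"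
  shows "left_ideal S (Some (i, inv p, l)) = obL G I (Some l)"
proof (intro equalityI subsetI)
  have p: "p \<in> carrier G" using entry_closed assms by blast
  fix y assume "y \<in> left_ideal S (Some (i, inv p, l))"
  then show "y \<in> obL G I (Some l)"
    using assms p by (auto simp: left_ideal_def entry_closed elim!: rees_carrierE split:
        option.splits)
next
  have p: "p \<in> carrier G" using entry_closed assms by blast
  fix y assume y: "y \<in> obL G I (Some l)"
  then have "y \<in> carrier S" "y = y \<cdot>\<^bsub>S\<^esub> Some (i, inv p, l)"
    using assms p by (auto elim!: obLE simp: m_assoc)
  then show "y \<in> left_ideal S (Some (i, inv p, l))" unfolding left_ideal_def by blast
qed

lemma right_ideal_Some:
  assumes "i \<in> I" "l \<in> L" "P l i = Some p"
  shows "right_ideal S (Some (i, inv p, l)) = obR G L (Some i)"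
proof (intro equalityI subsetI)
  have p: "p \<in> carrier G" using entry_closed assms by blast
  fix y assume "y \<in> right_ideal S (Some (i, inv p, l))"
  then show "y \<in> obR G L (Some i)"
    using assms p by (auto simp: right_ideal_def entry_closed elim!: rees_carrierE split:
        option.splits)
next
  have p: "p \<in> carrier G" using entry_closed assms by blast
  fix y assume y: "y \<in> obR G L (Some i)"
  then have "y \<in> carrier S" "y = Some (i, inv p, l) \<cdot>\<^bsub>S\<^esub> y"
    using assms p by (auto elim!: obRE)
  then show "y \<in> right_ideal S (Some (i, inv p, l))" unfolding right_ideal_def by blast
qed

lemma local_part_None: "local_part S None f = {None}" "local_part S e None = {None}"
  by (auto simp: local_part_def intro: exI[of _ None])

text \<open>The two idempotents act as left and right identity on the triples with first index i and
  last index k, and every nonzero product eSf has this form.\<close>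

lemma local_part_Some:
  assumes "i \<in> I" "l \<in> L" "P l i = Some p" "j \<in> I" "k \<in> L" "P k j = Some q"
  shows "local_part S (Some (i, inv p, l)) (Some (j, inv q, k)) =
      insert None {Some (i, g, k) | g. g \<in> carrier G}"
proof (intro equalityI subsetI)
  have pq: "p \<in> carrier G" "q \<in> carrier G" using entry_closed assms by auto
  fix y assume "y \<in> local_part S (Some (i, inv p, l)) (Some (j, inv q, k))"
  then obtain x where x: "x \<in> carrier S" "y = Some (i, inv p, l) \<cdot>\<^bsub>S\<^esub> x \<cdot>\<^bsub>S\<^esub> Some (j, inv q, k)"
    by (auto simp: local_part_def)
  from x(1) show "y \<in> insert None {Some (i, g, k) | g. g \<in> carrier G}"
    by (cases rule: rees_carrierE) (use x(2) assms pq in \<open>auto simp: entry_closed split: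
        option.splits\<close>)
next
  have pq: "p \<in> carrier G" "q \<in> carrier G" using entry_closed assms by auto
  fix y assume "y \<in> insert None {Some (i, g, k) | g. g \<in> carrier G}"
  then have "y \<in> carrier S \<and> y = Some (i, inv p, l) \<cdot>\<^bsub>S\<^esub> y \<cdot>\<^bsub>S\<^esub> Some (j, inv q, k)"
    using assms pq by (auto simp: m_assoc)
  then show "y \<in> local_part S (Some (i, inv p, l)) (Some (j, inv q, k))" unfolding local_part_def
      by blast
qed

definition actL ::
    "'l option \<Rightarrow> 'a option \<Rightarrow> 'l option \<Rightarrow> ('i \<times> 'a \<times> 'l) option \<Rightarrow> ('i \<times> 'a \<times> 'l) option" where
  "actL c h d = (\<lambda>x\<in>obL G I c. case (x, h, d) of
     (Some (i, a, l), Some g, Some k) \<Rightarrow> Some (i, a \<otimes> g, k) | _ \<Rightarrow> None)"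

definition actR ::
    "'i option \<Rightarrow> 'a option \<Rightarrow> 'i option \<Rightarrow> ('i \<times> 'a \<times> 'l) option \<Rightarrow> ('i \<times> 'a \<times> 'l) option" where
  "actR c h d = (\<lambda>x\<in>obR G L c. case (x, h, d) of
     (Some (i, a, l), Some g, Some j) \<Rightarrow> Some (j, g \<otimes> a, l) | _ \<Rightarrow> None)"

lemma coordL_simps: "FObj (coordL G I) = obL G I"
    "FArr (coordL G I) (c, h, d) = (obL G I c, actL c h d, obL G I d)"
  by (auto simp: coordL_def actL_def intro!: restrict_ext split: option.splits)

lemma coordR_simps: "FObj (coordR G L) = obR G L"
    "FArr (coordR G L) (c, h, d) = (obR G L c, actR c h d, obR G L d)"
  by (auto simp: coordR_def actR_def intro!: restrict_ext split: option.splits)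

lemma act_None: "actL c None d = (\<lambda>x\<in>obL G I c. None)" "actR i None j = (\<lambda>x\<in>obR G L i. None)"
  by (auto simp: actL_def actR_def restrict_def split: option.splits)

lemma act_Some:
  "i \<in> I \<Longrightarrow> a \<in> carrier G \<Longrightarrow> actL (Some l) (Some g) (Some k) (Some (i, a, l)) = Some (i, a \<otimes> g, k)"
  "l \<in> L \<Longrightarrow> a \<in> carrier G \<Longrightarrow> actR (Some i) (Some g) (Some j) (Some (i, a, l)) = Some (j, g \<otimes> a, l)"
  "actL c h d None = None" "actR c' h d' None = None"
  by (simp_all add: actL_def actR_def)

lemma actL_eqI:
  assumes "f \<in> extensional (obL G I (Some l))" "f None = None"
    "\<And>i a. i \<in> I \<Longrightarrow> a \<in> carrier G \<Longrightarrow> f (Some (i, a, l)) = Some (i, a \<otimes> g, k)"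
  shows "f = actL (Some l) (Some g) (Some k)"
  by (rule extensionalityI[OF assms(1)]) (auto simp: assms(2,3) act_Some elim!: obLE, simp add:
      actL_def)

lemma actR_eqI:
  assumes "f \<in> extensional (obR G L (Some i))" "f None = None"
    "\<And>l a. l \<in> L \<Longrightarrow> a \<in> carrier G \<Longrightarrow> f (Some (i, a, l)) = Some (j, g \<otimes> a, l)"
  shows "f = actR (Some i) (Some g) (Some j)"
  by (rule extensionalityI[OF assms(1)]) (auto simp: assms(2,3) act_Some elim!: obRE, simp add:
      actR_def)

text \<open>Each index l occurs because row l of \<open>P\<close> has a nonzero entry, which yields
  an idempotent with last index l.\<close>

lemma left_ideals_eq: "left_ideal S ` idems S = obL G I ` with_zero L"
proof (intro equalityI subsetI)
  fix x assume "x \<in> left_ideal S ` idems S"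
  then show "x \<in> obL G I ` with_zero L"
    using left_ideal_None left_ideal_Some unfolding idems_rees by auto
next
  fix x assume "x \<in> obL G I ` with_zero L"
  then consider "x = obL G I None" | l where "x = obL G I (Some l)" "l \<in> L"
      by (auto simp: with_zero_def)
  then show "x \<in> left_ideal S ` idems S"
  proof cases
    case 1
    then have "x = left_ideal S None" "None \<in> idems S" by (simp_all add: left_ideal_None idems_rees)
    then show ?thesis by (rule image_eqI)
  next
    case 2
    obtain i p where "i \<in> I" "P l i = Some p" using rowE[OF 2(2)] .
    then have "x = left_ideal S (Some (i, inv p, l))" "Some (i, inv p, l) \<in> idems S"
      using 2 left_ideal_Some by (auto simp: idems_rees)
    then show ?thesis by (rule image_eqI)
  qed
qed

lemma right_ideals_eq: "right_ideal S ` idems S = obR G L ` with_zero I"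
proof (intro equalityI subsetI)
  fix x assume "x \<in> right_ideal S ` idems S"
  then show "x \<in> obR G L ` with_zero I"
    using right_ideal_None right_ideal_Some unfolding idems_rees by auto
next
  fix x assume "x \<in> obR G L ` with_zero I"
  then consider "x = obR G L None" | i where "x = obR G L (Some i)" "i \<in> I"
      by (auto simp: with_zero_def)
  then show "x \<in> right_ideal S ` idems S"
  proof cases
    case 1
    then have "x = right_ideal S None" "None \<in> idems S"
        by (simp_all add: right_ideal_None idems_rees)
    then show ?thesis by (rule image_eqI)
  next
    case 2
    obtain l p where "l \<in> L" "P l i = Some p" using colE[OF 2(2)] .
    then have "x = right_ideal S (Some (i, inv p, l))" "Some (i, inv p, l) \<in> idems S"
      using 2 right_ideal_Some by (auto simp: idems_rees)
    then show ?thesis by (rule image_eqI)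
  qed
qed

lemma Arr_LL: "Arr (LL S) = FArr (coordL G I) ` zarr G L"
proof (intro equalityI subsetI)
  fix t assume "t \<in> Arr (LL S)"
  then obtain e u f where t: "t = (left_ideal S e, \<lambda>x\<in>left_ideal S e. x \<cdot>\<^bsub>S\<^esub> u, left_ideal S f)"
    and e: "e \<in> idems S" and f: "f \<in> idems S" and u: "u \<in> local_part S e f"
    by (auto simp: LL_def ideal_cat_def)
  obtain c where c: "c \<in> with_zero L" "left_ideal S e = obL G I c"
    using e left_ideals_eq by blast
  obtain d where d: "d \<in> with_zero L" "left_ideal S f = obL G I d"
    using f left_ideals_eq by blast
  show "t \<in> FArr (coordL G I) ` zarr G L"
  proof (cases "u = None")
    case True
    then have "t = FArr (coordL G I) (c, None, d)"
      unfolding t c d coordL_simps act_None by simp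
    moreover have "(c, None, d) \<in> zarr G L" using c d by (simp add: zarr_def)
    ultimately show ?thesis by (rule image_eqI)
  next
    case False
    then obtain i l p j k q where ef: "e = Some (i, inv p, l)" "i \<in> I" "l \<in> L" "P l i = Some p"
      "f = Some (j, inv q, k)" "j \<in> I" "k \<in> L" "P k j = Some q"
      using e f u local_part_None unfolding idems_rees by auto
    have p: "p \<in> carrier G" using entry_closed ef by blast
    obtain g where g: "g \<in> carrier G" "u = Some (i, g, k)"
      using u False local_part_Some[of i l p j k q] ef by auto
    \<comment> \<open>Right multiplication by (i, g, k) sends (i', a, l) to (i', apg, k), so the
      entry p of the domain idempotent is absorbed into the label.\<close>
    have "(\<lambda>x\<in>obL G I (Some l). x \<cdot>\<^bsub>S\<^esub> u) = actL (Some l) (Some (p \<otimes> g)) (Some k)"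
      by (rule actL_eqI) (use ef g p in \<open>auto simp: m_assoc\<close>)
    then have "t = FArr (coordL G I) (Some l, Some (p \<otimes> g), Some k)"
      unfolding t coordL_simps using ef left_ideal_Some by simp
    moreover have "(Some l, Some (p \<otimes> g), Some k) \<in> zarr G L" using ef g p by (simp add: zarr_def)
    ultimately show ?thesis by (rule image_eqI)
  qed
next
  fix t assume "t \<in> FArr (coordL G I) ` zarr G L"
  then obtain c h d where z: "(c, h, d) \<in> zarr G L" and t: "t = FArr (coordL G I) (c, h, d)" by auto
  have mem: "t \<in> Arr (LL S)" if "e \<in> idems S" "f \<in> idems S" "u \<in> local_part S e f"
    "t = (left_ideal S e, \<lambda>x\<in>left_ideal S e. x \<cdot>\<^bsub>S\<^esub> u, left_ideal S f)" for e f u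
    using that by (auto simp: LL_def ideal_cat_def)
  show "t \<in> Arr (LL S)"
  proof (cases h)
    case None
    have "obL G I c \<in> left_ideal S ` idems S" "obL G I d \<in> left_ideal S ` idems S"
      using z unfolding left_ideals_eq by (auto simp: zarr_def)
    then obtain e f where e: "e \<in> idems S" "left_ideal S e = obL G I c"
      and f: "f \<in> idems S" "left_ideal S f = obL G I d" by (elim imageE) simp
    have "None \<in> local_part S e f" by (auto simp: local_part_def intro: exI[of _ None])
    then show ?thesis
      by (rule mem[OF e(1) f(1)]) (simp add: t None coordL_simps act_None e f)
  next
    case (Some g)
    then obtain l k where cd: "c = Some l" "l \<in> L" "d = Some k" "k \<in> L" and g: "g \<in> carrier G"
      using z by (cases c; cases d) (auto simp: zarr_def)
    obtain i p where i: "i \<in> I" "P l i = Some p" "p \<in> carrier G" using rowE[OF cd(2)] .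
    obtain j q where j: "j \<in> I" "P k j = Some q" "q \<in> carrier G" using rowE[OF cd(4)] .
    \<comment> \<open>The factor p^-1 compensates the entry met in the product, so that right
      multiplication by this element has label g.\<close>
    have u: "Some (i, inv p \<otimes> g, k) \<in> local_part S (Some (i, inv p, l)) (Some (j, inv q, k))"
      using local_part_Some[of i l p j k q] i j cd g by auto
    have "(\<lambda>x\<in>obL G I (Some l). x \<cdot>\<^bsub>S\<^esub> Some (i, inv p \<otimes> g, k)) = actL (Some l) (Some g) (Some k)"
    proof (rule actL_eqI)
      fix i' a assume a: "i' \<in> I" "a \<in> carrier G"
      have "p \<otimes> (inv p \<otimes> g) = g" using g i by (simp flip: m_assoc)
      then have "a \<otimes> p \<otimes> (inv p \<otimes> g) = a \<otimes> g" using a g i by (simp add: m_assoc)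
      then show "(\<lambda>x\<in>obL G I (Some l). x \<cdot>\<^bsub>S\<^esub> Some (i, inv p \<otimes> g, k)) (Some (i', a, l)) =
          Some (i', a \<otimes> g, k)"
        using a g i by simp
    qed auto
    moreover have "Some (i, inv p, l) \<in> idems S" "Some (j, inv q, k) \<in> idems S"
      using i j cd unfolding idems_rees by blast+
    moreover have "left_ideal S (Some (i, inv p, l)) = obL G I c"
        "left_ideal S (Some (j, inv q, k)) = obL G I d"
      using left_ideal_Some i j cd by simp_all
    ultimately show ?thesis
      by (intro mem[OF _ _ u]) (simp_all add: t Some coordL_simps cd)
  qed
qed

lemma Arr_RR: "Arr (RR S) = FArr (coordR G L) ` zarr G I"
proof (intro equalityI subsetI)
  fix t assume "t \<in> Arr (RR S)"
  then obtain e u f where t: "t = (right_ideal S e, \<lambda>x\<in>right_ideal S e. u \<cdot>\<^bsub>S\<^esub> x, right_ideal S f)"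
    and e: "e \<in> idems S" and f: "f \<in> idems S" and u: "u \<in> local_part S f e"
    by (auto simp: RR_def ideal_cat_def)
  obtain c where c: "c \<in> with_zero I" "right_ideal S e = obR G L c"
    using e right_ideals_eq by blast
  obtain d where d: "d \<in> with_zero I" "right_ideal S f = obR G L d"
    using f right_ideals_eq by blast
  show "t \<in> FArr (coordR G L) ` zarr G I"
  proof (cases "u = None")
    case True
    then have "t = FArr (coordR G L) (c, None, d)"
      unfolding t c d coordR_simps act_None by (auto simp: fun_eq_iff)
    moreover have "(c, None, d) \<in> zarr G I" using c d by (simp add: zarr_def)
    ultimately show ?thesis by (rule image_eqI)
  next
    case False
    then obtain i l p j k q where ef: "e = Some (i, inv p, l)" "i \<in> I" "l \<in> L" "P l i = Some p"
      "f = Some (j, inv q, k)" "j \<in> I" "k \<in> L" "P k j = Some q"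
      using e f u local_part_None unfolding idems_rees by auto
    have p: "p \<in> carrier G" using entry_closed ef by blast
    obtain g where g: "g \<in> carrier G" "u = Some (j, g, l)"
      using u False local_part_Some[of j k q i l p] ef by auto
    \<comment> \<open>Left multiplication by (j, g, l) sends (i, a, l') to (j, gpa, l'), so here the
      entry is absorbed on the right of the label.\<close>
    have "(\<lambda>x\<in>obR G L (Some i). u \<cdot>\<^bsub>S\<^esub> x) = actR (Some i) (Some (g \<otimes> p)) (Some j)"
      by (rule actR_eqI) (use ef g p in auto)
    then have "t = FArr (coordR G L) (Some i, Some (g \<otimes> p), Some j)"
      unfolding t coordR_simps using ef right_ideal_Some by simp
    moreover have "(Some i, Some (g \<otimes> p), Some j) \<in> zarr G I" using ef g p by (simp add: zarr_def)
    ultimately show ?thesis by (rule image_eqI)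
  qed
next
  fix t assume "t \<in> FArr (coordR G L) ` zarr G I"
  then obtain c h d where z: "(c, h, d) \<in> zarr G I" and t: "t = FArr (coordR G L) (c, h, d)" by auto
  have mem: "t \<in> Arr (RR S)" if "e \<in> idems S" "f \<in> idems S" "u \<in> local_part S f e"
    "t = (right_ideal S e, \<lambda>x\<in>right_ideal S e. u \<cdot>\<^bsub>S\<^esub> x, right_ideal S f)" for e f u
    using that by (auto simp: RR_def ideal_cat_def)
  show "t \<in> Arr (RR S)"
  proof (cases h)
    case None
    have "obR G L c \<in> right_ideal S ` idems S" "obR G L d \<in> right_ideal S ` idems S"
      using z unfolding right_ideals_eq by (auto simp: zarr_def)
    then obtain e f where e: "e \<in> idems S" "right_ideal S e = obR G L c"
      and f: "f \<in> idems S" "right_ideal S f = obR G L d" by (elim imageE) simp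
    have "None \<in> local_part S f e" by (auto simp: local_part_def intro: exI[of _ None])
    then show ?thesis
      by (rule mem[OF e(1) f(1)]) (simp add: t None coordR_simps act_None e f)
  next
    case (Some g)
    then obtain i j where cd: "c = Some i" "i \<in> I" "d = Some j" "j \<in> I" and g: "g \<in> carrier G"
      using z by (cases c; cases d) (auto simp: zarr_def)
    obtain l p where i: "l \<in> L" "P l i = Some p" "p \<in> carrier G" using colE[OF cd(2)] .
    obtain k q where j: "k \<in> L" "P k j = Some q" "q \<in> carrier G" using colE[OF cd(4)] .
    have u: "Some (j, g \<otimes> inv p, l) \<in> local_part S (Some (j, inv q, k)) (Some (i, inv p, l))"
      using local_part_Some[of j k q i l p] i j cd g by auto
    have "(\<lambda>x\<in>obR G L (Some i). Some (j, g \<otimes> inv p, l) \<cdot>\<^bsub>S\<^esub> x) = actR (Some i) (Some g) (Some j)"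
      by (rule actR_eqI) (use i g in \<open>auto simp: m_assoc\<close>)
    moreover have "Some (i, inv p, l) \<in> idems S" "Some (j, inv q, k) \<in> idems S"
      using i j cd unfolding idems_rees by blast+
    moreover have "right_ideal S (Some (i, inv p, l)) = obR G L c"
        "right_ideal S (Some (j, inv q, k)) = obR G L d"
      using right_ideal_Some i j cd by simp_all
    ultimately show ?thesis
      by (intro mem[OF _ _ u]) (simp_all add: t Some coordR_simps cd)
  qed
qed

lemma LL_eq: "LL S = ideal_cat (FObj (coordL G I) ` with_zero L) (FArr (coordL G I) ` zarr G L)"
  unfolding Arr_LL[symmetric] coordL_simps LL_def left_ideals_eq by (simp add: Arr_ideal_cat)

lemma RR_eq: "RR S = ideal_cat (FObj (coordR G L) ` with_zero I) (FArr (coordR G L) ` zarr G I)"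
  unfolding Arr_RR[symmetric] coordR_simps RR_def right_ideals_eq by (simp add: Arr_ideal_cat)

lemma coordinatised_LL: "coordinatised G L (LL S) (coordL G I)"
  unfolding LL_eq
proof (rule coordinatised_ideal_cat[where act = actL])
  obtain i where i: "i \<in> I" using I_nonempty by auto
  show "group G" by (rule group_axioms)
  show "FArr (coordL G I) (c, h, d) = (FObj (coordL G I) c, actL c h d, FObj (coordL G I) d)"
      for c h d
    by (simp add: coordL_simps)
  show "FObj (coordL G I) c \<subseteq> FObj (coordL G I) d \<longleftrightarrow> c = None \<or> c = d" for c d
  proof
    assume sub: "FObj (coordL G I) c \<subseteq> FObj (coordL G I) d"
    show "c = None \<or> c = d"
    proof (cases c)
      case (Some l)
      \<comment> \<open>A test point in the ideal of l; the last index l tells this ideal apart from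
        all the others.\<close>
      then have "Some (i, \<one>, l) \<in> obL G I c" using i by simp
      then have "Some (i, \<one>, l) \<in> obL G I d" using sub unfolding coordL_simps by (rule rev_subsetD)
      then show ?thesis using Some by simp
    qed simp
  qed (auto simp: coordL_simps elim!: obLE)
  show "h = h'" if z: "(c, h, d) \<in> zarr G L" "(c, h', d) \<in> zarr G L"
      and eq: "actL c h d = actL c h' d" for c h h' d
  proof (cases "c = None \<or> d = None")
    case True
    then show ?thesis using z by (auto simp: zarr_def)
  next
    case False
    then obtain l k where cd: "c = Some l" "d = Some k" by auto
    \<comment> \<open>Evaluated at the triple with middle coordinate 1, the map returns its own
      label.\<close>
    have "actL c h d (Some (i, \<one>, l)) = actL c h' d (Some (i, \<one>, l))" by (simp add: eq)
    then show ?thesis using i z by (cases h; cases h') (auto simp: cd act_Some act_None zarr_def)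
  qed
  show "actL c (if c = None then None else Some \<one>) d = (\<lambda>x\<in>FObj (coordL G I) c. x)"
    if "c \<in> with_zero L" "d \<in> with_zero L" "c = None \<or> c = d" for c d
  proof (cases c)
    case None
    then show ?thesis by (auto simp: act_None coordL_simps intro!: restrict_ext elim!: obLE)
  next
    case (Some l)
    then show ?thesis using that by (auto simp: coordL_simps intro!: actL_eqI[symmetric])
  qed
  show "actL a (zmult G g h) c = compose (FObj (coordL G I) a) (actL b h c) (actL a g b)"
    if z: "(a, g, b) \<in> zarr G L" "(b, h, c) \<in> zarr G L" for a g b h c
  proof (cases "g = None \<or> h = None")
    case True
    have "actL b h c None = None" by (simp add: act_Some)
    moreover have "actL a g b x \<in> obL G I b" if "x \<in> obL G I a" for x
      using that z by (cases g; cases b) (auto simp: actL_def zarr_def elim!: obLE)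
    ultimately show ?thesis
      using True by (auto simp: compose_def coordL_simps act_None intro!: restrict_ext)
  next
    case False
    then obtain l k m x y where "a = Some l" "b = Some k" "c = Some m" "g = Some x" "h = Some y"
      using z by (cases a; cases b; cases c) (auto simp: zarr_def)
    then show ?thesis
      using z by (auto simp: coordL_simps compose_def act_Some m_assoc zarr_def intro!:
          actL_eqI[symmetric])
  qed
qed

text \<open>Labels now act from the left, so the composite of g and then h has label hg, which is
  the product in the opposite group.\<close>

lemma coordinatised_RR: "coordinatised (opp G) I (RR S) (coordR G L)"
  unfolding RR_eq zarr_opp[of G I, symmetric]
proof (rule coordinatised_ideal_cat[where act = actR])
  obtain l where l: "l \<in> L" using L_nonempty by auto
  show "group (opp G)" by (rule group_opp)
  show "FArr (coordR G L) (c, h, d) = (FObj (coordR G L) c, actR c h d, FObj (coordR G L) d)"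
      for c h d
    by (simp add: coordR_simps)
  show "FObj (coordR G L) c \<subseteq> FObj (coordR G L) d \<longleftrightarrow> c = None \<or> c = d" for c d
  proof
    assume sub: "FObj (coordR G L) c \<subseteq> FObj (coordR G L) d"
    show "c = None \<or> c = d"
    proof (cases c)
      case (Some i)
      then have "Some (i, \<one>, l) \<in> obR G L c" using l by simp
      then have "Some (i, \<one>, l) \<in> obR G L d" using sub unfolding coordR_simps by (rule rev_subsetD)
      then show ?thesis using Some by simp
    qed simp
  qed (auto simp: coordR_simps elim!: obRE)
  show "h = h'" if z: "(c, h, d) \<in> zarr (opp G) I" "(c, h', d) \<in> zarr (opp G) I"
      and eq: "actR c h d = actR c h' d" for c h h' d
  proof (cases "c = None \<or> d = None")
    case True
    then show ?thesis using z by (auto simp: zarr_def)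
  next
    case False
    then obtain i k where cd: "c = Some i" "d = Some k" by auto
    have "actR c h d (Some (i, \<one>, l)) = actR c h' d (Some (i, \<one>, l))" by (simp add: eq)
    then show ?thesis using l z by (cases h; cases h') (auto simp: cd act_Some act_None zarr_def)
  qed
  show "actR c (if c = None then None else Some \<one>\<^bsub>opp G\<^esub>) d = (\<lambda>x\<in>FObj (coordR G L) c. x)"
    if "c \<in> with_zero I" "d \<in> with_zero I" "c = None \<or> c = d" for c d
  proof (cases c)
    case None
    then show ?thesis by (auto simp: act_None coordR_simps intro!: restrict_ext elim!: obRE)
  next
    case (Some i)
    then show ?thesis using that by (auto simp: coordR_simps intro!: actR_eqI[symmetric])
  qed
  show "actR a (zmult (opp G) g h) c = compose (FObj (coordR G L) a) (actR b h c) (actR a g b)"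
    if z: "(a, g, b) \<in> zarr (opp G) I" "(b, h, c) \<in> zarr (opp G) I" for a g b h c
  proof (cases "g = None \<or> h = None")
    case True
    have "actR b h c None = None" by (simp add: act_Some)
    moreover have "actR a g b x \<in> obR G L b" if "x \<in> obR G L a" for x
      using that z by (cases g; cases b) (auto simp: actR_def zarr_def elim!: obRE)
    ultimately show ?thesis
      using True by (auto simp: compose_def coordR_simps act_None intro!: restrict_ext)
  next
    case False
    then obtain i k m x y where "a = Some i" "b = Some k" "c = Some m" "g = Some x" "h = Some y"
      using z by (cases a; cases b; cases c) (auto simp: zarr_def)
    then show ?thesis
      using z by (auto simp: zmult_opp coordR_simps compose_def act_Some m_assoc zarr_def intro!:
          actR_eqI[symmetric])
  qed
qed

end

section \<open>Isomorphisms between coordinatised categories, and the conclusion\<close>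

lemma coordinatised_catC:
  assumes "group G"
  shows "coordinatised G L (catC G L) id_coord"
  using assms
  by (intro coordinatised.intro coordinatised_axioms.intro) (auto simp: catC_def id_coord_def
      zid_def inj_on_def)

text \<open>The isomorphism reads off coordinates with one map and reinserts them with the other. It
  carries \<open>LL\<close> or \<open>RR\<close> of a Rees matrix semigroup to any category with the
  same coordinates.\<close>

lemma coordinatised_isomorphic:
  assumes "coordinatised G L C \<Phi>" "coordinatised G L D \<Psi>"
  shows "isomorphic_with_subobjects C D"
proof -
  interpret C: coordinatised G L C \<Phi> by fact
  interpret D: coordinatised G L D \<Psi> by fact
  define F where "F = \<lparr>FObj = (\<lambda>x\<in>Obj C. D.ob (inv_into (with_zero L) C.ob x)),
    FArr = (\<lambda>f\<in>Arr C. FArr \<Psi> (inv_into (zarr G L) (FArr \<Phi>) f))\<rparr>"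
  have Fo: "FObj F (C.ob a) = D.ob a" if "a \<in> with_zero L" for a
    using that C.inj_ob by (simp add: F_def)
  have Fa: "FArr F (C.ar a g b) = D.ar a g b" if "(a, g, b) \<in> zarr G L" for a g b
    using that C.inj_ar C.ar_in_Arr by (simp add: F_def)
  have Fa': "FArr F (FArr \<Phi> t) = FArr \<Psi> t" if "t \<in> zarr G L" for t
    using that Fa by (cases t) auto
  have "is_functor C D F"
    unfolding is_functor_def
  proof (intro conjI ballI impI)
    show "is_category C" "is_category D" by (rule C.is_category D.is_category)+
    show "FObj F \<in> Obj C \<rightarrow>\<^sub>E Obj D"
      by (rule PiE_I) (auto simp: Fo elim!: C.ObjE, simp add: F_def)
    show "FArr F \<in> Arr C \<rightarrow>\<^sub>E Arr D"
      by (rule PiE_I) (auto simp: Fa D.ar_in_Arr elim!: C.ArrE, simp add: F_def)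
    fix f assume "f \<in> Arr C"
    then obtain a g b where f: "(a, g, b) \<in> zarr G L" "f = C.ar a g b" by (rule C.ArrE)
    then have ab: "a \<in> with_zero L" "b \<in> with_zero L" by (auto simp: zarr_def)
    show "Dom D (FArr F f) = FObj F (Dom C f)" "Cod D (FArr F f) = FObj F (Cod C f)"
      using f ab by (simp_all add: Fa Fo C.Dom_ar C.Cod_ar D.Dom_ar D.Cod_ar)
    fix f' assume "f' \<in> Arr C"
    then obtain a' g' b' where f': "(a', g', b') \<in> zarr G L" "f' = C.ar a' g' b'" by (rule C.ArrE)
    then have ab': "a' \<in> with_zero L" by (auto simp: zarr_def)
    assume "Cod C f = Dom C f'"
    then have "a' = b" using f f' ab ab' by (simp add: C.Dom_ar C.Cod_ar)
    then show "FArr F (f \<Zsemi>\<^bsub>C\<^esub> f') = FArr F f \<Zsemi>\<^bsub>D\<^esub> FArr F f'"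
      using f f' C.Cmp_closed[of a g b g' b'] by (simp add: Fa C.Cmp_ar D.Cmp_ar)
  next
    fix x assume "x \<in> Obj C"
    then show "FArr F (Id C x) = Id D (FObj F x)"
      by (auto simp: Fo C.Id_ob D.Id_ob zid_def Fa zarr_def elim!: C.ObjE)
  qed
  moreover have "bij_betw (FObj F) (Obj C) (Obj D)"
    using C.inj_ob D.inj_ob
    by (auto simp: bij_betw_def inj_on_def C.Obj_eq D.Obj_eq Fo image_image cong: image_cong)
  moreover have "bij_betw (FArr F) (Arr C) (Arr D)"
    unfolding bij_betw_def C.Arr_eq D.Arr_eq
  proof
    show "inj_on (FArr F) (FArr \<Phi> ` zarr G L)"
      by (rule inj_onI) (auto simp: Fa)
    show "FArr F ` FArr \<Phi> ` zarr G L = FArr \<Psi> ` zarr G L"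
      unfolding image_image by (rule image_cong[OF refl]) (rule Fa')
  qed
  moreover have "FArr F ` Inc C = Inc D"
    unfolding C.Inc_eq D.Inc_eq image_image
    by (rule image_cong[OF refl]) (rule Fa', auto simp: zid_def zarr_def)
  ultimately show ?thesis unfolding isomorphic_with_subobjects_def is_cat_iso_def by blast
qed

context rees_matrix
begin

lemma completely_unambiguous_left:
  assumes "coordinatised G L C \<Phi>"
  shows "completely_unambiguous TYPE(('i \<times> 'a \<times> 'l) option) C"
  unfolding completely_unambiguous_def
  using coordinatised.unambiguous[OF assms] completely_0_simple_rees
    coordinatised_isomorphic[OF assms coordinatised_LL] by blast

lemma completely_unambiguous_right:
  assumes "coordinatised (opp G) I C \<Phi>"
  shows "completely_unambiguous TYPE(('i \<times> 'a \<times> 'l) option) C"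
  unfolding completely_unambiguous_def
  using coordinatised.unambiguous[OF assms] completely_0_simple_rees
    coordinatised_isomorphic[OF assms coordinatised_RR] by blast

text \<open>Stated for arbitrary coordinates, so that it yields the cross-connection both for the
  ideal categories and for \<open>catC\<close> and \<open>catD\<close>.\<close>

lemma matrix_cross_connection:
  fixes C :: "('o, 'm) cat" and D :: "('p, 'n) cat"
  assumes "coordinatised G L C \<Phi>" "coordinatised (opp G) I D \<Psi>"
  shows "\<exists>\<Gamma> \<Delta>. is_Gamma_P G I L P C \<Phi> D \<Psi> \<Gamma> \<and> is_Delta_P G I L P C \<Phi> D \<Psi> \<Delta> \<and>
    (\<forall>\<Gamma>'. is_Gamma_P G I L P C \<Phi> D \<Psi> \<Gamma>' \<longrightarrow> \<Gamma>' = \<Gamma>) \<and>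
    (\<forall>\<Delta>'. is_Delta_P G I L P C \<Phi> D \<Psi> \<Delta>' \<longrightarrow> \<Delta>' = \<Delta>) \<and>
    cross_connection C D \<Gamma> \<Delta> \<and> sgrp_isomorphic (cc_semigroup C D \<Gamma> \<Delta>) S"
proof -
  interpret sandwich_pair G L C \<Phi> I D \<Psi> P
    using assms I_nonempty L_nonempty regular
    by (intro sandwich_pair.intro sandwich.intro sandwich_axioms.intro sandwich_pair_axioms.intro)
      (auto simp: regular_matrix_def)
  have Delta: "is_Delta_P G I L P C \<Phi> D \<Psi> = T.is_Gamma"
    by (rule is_Delta_P_eq_is_Gamma_P[OF group_axioms]) (use P_closed in blast)
  obtain \<Gamma> where \<Gamma>: "is_Gamma \<Gamma>" using Gamma_exists by blast
  obtain \<Delta> where \<Delta>: "T.is_Gamma \<Delta>" using T.Gamma_exists by blast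
  show ?thesis
    unfolding Delta
    using \<Gamma> \<Delta> Gamma_unique T.Gamma_unique cross_connection[OF \<Gamma> \<Delta>] cc_semigroup_isomorphic[OF \<Gamma> \<Delta>]
        by blast
qed

end

theorem theorem4p1:
  fixes G :: "('g, 'x) monoid_scheme" and I :: "'i set" and L :: "'l set"
  assumes "group G" and "I \<noteq> {}" and "L \<noteq> {}"
  shows
    "(\<forall>P. regular_matrix G I L P \<longrightarrow>
        (let S = rees G I L P in
         completely_unambiguous TYPE(('i \<times> 'g \<times> 'l) option) (LL S) \<and>
         completely_unambiguous TYPE(('i \<times> 'g \<times> 'l) option) (RR S) \<and>
         (\<exists>\<Gamma> \<Delta>.
            is_Gamma_P G I L P (LL S) (coordL G I) (RR S) (coordR G L) \<Gamma> \<and>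
            is_Delta_P G I L P (LL S) (coordL G I) (RR S) (coordR G L) \<Delta> \<and>
            (\<forall>\<Gamma>'. is_Gamma_P G I L P (LL S) (coordL G I) (RR S) (coordR G L) \<Gamma>' \<longrightarrow> \<Gamma>' = \<Gamma>) \<and>
            (\<forall>\<Delta>'. is_Delta_P G I L P (LL S) (coordL G I) (RR S) (coordR G L) \<Delta>' \<longrightarrow> \<Delta>' = \<Delta>) \<and>
            cross_connection (LL S) (RR S) \<Gamma> \<Delta>)))
     \<and>
     (let C = catC G L; D = catD G I in
      completely_unambiguous TYPE(('i \<times> 'g \<times> 'l) option) C \<and>
      completely_unambiguous TYPE(('i \<times> 'g \<times> 'l) option) D \<and>
      (\<forall>P. regular_matrix G I L P \<longrightarrow>
         (\<exists>\<Gamma> \<Delta>.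
            is_Gamma_P G I L P C id_coord D id_coord \<Gamma> \<and>
            is_Delta_P G I L P C id_coord D id_coord \<Delta> \<and>
            (\<forall>\<Gamma>'. is_Gamma_P G I L P C id_coord D id_coord \<Gamma>' \<longrightarrow> \<Gamma>' = \<Gamma>) \<and>
            (\<forall>\<Delta>'. is_Delta_P G I L P C id_coord D id_coord \<Delta>' \<longrightarrow> \<Delta>' = \<Delta>) \<and>
            cross_connection C D \<Gamma> \<Delta> \<and>
            completely_0_simple (rees G I L P) \<and>
            sgrp_isomorphic (cc_semigroup C D \<Gamma> \<Delta>) (rees G I L P))))"
proof -
  interpret group G by fact
  have R: "rees_matrix G I L P" if "regular_matrix G I L P" for P
    using that assms by (intro rees_matrix.intro rees_matrix_axioms.intro)
  \<comment> \<open>\<open>catC\<close> and \<open>catD\<close> are claimed to be completely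
    unambiguous before any matrix is given; the matrix with all entries 1 supplies the completely
    0-simple semigroup for this.\<close>
  have "regular_matrix G I L (\<lambda>l i. Some \<one>\<^bsub>G\<^esub>)"
    using assms by (auto simp: regular_matrix_def)
  note ones = R[OF this]
  note C = coordinatised_catC[OF assms(1), of L]
  have D: "coordinatised (opp G) I (catD G I) id_coord"
    unfolding catD_eq_catC_opp by (rule coordinatised_catC[OF group_opp])
  show ?thesis
    unfolding Let_def
  proof (intro conjI allI impI, goal_cases)
    case (1 P)
    then interpret rees_matrix G I L P by (rule R)
    show ?case by (rule completely_unambiguous_left[OF coordinatised_LL])
  next
    case (2 P)
    then interpret rees_matrix G I L P by (rule R)
    show ?case by (rule completely_unambiguous_right[OF coordinatised_RR])
  next
    case (3 P)
    then interpret rees_matrix G I L P by (rule R)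
    show ?case
      using matrix_cross_connection[OF coordinatised_LL coordinatised_RR] by (elim exE conjE) (intro exI conjI)
  next
    case 4
    show ?case by (rule rees_matrix.completely_unambiguous_left[OF ones C])
  next
    case 5
    show ?case by (rule rees_matrix.completely_unambiguous_right[OF ones D])
  next
    case (6 P)
    then interpret rees_matrix G I L P by (rule R)
    show ?case
      using matrix_cross_connection[OF C D] completely_0_simple_rees by (elim exE conjE) (intro exI conjI)
  qed
qed

end
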